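(* (i) If $G$ is the octahedral group or the icosahedral group, then there exist real basis functions of $G$ which form a complete orthonormal system on $L_2$ of the unit sphere. (ii) If $G$ is the tetrahedral group, then there do not exist real basis functions of $G$ which form a complete orthonormal system on $L_2$ of the unit sphere.
   Context: The tetrahedral, octahedral and icosahedral groups are the rotational symmetry groups of the platonic solids centered at the origin of $\mathbb{R}^3$; $R_g\in\mathbb{R}^{3\times3}$ denotes the rotation matrix of $g\in G$, with $R_{gh}=R_gR_h$. Let $p=1,\dots,N_{\rm rep}$ index the inequivalent irreducible complex representations of $G$, with dimensions $d_p$; each is realized by unitary matrices $\Gamma^p(g)\in\mathbb{C}^{d_p\times d_p}$, $g\in G$ (the choice of unitary matrix form within the equivalence class being free, one form for each $p$). A basis function of $G$ for the $p$th irreducible representation is a $d_p$-dimensional vector function $I_{p;\zeta}=(I_{p;\zeta}[1],\dots,I_{p;\zeta}[d_p])^T$ on the unit sphere $S^2\subset\mathbb{R}^3$ with square-integrable components, orthonormal with respect to $(f,h)=\int_{S^2}\overline{f}\,h$ (surface measure), such that $$I_{p;\zeta}(R_g^{-1}\mathbf{x})=(\Gamma^p(g))^T I_{p;\zeta}(\mathbf{x})\quad\text{for all } g\in G.$$ It is real if it takes values in $\mathbb{R}^{d_p}$. A family of basis functions (over various $p$ and $\zeta$) forms a complete orthonormal system on $L_2$ if the collection of all scalar components $I_{p;\zeta}[j]$, $j=1,\dots,d_p$, of all members of the family is a complete orthonormal system in $L_2(S^2)$. *)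

theory Defs
  imports
    "HOL-Analysis.Analysis"
    "Jordan_Normal_Form.Schur_Decomposition"
begin

(* Vectors and matrices of fixed size 3 are those of HOL-Analysis (real^3, real^3^3); vectors and
   matrices whose size is a natural number are those of Jordan_Normal_Form ("mat", "carrier_vec"). *)

section \<open>Rotational symmetry groups of the platonic solids\<close>

definition rotational_symmetries :: "(real^3) set \<Rightarrow> (real^3^3) set" where
  "rotational_symmetries S = {A. rotation_matrix A \<and> (\<lambda>x. A *v x) ` S = S}"

definition similar_about_origin :: "(real^3) set \<Rightarrow> (real^3) set \<Rightarrow> bool" where
  "similar_about_origin S S' \<longleftrightarrow>
     (\<exists>c Q. c > 0 \<and> orthogonal_matrix Q \<and> S' = (\<lambda>x. c *\<^sub>R (Q *v x)) ` S)"

definition std_tetrahedron :: "(real^3) set" where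
  "std_tetrahedron = convex hull
     {vector [1, 1, 1], vector [1, -1, -1], vector [-1, 1, -1], vector [-1, -1, 1]}"

definition std_octahedron :: "(real^3) set" where
  "std_octahedron = convex hull
     {vector [1, 0, 0], vector [-1, 0, 0], vector [0, 1, 0], vector [0, -1, 0],
      vector [0, 0, 1], vector [0, 0, -1]}"

definition std_icosahedron :: "(real^3) set" where
  "std_icosahedron = (let \<phi> = (1 + sqrt 5) / 2 in convex hull
     (\<Union>a\<in>{-1, 1}. \<Union>b\<in>{-\<phi>, \<phi>}. {vector [0, a, b], vector [a, b, 0], vector [b, 0, a]}))"

(* The solids may have any size and any orientation. The cube and the dodecahedron, being dual to
   the octahedron and the icosahedron, give no further groups. *)

definition tetrahedral_group :: "(real^3^3) set \<Rightarrow> bool" where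
  "tetrahedral_group G \<longleftrightarrow>
     (\<exists>S. similar_about_origin std_tetrahedron S \<and> G = rotational_symmetries S)"

definition octahedral_group :: "(real^3^3) set \<Rightarrow> bool" where
  "octahedral_group G \<longleftrightarrow>
     (\<exists>S. similar_about_origin std_octahedron S \<and> G = rotational_symmetries S)"

definition icosahedral_group :: "(real^3^3) set \<Rightarrow> bool" where
  "icosahedral_group G \<longleftrightarrow>
     (\<exists>S. similar_about_origin std_icosahedron S \<and> G = rotational_symmetries S)"

section \<open>Irreducible complex matrix representations\<close>

(* A group element g is identified with its rotation matrix, so that R_g is g itself. *)

definition matrix_representation ::
    "(real^3^3) set \<Rightarrow> nat \<Rightarrow> (real^3^3 \<Rightarrow> complex mat) \<Rightarrow> bool" where
  "matrix_representation G d \<Gamma> \<longleftrightarrow>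
     (\<forall>g\<in>G. \<Gamma> g \<in> carrier_mat d d) \<and>
     \<Gamma> (Finite_Cartesian_Product.mat 1) = 1\<^sub>m d \<and>
     (\<forall>g\<in>G. \<forall>h\<in>G. \<Gamma> (g ** h) = \<Gamma> g * \<Gamma> h)"

definition irreducible_representation ::
    "(real^3^3) set \<Rightarrow> nat \<Rightarrow> (real^3^3 \<Rightarrow> complex mat) \<Rightarrow> bool" where
  "irreducible_representation G d \<Gamma> \<longleftrightarrow>
     matrix_representation G d \<Gamma> \<and> d > 0 \<and>
     (\<forall>W. VectorSpace.subspace class_ring W (module_vec TYPE(complex) d) \<and>
          (\<forall>g\<in>G. \<forall>w\<in>W. \<Gamma> g *\<^sub>v w \<in> W)
        \<longrightarrow> W = {0\<^sub>v d} \<or> W = carrier_vec d)"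

definition unitary_matrix :: "complex mat \<Rightarrow> bool" where
  "unitary_matrix A \<longleftrightarrow> inverts_mat A (mat_adjoint A) \<and> inverts_mat (mat_adjoint A) A"

definition equivalent_representations ::
    "(real^3^3) set \<Rightarrow> nat \<Rightarrow> (real^3^3 \<Rightarrow> complex mat) \<Rightarrow> nat \<Rightarrow> (real^3^3 \<Rightarrow> complex mat) \<Rightarrow> bool"
  where
  "equivalent_representations G d \<Gamma> d' \<Gamma>' \<longleftrightarrow>
     d = d' \<and>
     (\<exists>T\<in>carrier_mat d d. invertible_mat T \<and> (\<forall>g\<in>G. T * \<Gamma> g = \<Gamma>' g * T))"

(* One unitary matrix form for each equivalence class of irreducible representations of G. *)

definition unitary_irreps ::
    "(real^3^3) set \<Rightarrow> nat \<Rightarrow> (nat \<Rightarrow> nat) \<Rightarrow> (nat \<Rightarrow> real^3^3 \<Rightarrow> complex mat) \<Rightarrow> bool" where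
  "unitary_irreps G N d \<Gamma> \<longleftrightarrow>
     (\<forall>p<N. irreducible_representation G (d p) (\<Gamma> p) \<and> (\<forall>g\<in>G. unitary_matrix (\<Gamma> p g))) \<and>
     (\<forall>p<N. \<forall>q<N. p \<noteq> q \<longrightarrow> \<not> equivalent_representations G (d p) (\<Gamma> p) (d q) (\<Gamma> q)) \<and>
     (\<forall>d' \<Gamma>'. irreducible_representation G d' \<Gamma>' \<longrightarrow>
        (\<exists>p<N. equivalent_representations G (d p) (\<Gamma> p) d' \<Gamma>'))"

section \<open>The space \<open>L\<^sub>2\<close> of the unit sphere\<close>

(* Surface measure on the unit sphere: \<sigma>(A) = 3 vol {r u | u \<in> A, 0 < r < 1}, because
   vol {r u | u \<in> A, 0 < r < 1} = \<sigma>(A) \<integral>_0^1 r^2 dr. *)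

definition sphere_measure :: "(real^3) measure" where
  "sphere_measure = scale_measure 3
     (distr (restrict_space lborel (ball 0 1 - {0})) (restrict_space borel (sphere 0 1))
        (\<lambda>x. x /\<^sub>R norm x))"

(* Functions on the sphere are functions on real^3 of which only the values on the sphere matter. *)

definition sphere_L2 :: "(real^3 \<Rightarrow> complex) set" where
  "sphere_L2 = {f. f \<in> borel_measurable sphere_measure \<and>
                   integrable sphere_measure (\<lambda>x. (cmod (f x))\<^sup>2)}"

definition sphere_inner :: "(real^3 \<Rightarrow> complex) \<Rightarrow> (real^3 \<Rightarrow> complex) \<Rightarrow> complex" where
  "sphere_inner f h = (LINT x|sphere_measure. cnj (f x) * h x)"

definition orthonormal_system :: "'k set \<Rightarrow> ('k \<Rightarrow> real^3 \<Rightarrow> complex) \<Rightarrow> bool" where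
  "orthonormal_system K e \<longleftrightarrow>
     (\<forall>k\<in>K. e k \<in> sphere_L2) \<and>
     (\<forall>k\<in>K. \<forall>l\<in>K. sphere_inner (e k) (e l) = (if k = l then 1 else 0))"

(* Complete: the finite linear combinations are dense in the mean-square sense. *)

definition complete_orthonormal_system :: "'k set \<Rightarrow> ('k \<Rightarrow> real^3 \<Rightarrow> complex) \<Rightarrow> bool" where
  "complete_orthonormal_system K e \<longleftrightarrow>
     orthonormal_system K e \<and>
     (\<forall>f\<in>sphere_L2. \<forall>\<epsilon>>0. \<exists>S c. finite S \<and> S \<subseteq> K \<and>
        (LINT x|sphere_measure. (cmod (f x - (\<Sum>k\<in>S. c k * e k x)))\<^sup>2) < \<epsilon>)"

section \<open>Basis functions\<close>

definition basis_function ::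
    "(real^3^3) set \<Rightarrow> nat \<Rightarrow> (real^3^3 \<Rightarrow> complex mat) \<Rightarrow> (real^3 \<Rightarrow> complex Matrix.vec) \<Rightarrow> bool" where
  "basis_function G d \<Gamma> I \<longleftrightarrow>
     (\<forall>x\<in>sphere 0 1. I x \<in> carrier_vec d) \<and>
     orthonormal_system {..<d} (\<lambda>j x. vec_index (I x) j) \<and>
     (\<forall>g\<in>G. \<forall>x\<in>sphere 0 1. I (matrix_inv g *v x) = transpose_mat (\<Gamma> g) *\<^sub>v I x)"

definition real_on_sphere :: "(real^3 \<Rightarrow> complex Matrix.vec) \<Rightarrow> bool" where
  "real_on_sphere I \<longleftrightarrow> (\<forall>x\<in>sphere 0 1. \<forall>j<dim_vec (I x). vec_index (I x) j \<in> \<real>)"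

(* F p is the set of the members I_{p;\<zeta>} of the family that belong to the p-th representation.
   The scalar components are indexed by the triples (p, I, j). *)

definition complete_basis_family ::
    "(real^3^3) set \<Rightarrow> nat \<Rightarrow> (nat \<Rightarrow> nat) \<Rightarrow> (nat \<Rightarrow> real^3^3 \<Rightarrow> complex mat) \<Rightarrow>
     (nat \<Rightarrow> (real^3 \<Rightarrow> complex Matrix.vec) set) \<Rightarrow> bool" where
  "complete_basis_family G N d \<Gamma> F \<longleftrightarrow>
     (\<forall>p<N. \<forall>I\<in>F p. basis_function G (d p) (\<Gamma> p) I) \<and>
     complete_orthonormal_system {(p, I, j). p < N \<and> I \<in> F p \<and> j < d p}
       (\<lambda>(p, I, j) x. vec_index (I x) j)"

end

theory Submission
  imports Defs "Jordan_Normal_Form.Spectral_Radius"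
begin

text \<open>
  Real basis functions are complete exactly when no irreducible representation needs complex
  matrices; the three groups are told apart by this.

  The tetrahedral group fails because of a one-dimensional representation. With \<open>\<omega>\<close> a primitive
  third root of unity, the form \<open>f = x_1^2 + \<omega> x_2^2 + \<omega>^2 x_3^2\<close> is multiplied by a third root of
  unity under every rotation of the tetrahedron, and the cyclic permutation of the axes gives a
  non-real factor. A real function that is multiplied by this character vanishes, so a real family
  has no member for it. The members for the other representations are orthogonal to \<open>f\<close>: their
  inner products with \<open>f\<close> would otherwise form a left eigenvector of an irreducible representation
  other than the character. So \<open>f\<close> stays at a positive distance from
  the span of the family (\<open>no_real_basis_if_nonreal_character\<close>).

  For the other two groups, every irreducible representation \<open>r\<close> over the reals stays irreducible
  over the complex numbers. Let \<open>K\<close> be a skew-symmetric matrix that commutes with the orthogonal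
  matrices \<open>r(g)\<close>, and put \<open>\<psi>(g) = <K v, r(g) v>\<close>. Then \<open>\<psi>(g^-1) = - \<psi>(g)\<close>, so \<open>\<psi>\<close> vanishes at the
  elements of order at most two. If \<open>v\<close> is a common eigenvector, with eigenvalues \<open>\<plusminus>1\<close>, of the half turns about the
  three coordinate axes, then \<open>\<psi>(g)\<close> only changes its sign when \<open>g\<close> is multiplied by such a half turn
  from the left or from the right. Up to these half turns, every rotation of the octahedron or of the
  icosahedron has order at most two or is the cyclic permutation \<open>P\<close> of the axes or its inverse, and
  \<open>v\<close> can be chosen with \<open>\<psi>(P) = 0\<close>. So \<open>K v\<close> is orthogonal to the orbit of \<open>v\<close>, and \<open>K = 0\<close>
  (\<open>skew_commutant_trivial\<close>). A symmetric matrix in the commutant has a real eigenvalue and hence is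
  scalar.

  Schur orthogonality bounds the length of a list of pairwise inequivalent real representations
  that are irreducible in this strong sense. A list of maximal length satisfies
  \<open>\<Sum>_p d_p / |G| \<chi>_p(g) = \<delta>(g, 1)\<close>, because otherwise the regular representation would provide a
  further one (\<open>complete_irrep_list_exists\<close>). This identity has two consequences. Every complex
  irreducible representation is equivalent to one of the list (\<open>unitary_irreps_of_irrep_list\<close>).
  And every function on the sphere is a sum of components of vector functions that transform under
  the representations of the list. These are applied to the monomials, whose linear span is dense in
  \<open>L_2\<close> (\<open>closed_subspace_eq_L2\<close>). Orthonormalising the resulting real vector functions for one
  representation at a time gives the family (\<open>real_complete_basis_family\<close>): by Schur's lemma, making
  their first components orthonormal makes all components orthonormal.
\<close>

text \<open>The notations for vectors and matrices of fixed size are given precedence over those for variable size.\<close>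

hide_const (open) Matrix.mat Determinant.det
hide_fact (open) Matrix.vec_eq_iff Matrix.mat_def
no_notation Matrix.vec_index (infixl "$" 100)
no_notation Matrix.scalar_prod (infix "\<bullet>" 70)

section \<open>Orthonormal tuples of real functions on a finite set\<close>

definition dot :: "'i set \<Rightarrow> ('i \<Rightarrow> real) \<Rightarrow> ('i \<Rightarrow> real) \<Rightarrow> real" where
  "dot A u v = (\<Sum>x\<in>A. u x * v x)"

definition orthonormal_tuple :: "'i set \<Rightarrow> nat \<Rightarrow> (nat \<Rightarrow> 'i \<Rightarrow> real) \<Rightarrow> bool" where
  "orthonormal_tuple A k e \<longleftrightarrow> (\<forall>i<k. \<forall>j<k. dot A (e i) (e j) = of_bool (i = j))"

lemma dot_commute: "dot A u v = dot A v u"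
  by (simp add: dot_def mult.commute)

lemma dot_add_right: "dot A u (\<lambda>x. v x + c * w x) = dot A u v + c * dot A u w"
  by (simp add: dot_def algebra_simps sum.distrib sum_distrib_left)

lemma dot_sum_right: "dot A u (\<lambda>x. \<Sum>i\<in>I. c i * v i x) = (\<Sum>i\<in>I. c i * dot A u (v i))"
  unfolding dot_def
  by (simp add: sum_distrib_left) (subst sum.swap, simp add: algebra_simps)

lemma dot_sum_left: "dot A (\<lambda>x. \<Sum>i\<in>I. c i * v i x) u = (\<Sum>i\<in>I. c i * dot A (v i) u)"
  by (simp add: dot_commute[of A _ u] dot_sum_right)

lemma dot_diff_right: "dot A u (\<lambda>x. v x - w x) = dot A u v - dot A u w"
  by (simp add: dot_def algebra_simps sum_subtractf)

lemma dot_diff_left: "dot A (\<lambda>x. v x - w x) u = dot A v u - dot A w u"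
  by (simp add: dot_def algebra_simps sum_subtractf)

lemma dot_scale_right: "dot A u (\<lambda>x. c * v x) = c * dot A u v"
  by (simp add: dot_def sum_distrib_left algebra_simps)

lemma dot_scale_left: "dot A (\<lambda>x. c * v x) u = c * dot A v u"
  by (simp add: dot_def sum_distrib_left algebra_simps)

lemma dot_self_nonneg: "dot A u u \<ge> 0"
  by (simp add: dot_def sum_nonneg)

lemma dot_self_eq_0_iff: "finite A \<Longrightarrow> dot A u u = 0 \<longleftrightarrow> (\<forall>x\<in>A. u x = 0)"
  by (simp add: dot_def sum_nonneg_eq_0_iff)

lemma dot_cong: "(\<And>x. x \<in> A \<Longrightarrow> u x = u' x) \<Longrightarrow> (\<And>x. x \<in> A \<Longrightarrow> v x = v' x) \<Longrightarrow> dot A u v = dot A u' v'"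
  by (simp add: dot_def)

lemma sum_of_bool:
  assumes "finite A"
  shows "(\<Sum>i\<in>A. of_bool (i = j) * f i) = (if j \<in> A then f j else (0::real))"
    and "(\<Sum>i\<in>A. f i * of_bool (i = j)) = (if j \<in> A then f j else (0::real))"
    and "(\<Sum>i\<in>A. of_bool (j = i) * f i) = (if j \<in> A then f j else (0::real))"
    and "(\<Sum>i\<in>A. f i * of_bool (j = i)) = (if j \<in> A then f j else (0::real))"
  using assms by (simp_all add: of_bool_def if_distrib if_distribR cong: if_cong)

text \<open>Bessel's inequality for the unit vectors, summed over the set.\<close>

lemma orthonormal_tuple_length_le:
  assumes A: "finite A" and e: "orthonormal_tuple A k e"
  shows "k \<le> card A"
proof -
  have le1: "(\<Sum>i<k. (e i x)\<^sup>2) \<le> 1" if x: "x \<in> A" for x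
  proof -
    let ?p = "\<lambda>y. \<Sum>i<k. e i x * e i y"
    let ?d = "\<lambda>y. of_bool (x = y) :: real"
    define s where "s = (\<Sum>i<k. (e i x)\<^sup>2)"
    have dp: "dot A ?d ?p = s"
      by (simp add: dot_def sum_of_bool A x s_def power2_eq_square)
    have pp: "dot A ?p ?p = s"
      using e by (simp add: dot_sum_left dot_sum_right orthonormal_tuple_def sum_of_bool s_def
          power2_eq_square cong: sum.cong_simp)
    have dd: "dot A ?d ?d = 1"
      by (simp add: dot_def sum_of_bool A x)
    have "0 \<le> dot A (\<lambda>y. ?d y - ?p y) (\<lambda>y. ?d y - ?p y)"
      by (rule dot_self_nonneg)
    also have "\<dots> = 1 - s"
      using dp pp dd dot_commute[of A ?p ?d] by (simp add: dot_diff_right dot_diff_left)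
    finally show ?thesis by (simp add: s_def)
  qed
  have "real k = (\<Sum>i<k. dot A (e i) (e i))"
    using e by (simp add: orthonormal_tuple_def)
  also have "\<dots> = (\<Sum>x\<in>A. \<Sum>i<k. (e i x)\<^sup>2)"
    unfolding dot_def power2_eq_square by (rule sum.swap)
  also have "\<dots> \<le> (\<Sum>x\<in>A. 1)"
    by (rule sum_mono) (rule le1)
  finally show ?thesis by simp
qed

text \<open>The functions are total, but only their values on the finite set in question will matter.\<close>

definition function_space :: "('i \<Rightarrow> real) set \<Rightarrow> bool" where
  "function_space U \<longleftrightarrow> (\<lambda>x. 0) \<in> U \<and> (\<forall>u\<in>U. \<forall>v\<in>U. \<forall>c. (\<lambda>x. u x + c * v x) \<in> U)"

lemma function_space_add:
  "function_space U \<Longrightarrow> u \<in> U \<Longrightarrow> v \<in> U \<Longrightarrow> (\<lambda>x. u x + c * v x) \<in> U"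
  by (simp add: function_space_def)

lemma function_space_zero: "function_space U \<Longrightarrow> (\<lambda>x. 0) \<in> U"
  by (simp add: function_space_def)

lemma function_space_sum:
  assumes "function_space U" "finite I" "\<And>i. i \<in> I \<Longrightarrow> v i \<in> U"
  shows "(\<lambda>x. \<Sum>i\<in>I. c i * v i x) \<in> U"
  using assms(2,3)
proof (induction I rule: finite_induct)
  case empty
  then show ?case using assms(1) by (simp add: function_space_def)
next
  case (insert i I)
  have "(\<lambda>x. (\<Sum>i\<in>I. c i * v i x) + c i * v i x) \<in> U"
    using insert assms(1) by (simp add: function_space_def)
  then show ?case using insert by (simp add: add.commute)
qed

text \<open>An orthonormal tuple of maximal length in the space spans it: the part of a member of the space
  that is orthogonal to the tuple could otherwise be normalised and appended.\<close>

lemma orthonormal_basis_exists: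
  assumes A: "finite A" and U: "function_space U"
  obtains k e where "orthonormal_tuple A k e" "\<And>i. i < k \<Longrightarrow> e i \<in> U"
    "\<And>f x. f \<in> U \<Longrightarrow> x \<in> A \<Longrightarrow> f x = (\<Sum>i<k. dot A (e i) f * e i x)"
proof -
  let ?P = "\<lambda>k. \<exists>e. orthonormal_tuple A k e \<and> (\<forall>i<k. e i \<in> U)"
  have "?P 0" by (simp add: orthonormal_tuple_def)
  moreover have "\<forall>k. ?P k \<longrightarrow> k \<le> card A"
    using orthonormal_tuple_length_le[OF A] by blast
  ultimately obtain k where k: "?P k" and max: "\<And>l. ?P l \<Longrightarrow> l \<le> k"
    using Nat.ex_has_greatest_nat[of ?P 0 "card A"] by blast
  then obtain e where e: "orthonormal_tuple A k e" "\<And>i. i < k \<Longrightarrow> e i \<in> U" by auto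
  show ?thesis
  proof (rule that[OF e])
    fix f x assume f: "f \<in> U" and x: "x \<in> A"
    let ?p = "\<lambda>y. \<Sum>i<k. dot A (e i) f * e i y"
    define h where "h = (\<lambda>y. f y - ?p y)"
    have p: "?p \<in> U"
      by (rule function_space_sum[OF U]) (use e in auto)
    have hU: "h \<in> U"
      using function_space_add[OF U f p, of "-1"] by (simp add: h_def)
    have eh: "dot A (e i) h = 0" if "i < k" for i
      using e(1) that
      by (simp add: h_def dot_diff_right dot_sum_right orthonormal_tuple_def sum_of_bool cong: sum.cong_simp)
    have "dot A h h = 0"
    proof (rule ccontr)
      assume nz: "dot A h h \<noteq> 0"
      then have pos: "dot A h h > 0" using dot_self_nonneg[of A h] by simp
      define c where "c = 1 / sqrt (dot A h h)"
      define e' where "e' = e(k := \<lambda>y. c * h y)"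
      have he: "dot A h (e i) = 0" if "i < k" for i
        using eh[OF that] by (simp add: dot_commute)
      have cc: "c * (c * dot A h h) = 1"
        using pos by (simp add: c_def field_simps)
      have "orthonormal_tuple A (Suc k) e'"
        using e(1) eh he cc
        by (auto simp: orthonormal_tuple_def e'_def less_Suc_eq dot_scale_left dot_scale_right)
      moreover have "\<forall>i<Suc k. e' i \<in> U"
        using e(2) function_space_add[OF U function_space_zero[OF U] hU, of c]
        by (auto simp: e'_def less_Suc_eq)
      ultimately have "?P (Suc k)" by blast
      then show False using max by fastforce
    qed
    then show "f x = ?p x"
      using x A by (simp add: dot_self_eq_0_iff h_def)
  qed
qed

section \<open>Real orthogonal representations\<close>

text \<open>Matrices are given by their entries over an arbitrary finite index set, so that the group itself can
  be the index set of its regular representation. The last clause says that the matrices are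
  orthogonal.\<close>

definition orthogonal_rep :: "('g, 'b) monoid_scheme \<Rightarrow> 'i set \<Rightarrow> ('g \<Rightarrow> 'i \<Rightarrow> 'i \<Rightarrow> real) \<Rightarrow> bool" where
  "orthogonal_rep G A r \<longleftrightarrow> finite A \<and>
     (\<forall>i\<in>A. \<forall>j\<in>A. r \<one>\<^bsub>G\<^esub> i j = of_bool (i = j)) \<and>
     (\<forall>g\<in>carrier G. \<forall>h\<in>carrier G. \<forall>i\<in>A. \<forall>j\<in>A. r (g \<otimes>\<^bsub>G\<^esub> h) i j = (\<Sum>k\<in>A. r g i k * r h k j)) \<and>
     (\<forall>g\<in>carrier G. \<forall>i\<in>A. \<forall>j\<in>A. r (inv\<^bsub>G\<^esub> g) i j = r g j i)"

definition act :: "'i set \<Rightarrow> ('i \<Rightarrow> 'i \<Rightarrow> real) \<Rightarrow> ('i \<Rightarrow> real) \<Rightarrow> 'i \<Rightarrow> real" where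
  "act A m u = (\<lambda>i. \<Sum>j\<in>A. m i j * u j)"

text \<open>This is irreducibility over the reals: the vectors orthogonal to an orbit form an invariant
  subspace, so no nonzero vector \<open>u\<close> has an orbit whose span leaves room for an orthogonal \<open>w\<close>.\<close>

definition real_irreducible ::
    "('g, 'b) monoid_scheme \<Rightarrow> 'i set \<Rightarrow> ('g \<Rightarrow> 'i \<Rightarrow> 'i \<Rightarrow> real) \<Rightarrow> bool" where
  "real_irreducible G A r \<longleftrightarrow>
     (\<forall>u w. (\<exists>i\<in>A. u i \<noteq> 0) \<longrightarrow> (\<forall>g\<in>carrier G. dot A w (act A (r g) u) = 0) \<longrightarrow> (\<forall>i\<in>A. w i = 0))"

definition commutes_with ::
    "('g, 'b) monoid_scheme \<Rightarrow> 'i set \<Rightarrow> ('g \<Rightarrow> 'i \<Rightarrow> 'i \<Rightarrow> real) \<Rightarrow> ('i \<Rightarrow> 'i \<Rightarrow> real) \<Rightarrow> bool" where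
  "commutes_with G A r X \<longleftrightarrow>
     (\<forall>g\<in>carrier G. \<forall>i\<in>A. \<forall>j\<in>A. (\<Sum>k\<in>A. X i k * r g k j) = (\<Sum>k\<in>A. r g i k * X k j))"

text \<open>The real and the imaginary part of a complex matrix in the commutant are in the commutant as well, so
  by Schur's lemma this is irreducibility over the complex numbers.\<close>

definition absolutely_irreducible ::
    "('g, 'b) monoid_scheme \<Rightarrow> 'i set \<Rightarrow> ('g \<Rightarrow> 'i \<Rightarrow> 'i \<Rightarrow> real) \<Rightarrow> bool" where
  "absolutely_irreducible G A r \<longleftrightarrow>
     (\<forall>X. commutes_with G A r X \<longrightarrow> (\<exists>c. \<forall>i\<in>A. \<forall>j\<in>A. X i j = c * of_bool (i = j)))"

definition disjoint_reps ::
    "('g, 'b) monoid_scheme \<Rightarrow> 'i set \<Rightarrow> ('g \<Rightarrow> 'i \<Rightarrow> 'i \<Rightarrow> real) \<Rightarrow>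
     'j set \<Rightarrow> ('g \<Rightarrow> 'j \<Rightarrow> 'j \<Rightarrow> real) \<Rightarrow> bool" where
  "disjoint_reps G A r B s \<longleftrightarrow>
     (\<forall>T. (\<forall>g\<in>carrier G. \<forall>i\<in>A. \<forall>j\<in>B. (\<Sum>k\<in>A. r g i k * T k j) = (\<Sum>k\<in>B. T i k * s g k j))
        \<longrightarrow> (\<forall>i\<in>A. \<forall>j\<in>B. T i j = 0))"

lemma act_cong: "(\<And>j. j \<in> A \<Longrightarrow> u j = u' j) \<Longrightarrow> act A m u = act A m u'"
  by (simp add: act_def)

lemma act_add: "act A m (\<lambda>x. u x + c * v x) = (\<lambda>x. act A m u x + c * act A m v x)"
  by (simp add: act_def algebra_simps sum.distrib sum_distrib_left)

lemma act_sum: "act A m (\<lambda>x. \<Sum>i\<in>I. c i * v i x) = (\<lambda>x. \<Sum>i\<in>I. c i * act A m (v i) x)"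
proof
  fix x
  have "act A m (\<lambda>x. \<Sum>i\<in>I. c i * v i x) x = (\<Sum>j\<in>A. \<Sum>i\<in>I. c i * (m x j * v i j))"
    by (simp add: act_def sum_distrib_left algebra_simps)
  also have "\<dots> = (\<Sum>i\<in>I. c i * act A m (v i) x)"
    by (subst sum.swap) (simp add: act_def sum_distrib_left)
  finally show "act A m (\<lambda>x. \<Sum>i\<in>I. c i * v i x) x = (\<Sum>i\<in>I. c i * act A m (v i) x)" .
qed

lemma dot_act: "dot A w (act A m u) = (\<Sum>i\<in>A. \<Sum>j\<in>A. w i * m i j * u j)"
  by (simp add: dot_def act_def sum_distrib_left mult.assoc)

lemma dot_act_transpose:
  assumes "\<And>i j. i \<in> A \<Longrightarrow> j \<in> A \<Longrightarrow> m' i j = m j i"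
  shows "dot A w (act A m u) = dot A (act A m' w) u"
  unfolding dot_act dot_commute[of A "act A m' w"]
  by (subst sum.swap) (intro sum.cong refl, simp add: assms)

lemma (in group) act_mult:
  assumes r: "orthogonal_rep G A r" and "g \<in> carrier G" "h \<in> carrier G" "x \<in> A"
  shows "act A (r (g \<otimes> h)) u x = act A (r g) (act A (r h) u) x"
proof -
  have "act A (r (g \<otimes> h)) u x = (\<Sum>j\<in>A. \<Sum>k\<in>A. r g x k * (r h k j * u j))"
    using assms by (simp add: act_def orthogonal_rep_def sum_distrib_right mult.assoc)
  also have "\<dots> = act A (r g) (act A (r h) u) x"
    by (subst sum.swap) (simp add: act_def sum_distrib_left)
  finally show ?thesis .
qed

lemma (in group) act_one:
  assumes r: "orthogonal_rep G A r" and "x \<in> A"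
  shows "act A (r \<one>) u x = u x"
  using assms by (simp add: act_def orthogonal_rep_def sum_of_bool cong: sum.cong_simp)

lemma (in group) dot_act_inv:
  assumes r: "orthogonal_rep G A r" and "g \<in> carrier G"
  shows "dot A w (act A (r g) u) = dot A (act A (r (inv g)) w) u"
  by (rule dot_act_transpose) (use assms in \<open>auto simp: orthogonal_rep_def\<close>)

text \<open>In an orthonormal basis of an invariant space the group acts by orthogonal matrices again.\<close>

lemma (in group) subrepresentation:
  assumes r: "orthogonal_rep G A r" and U: "function_space U"
    and inv: "\<And>g u. g \<in> carrier G \<Longrightarrow> u \<in> U \<Longrightarrow> act A (r g) u \<in> U"
  obtains k e s where "orthonormal_tuple A k e" "\<And>i. i < k \<Longrightarrow> e i \<in> U"
    "\<And>f x. f \<in> U \<Longrightarrow> x \<in> A \<Longrightarrow> f x = (\<Sum>i<k. dot A (e i) f * e i x)"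
    "orthogonal_rep G {..<k} s"
    "\<And>g j x. g \<in> carrier G \<Longrightarrow> j < k \<Longrightarrow> x \<in> A \<Longrightarrow> act A (r g) (e j) x = (\<Sum>i<k. s g i j * e i x)"
proof -
  have A: "finite A" using r by (simp add: orthogonal_rep_def)
  obtain k e where e: "orthonormal_tuple A k e" "\<And>i. i < k \<Longrightarrow> e i \<in> U"
    "\<And>f x. f \<in> U \<Longrightarrow> x \<in> A \<Longrightarrow> f x = (\<Sum>i<k. dot A (e i) f * e i x)"
    using orthonormal_basis_exists[OF A U] by blast
  define s where "s g i j = dot A (e i) (act A (r g) (e j))" for g i j
  have re: "act A (r g) (e j) x = (\<Sum>i<k. s g i j * e i x)"
    if "g \<in> carrier G" "j < k" "x \<in> A" for g j x
    using e(3)[OF inv[OF that(1) e(2)[OF that(2)]] that(3)] by (simp add: s_def)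
  have "orthogonal_rep G {..<k} s"
    unfolding orthogonal_rep_def
  proof (intro conjI ballI)
    show "s \<one> i j = of_bool (i = j)" if "i \<in> {..<k}" "j \<in> {..<k}" for i j
    proof -
      have "s \<one> i j = dot A (e i) (e j)"
        unfolding s_def by (rule dot_cong) (simp_all add: act_one[OF r])
      then show ?thesis using e(1) that by (simp add: orthonormal_tuple_def)
    qed
    show "s (g \<otimes> h) i j = (\<Sum>l\<in>{..<k}. s g i l * s h l j)"
      if "g \<in> carrier G" "h \<in> carrier G" "i \<in> {..<k}" "j \<in> {..<k}" for g h i j
    proof -
      have "s (g \<otimes> h) i j = dot A (e i) (act A (r g) (act A (r h) (e j)))"
        unfolding s_def by (rule dot_cong) (use that in \<open>simp_all add: act_mult[OF r]\<close>)
      also have "act A (r g) (act A (r h) (e j)) = act A (r g) (\<lambda>x. \<Sum>l<k. s h l j * e l x)"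
        by (rule act_cong) (use that re in auto)
      also have "dot A (e i) \<dots> = (\<Sum>l<k. s h l j * s g i l)"
        by (simp add: act_sum dot_sum_right s_def)
      finally show ?thesis by (simp add: mult.commute)
    qed
    show "s (inv g) i j = s g j i" if "g \<in> carrier G" for g i j
      unfolding s_def
      using that dot_act_inv[OF r that, of "e j" "e i"] by (simp add: dot_commute)
  qed simp
  with e re show ?thesis using that by blast
qed

section \<open>Absence of skew-symmetric endomorphisms\<close>

context group
begin

lemma commutes_with_act:
  assumes K: "commutes_with G A r K" and g: "g \<in> carrier G" and x: "x \<in> A"
  shows "act A K (act A (r g) u) x = act A (r g) (act A K u) x"
proof -
  have "act A K (act A (r g) u) x = (\<Sum>j\<in>A. (\<Sum>k\<in>A. K x k * r g k j) * u j)"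
    unfolding act_def sum_distrib_left sum_distrib_right by (subst sum.swap) (simp add: mult.assoc)
  also have "\<dots> = (\<Sum>j\<in>A. (\<Sum>k\<in>A. r g x k * K k j) * u j)"
    using K g x by (simp add: commutes_with_def)
  also have "\<dots> = act A (r g) (act A K u) x"
    unfolding act_def sum_distrib_left sum_distrib_right by (subst sum.swap) (simp add: mult.assoc)
  finally show ?thesis .
qed

definition skew_coefficient where
  "skew_coefficient A r K v g = dot A (act A K v) (act A (r g) v)"

lemma dot_skew:
  assumes K: "\<forall>i\<in>A. \<forall>j\<in>A. K i j + K j i = 0"
  shows "dot A (act A K u) w = - dot A u (act A K w)"
proof -
  have "dot A u (act A K w) = dot A (act A (\<lambda>i j. - K i j) u) w"
  proof (rule dot_act_transpose)
    fix i j assume "i \<in> A" "j \<in> A"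
    then have "K i j + K j i = 0" using K by blast
    then show "- K i j = K j i" by linarith
  qed
  also have "\<dots> = - dot A (act A K u) w"
    by (simp add: act_def dot_def sum_negf)
  finally show ?thesis by simp
qed

text \<open>The representation preserves the inner product, \<open>K\<close> commutes with it, and skewness yields the sign.\<close>

lemma skew_coefficient_inv:
  assumes r: "orthogonal_rep G A r" and K: "commutes_with G A r K"
    and skew: "\<forall>i\<in>A. \<forall>j\<in>A. K i j + K j i = 0" and g: "g \<in> carrier G"
  shows "skew_coefficient A r K v (inv g) = - skew_coefficient A r K v g"
proof -
  have "skew_coefficient A r K v (inv g) = dot A (act A (r g) (act A K v)) v"
    using g by (simp add: skew_coefficient_def dot_act_inv[OF r])
  also have "\<dots> = dot A (act A K (act A (r g) v)) v"
    by (rule dot_cong) (simp_all add: commutes_with_act[OF K g])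
  also have "\<dots> = - dot A (act A (r g) v) (act A K v)"
    by (rule dot_skew[OF skew])
  finally show ?thesis by (simp add: skew_coefficient_def dot_commute)
qed

lemma skew_coefficient_eigen_right:
  assumes r: "orthogonal_rep G A r" and g: "g \<in> carrier G" and h: "h \<in> carrier G"
    and v: "\<And>x. x \<in> A \<Longrightarrow> act A (r h) v x = c * v x"
  shows "skew_coefficient A r K v (g \<otimes> h) = c * skew_coefficient A r K v g"
proof -
  have "skew_coefficient A r K v (g \<otimes> h) = dot A (act A K v) (act A (r g) (act A (r h) v))"
    unfolding skew_coefficient_def by (rule dot_cong) (simp_all add: act_mult[OF r] g h)
  also have "act A (r g) (act A (r h) v) = act A (r g) (\<lambda>x. c * v x)"
    by (rule act_cong) (rule v)
  also have "dot A (act A K v) \<dots> = c * skew_coefficient A r K v g"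
    by (simp add: skew_coefficient_def act_def dot_def sum_distrib_left algebra_simps)
  finally show ?thesis .
qed

lemma skew_coefficient_eigen_left:
  assumes r: "orthogonal_rep G A r" and K: "commutes_with G A r K"
    and skew: "\<forall>i\<in>A. \<forall>j\<in>A. K i j + K j i = 0"
    and g: "g \<in> carrier G" and h: "h \<in> carrier G" and hh: "h \<otimes> h = \<one>"
    and v: "\<And>x. x \<in> A \<Longrightarrow> act A (r h) v x = c * v x"
  shows "skew_coefficient A r K v (h \<otimes> g) = c * skew_coefficient A r K v g"
proof -
  have ih: "inv h = h" using hh h by (simp add: inv_equality)
  have "skew_coefficient A r K v (h \<otimes> g) = - skew_coefficient A r K v (inv g \<otimes> h)"
    using skew_coefficient_inv[OF r K skew, of "h \<otimes> g" v] g h by (simp add: inv_mult_group ih)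
  also have "\<dots> = - (c * skew_coefficient A r K v (inv g))"
    using skew_coefficient_eigen_right[OF r inv_closed[OF g] h v] by simp
  also have "\<dots> = c * skew_coefficient A r K v g"
    using skew_coefficient_inv[OF r K skew g, of v] by simp
  finally show ?thesis .
qed

lemma involution_eigenvector:
  assumes r: "orthogonal_rep G A r" and h: "h \<in> carrier G" "h \<otimes> h = \<one>" and c: "c * c = 1" and x: "x \<in> A"
  shows "act A (r h) (\<lambda>y. u y + c * act A (r h) u y) x = c * (u x + c * act A (r h) u x)"
proof -
  have "act A (r h) (act A (r h) u) x = u x"
    using act_mult[OF r h(1) h(1) x, of u] act_one[OF r x] h(2) by simp
  then show ?thesis using c by (simp add: act_add algebra_simps flip: mult.assoc)
qed

text \<open>The difference of \<open>u\<close> and its image under \<open>a\<close> is an eigenvector of \<open>a\<close> for \<open>-1\<close>. It is kept if \<open>b\<close>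
  negates it, and otherwise replaced by its sum with its image under \<open>b\<close>.\<close>

lemma common_eigenvector:
  assumes r: "orthogonal_rep G A r"
    and a: "a \<in> carrier G" "a \<otimes> a = \<one>" and b: "b \<in> carrier G" "b \<otimes> b = \<one>" and ab: "a \<otimes> b = b \<otimes> a"
    and x: "x \<in> A" and ux: "act A (r a) u x \<noteq> u x"
  obtains v c where "\<exists>x\<in>A. v x \<noteq> 0" "c * c = 1"
    "\<And>x. x \<in> A \<Longrightarrow> act A (r a) v x = (-1) * v x" "\<And>x. x \<in> A \<Longrightarrow> act A (r b) v x = c * v x"
proof -
  define w where "w = (\<lambda>y. u y + (-1) * act A (r a) u y)"
  have wa: "act A (r a) w y = (-1) * w y" if "y \<in> A" for y
    unfolding w_def by (rule involution_eigenvector[OF r a _ that]) simp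
  have wx: "w x \<noteq> 0" using ux by (simp add: w_def)
  show ?thesis
  proof (cases "\<forall>y\<in>A. act A (r b) w y = (-1) * w y")
    case True
    show ?thesis
      by (rule that[of w "-1"]) (use x wx wa True in auto)
  next
    case False
    define v where "v = (\<lambda>y. w y + 1 * act A (r b) w y)"
    have "act A (r a) (act A (r b) w) y = (-1) * act A (r b) w y" if y: "y \<in> A" for y
    proof -
      have "act A (r a) (act A (r b) w) y = act A (r b) (act A (r a) w) y"
        using act_mult[OF r a(1) b(1) y, of w] act_mult[OF r b(1) a(1) y, of w] ab by simp
      also have "act A (r b) (act A (r a) w) = act A (r b) (\<lambda>y. (-1) * w y)"
        by (rule act_cong) (rule wa)
      also have "\<dots> y = (-1) * act A (r b) w y"
        by (simp add: act_def sum_negf)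
      finally show ?thesis .
    qed
    then have va: "act A (r a) v y = (-1) * v y" if "y \<in> A" for y
      using that wa[OF that] by (simp add: v_def act_add[of A _ w 1, simplified])
    have vb: "act A (r b) v y = 1 * v y" if "y \<in> A" for y
      unfolding v_def by (rule involution_eigenvector[OF r b _ that]) simp
    show ?thesis
      by (rule that[of v 1]) (use False va vb in \<open>auto simp: v_def add_eq_0_iff\<close>)
  qed
qed

lemma commutes_with_transpose:
  assumes r: "orthogonal_rep G A r" and X: "commutes_with G A r X"
  shows "commutes_with G A r (\<lambda>i j. X j i)"
  unfolding commutes_with_def
proof (intro ballI)
  fix g i j assume g: "g \<in> carrier G" and i: "i \<in> A" and j: "j \<in> A"
  have "(\<Sum>k\<in>A. X j k * r (inv g) k i) = (\<Sum>k\<in>A. r (inv g) j k * X k i)"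
    using X g i j by (simp add: commutes_with_def)
  moreover have "r (inv g) a b = r g b a" if "a \<in> A" "b \<in> A" for a b
    using r g that by (simp add: orthogonal_rep_def)
  ultimately show "(\<Sum>k\<in>A. X k i * r g k j) = (\<Sum>k\<in>A. r g i k * X j k)"
    using i j by (simp add: mult.commute)
qed

text \<open>A symmetric matrix has a real eigenvalue. Its eigenspace is invariant if the matrix commutes with the
  representation, so it is the whole space.\<close>

lemma symmetric_commutant_scalar:
  fixes m :: nat
  assumes r: "orthogonal_rep G {..<m} r" and irr: "real_irreducible G {..<m} r"
    and X: "commutes_with G {..<m} r X" and sym: "\<forall>i<m. \<forall>j<m. X i j = X j i" and m: "m > 0"
  shows "\<exists>c. \<forall>i<m. \<forall>j<m. X i j = c * of_bool (i = j)"
proof -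
  define C where "C = Matrix.mat m m (\<lambda>(i, j). complex_of_real (X i j))"
  have C: "C \<in> carrier_mat m m" by (simp add: C_def)
  obtain k where "k \<in> spectrum C" using spectrum_non_empty[OF C m] by blast
  then obtain z where z: "z \<in> carrier_vec m" "z \<noteq> 0\<^sub>v m" "C *\<^sub>v z = k \<cdot>\<^sub>v z"
    using C by (auto simp: spectrum_def eigenvalue_def eigenvector_def)
  define u where "u i = Re (vec_index z i)" for i
  define w where "w i = Im (vec_index z i)" for i
  have ev: "(\<Sum>j<m. complex_of_real (X i j) * vec_index z j) = k * vec_index z i" if "i < m" for i
  proof -
    have "vec_index (C *\<^sub>v z) i = (\<Sum>j<m. complex_of_real (X i j) * vec_index z j)"
      using that z(1) by (simp add: C_def scalar_prod_def lessThan_atLeast0)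
    then show ?thesis using that z by simp
  qed
  have Xu: "act {..<m} X u i = Re k * u i - Im k * w i" if "i < m" for i
    using arg_cong[OF ev[OF that], of Re] by (simp add: act_def u_def w_def)
  have Xw: "act {..<m} X w i = Re k * w i + Im k * u i" if "i < m" for i
    using arg_cong[OF ev[OF that], of Im] by (simp add: act_def u_def w_def)
  have symd: "dot {..<m} a (act {..<m} X b) = dot {..<m} (act {..<m} X a) b" for a b
    by (rule dot_act_transpose) (use sym in auto)
  have "dot {..<m} u (\<lambda>i. Re k * w i + Im k * u i) = dot {..<m} (\<lambda>i. Re k * u i - Im k * w i) w"
    using symd[of u w] Xu Xw by (simp add: dot_def cong: sum.cong_simp)
  then have *: "Im k * (dot {..<m} u u + dot {..<m} w w) = 0"
    unfolding dot_add_right dot_diff_left dot_scale_right dot_scale_left by (simp add: algebra_simps)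
  obtain i where i: "i < m" "vec_index z i \<noteq> 0"
    using z(1,2) by (metis carrier_vecD eq_vecI index_zero_vec)
  have nz: "u i \<noteq> 0 \<or> w i \<noteq> 0"
    using i(2) by (auto simp: u_def w_def complex_eq_iff)
  have "dot {..<m} u u + dot {..<m} w w \<noteq> 0"
    using nz i(1) dot_self_eq_0_iff[of "{..<m}" u] dot_self_eq_0_iff[of "{..<m}" w]
      dot_self_nonneg[of "{..<m}" u] dot_self_nonneg[of "{..<m}" w]
    by (auto simp: add_nonneg_eq_0_iff)
  then have k0: "Im k = 0" using * by simp
  obtain v where v: "v i \<noteq> 0" "\<And>i. i < m \<Longrightarrow> act {..<m} X v i = Re k * v i"
    using nz Xu Xw k0 by auto
  define Y where "Y = (\<lambda>y i. act {..<m} X y i + (- Re k) * y i)"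
  have Y0: "Y y x = 0" if "x < m" for y x
  proof -
    have "dot {..<m} (Y y) (act {..<m} (r g) v) = 0" if g: "g \<in> carrier G" for g
    proof -
      have "dot {..<m} (Y y) (act {..<m} (r g) v)
          = dot {..<m} (act {..<m} (r g) v) (Y y)" by (rule dot_commute)
      also have "\<dots> = dot {..<m} (act {..<m} X (act {..<m} (r g) v)) y
          + (- Re k) * dot {..<m} (act {..<m} (r g) v) y"
        unfolding Y_def dot_add_right by (simp add: symd)
      also have "dot {..<m} (act {..<m} X (act {..<m} (r g) v)) y
          = dot {..<m} (act {..<m} (r g) (act {..<m} X v)) y"
        by (rule dot_cong) (simp_all add: commutes_with_act[OF X g])
      also have "act {..<m} (r g) (act {..<m} X v) = act {..<m} (r g) (\<lambda>i. Re k * v i)"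
        by (rule act_cong) (simp add: v(2))
      also have "\<dots> = (\<lambda>i. Re k * act {..<m} (r g) v i)"
        by (auto simp: act_def sum_distrib_left algebra_simps)
      finally show ?thesis by (simp add: dot_scale_left)
    qed
    then show ?thesis
      using irr v(1) i(1) that unfolding real_irreducible_def by blast
  qed
  have "X a b = Re k * of_bool (a = b)" if "a < m" "b < m" for a b
    using Y0[OF that(1), of "\<lambda>j. of_bool (j = b)"] that by (simp add: Y_def act_def sum_of_bool)
  then show ?thesis by blast
qed

end

text \<open>What the octahedral and the icosahedral group have in common: a four-group \<open>{1, d1, d2, d3}\<close>, an
  element \<open>p\<close> that permutes its involutions cyclically, an involution \<open>s\<close> that inverts \<open>p\<close>, and the
  property that every coset of the four-group contains \<open>p\<close>, its inverse or an element of order at most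
  two.\<close>

locale sign_structured_group = group +
  fixes d1 d2 d3 p s
  assumes in_carrier [simp]: "d1 \<in> carrier G" "d2 \<in> carrier G" "d3 \<in> carrier G"
      "p \<in> carrier G" "s \<in> carrier G"
    and involutions: "d1 \<otimes> d1 = \<one>" "d2 \<otimes> d2 = \<one>" "d3 \<otimes> d3 = \<one>" "s \<otimes> s = \<one>"
    and four_group: "d1 \<otimes> d2 = d3" "d2 \<otimes> d1 = d3" "d2 \<otimes> d3 = d1" "d3 \<otimes> d2 = d1"
      "d3 \<otimes> d1 = d2" "d1 \<otimes> d3 = d2"
    and cycles: "p \<otimes> d1 = d2 \<otimes> p" "p \<otimes> d2 = d3 \<otimes> p" "p \<otimes> d3 = d1 \<otimes> p"
    and inverts: "s \<otimes> p \<otimes> s = inv p"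
    and cover: "a \<in> carrier G \<Longrightarrow> \<exists>d\<in>{\<one>, d1, d2, d3}.
        (d \<otimes> a) \<otimes> (d \<otimes> a) = \<one> \<or> d \<otimes> a = p \<or> d \<otimes> a = inv p"
begin

text \<open>If some involution of the four-group acts nontrivially, there is a common eigenvector of the four-group
  with the eigenvalues \<open>-1\<close>, \<open>m\<close>, \<open>-m\<close>, where \<open>m\<close> is a sign. Moving an involution past \<open>p\<close> turns it
  into the next one, so the coefficient at \<open>p\<close> is unchanged when it is multiplied by the ratio of their
  eigenvalues; as these are not all equal, it vanishes. If the four-group acts trivially, an eigenvector
  of \<open>s\<close> will do: the coefficients at \<open>p\<close> and at \<open>s p s\<close>, the inverse of \<open>p\<close>, agree.\<close>

lemma skew_coefficient_vanishes:
  assumes r: "orthogonal_rep G A r" and K: "commutes_with G A r K"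
    and skew: "\<forall>i\<in>A. \<forall>j\<in>A. K i j + K j i = 0" and A: "A \<noteq> {}"
  obtains v where "\<exists>x\<in>A. v x \<noteq> 0" "\<And>g. g \<in> carrier G \<Longrightarrow> skew_coefficient A r K v g = 0"
proof -
  note result = that
  note S = in_carrier involutions four_group cycles inverts
  \<comment> \<open>The coefficient vanishes at elements of order at most two, so only its value at \<open>p\<close> matters.\<close>
  have fin: "skew_coefficient A r K v g = 0"
    if v: "\<And>d. d \<in> {d1, d2, d3} \<Longrightarrow> \<exists>c. c \<noteq> 0 \<and> (\<forall>x\<in>A. act A (r d) v x = c * v x)"
      and p: "skew_coefficient A r K v p = 0" and g: "g \<in> carrier G" for v g
  proof -
    obtain d where d: "d \<in> {\<one>, d1, d2, d3}"
        "(d \<otimes> g) \<otimes> (d \<otimes> g) = \<one> \<or> d \<otimes> g = p \<or> d \<otimes> g = inv p"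
      using cover[OF g] by blast
    have dG: "d \<in> carrier G" "d \<otimes> d = \<one>" using d(1) S by auto
    obtain c where c: "c \<noteq> 0" "\<And>x. x \<in> A \<Longrightarrow> act A (r d) v x = c * v x"
    proof (cases "d = \<one>")
      case True
      then show ?thesis using that[of 1] act_one[OF r] by simp
    next
      case False
      then show ?thesis using that v[of d] d(1) by blast
    qed
    have "skew_coefficient A r K v (d \<otimes> g) = 0"
      using d(2)
    proof (elim disjE)
      assume "(d \<otimes> g) \<otimes> (d \<otimes> g) = \<one>"
      then have "inv (d \<otimes> g) = d \<otimes> g" using dG g by (simp add: inv_equality)
      then show ?thesis using skew_coefficient_inv[OF r K skew, of "d \<otimes> g" v] dG g by simp
    next
      assume "d \<otimes> g = inv p"
      then show ?thesis using skew_coefficient_inv[OF r K skew, of p v] S p by simp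
    qed (use p in simp)
    then show ?thesis
      using skew_coefficient_eigen_left[OF r K skew g dG c(2)] c(1) by simp
  qed
  show ?thesis
  proof (cases "\<exists>d\<in>{d1, d2, d3}. \<exists>u. \<exists>x\<in>A. act A (r d) u x \<noteq> u x")
    case True
    have gen: thesis
      if ab: "a \<in> carrier G" "b \<in> carrier G" "c \<in> carrier G" "a \<otimes> a = \<one>" "b \<otimes> b = \<one>" "c \<otimes> c = \<one>"
          "a \<otimes> b = c" "b \<otimes> a = c" and set: "{d1, d2, d3} = {a, b, c}"
        and pa: "p \<otimes> a = b \<otimes> p" "p \<otimes> b = c \<otimes> p"
        and u: "x \<in> A" "act A (r a) u x \<noteq> u x" for a b c u x
    proof -
      obtain v m where v: "\<exists>x\<in>A. v x \<noteq> 0" "m * m = 1"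
        "\<And>x. x \<in> A \<Longrightarrow> act A (r a) v x = (-1) * v x" "\<And>x. x \<in> A \<Longrightarrow> act A (r b) v x = m * v x"
        using common_eigenvector[OF r ab(1,4) ab(2,5) _ u] ab(7,8) by metis
      have vc: "act A (r c) v x = (-m) * v x" if x: "x \<in> A" for x
      proof -
        have "act A (r c) v x = act A (r a) (act A (r b) v) x"
          using act_mult[OF r ab(1,2) x, of v] ab(7) by simp
        also have "act A (r a) (act A (r b) v) = act A (r a) (\<lambda>x. 0 + m * v x)"
          by (rule act_cong) (simp add: v(4))
        also have "\<dots> x = m * act A (r a) v x"
          unfolding act_add by (simp add: act_def)
        finally show ?thesis using v(3)[OF x] by simp
      qed
      have pG: "p \<in> carrier G" using S by simp
      note L = skew_coefficient_eigen_left[OF r K skew pG] and R = skew_coefficient_eigen_right[OF r pG]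
      let ?q = "skew_coefficient A r K v p"
      have "m * ?q = (-1) * ?q"
        using L[OF ab(2,5) v(4)] R[OF ab(1) v(3), of K] pa(1) by simp
      moreover have "(-m) * ?q = m * ?q"
        using L[OF ab(3,6) vc] R[OF ab(2) v(4), of K] pa(2) by simp
      ultimately have "?q = 0" using v(2) by auto
      moreover have "\<exists>e. e \<noteq> 0 \<and> (\<forall>x\<in>A. act A (r d) v x = e * v x)" if "d \<in> {d1, d2, d3}" for d
        using that set v(2-4) vc by (metis insertE mult_zero_left neg_equal_0_iff_equal singletonD zero_neq_one)
      ultimately show thesis using result[of v] fin v(1) by blast
    qed
    from True obtain d u x where d: "d \<in> {d1, d2, d3}" and u: "x \<in> A" "act A (r d) u x \<noteq> u x" by blast
    then consider "d = d1" | "d = d2" | "d = d3" by blast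
    then show ?thesis
    proof cases
      case 1
      show ?thesis by (rule gen[of d1 d2 d3 x u]) (use S u 1 in auto)
    next
      case 2
      show ?thesis by (rule gen[of d2 d3 d1 x u]) (use S u 2 in auto)
    next
      case 3
      show ?thesis by (rule gen[of d3 d1 d2 x u]) (use S u 3 in auto)
    qed
  next
    case False
    obtain a where a: "a \<in> A" using A by blast
    define u where "u = (\<lambda>x. of_bool (x = a) :: real)"
    have sG: "s \<in> carrier G" "s \<otimes> s = \<one>" and pG: "p \<in> carrier G" using S by auto
    obtain v c where v: "\<exists>x\<in>A. v x \<noteq> 0" "c * c = 1" "\<And>x. x \<in> A \<Longrightarrow> act A (r s) v x = c * v x"
    proof (cases "\<forall>x\<in>A. u x + 1 * act A (r s) u x = 0")
      case True
      show ?thesis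
        by (rule that[of u "-1"]) (use True a in \<open>auto simp: u_def add_eq_0_iff\<close>)
    next
      case False
      then show ?thesis
        using that[of _ 1] involution_eigenvector[OF r sG, of 1 _ u] by auto
    qed
    have "skew_coefficient A r K v (s \<otimes> p \<otimes> s) = c * (c * skew_coefficient A r K v p)"
      using skew_coefficient_eigen_right[OF r _ sG(1) v(3), of "s \<otimes> p"]
        skew_coefficient_eigen_left[OF r K skew pG sG v(3)] sG pG by simp
    also have "\<dots> = skew_coefficient A r K v p" using v(2) by (simp flip: mult.assoc)
    finally have "skew_coefficient A r K v p = 0"
      using skew_coefficient_inv[OF r K skew pG, of v] S by simp
    moreover have "\<exists>e. e \<noteq> 0 \<and> (\<forall>x\<in>A. act A (r d) v x = e * v x)" if "d \<in> {d1, d2, d3}" for d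
      using False that by (intro exI[of _ 1]) auto
    ultimately show ?thesis using result[of v] fin v(1) by blast
  qed
qed

text \<open>The vector \<open>K v\<close> is orthogonal to the orbit of \<open>v\<close>, so \<open>v\<close> is in the kernel of \<open>K\<close>, which is
  invariant.\<close>

lemma skew_commutant_trivial:
  assumes r: "orthogonal_rep G A r" and irr: "real_irreducible G A r" and K: "commutes_with G A r K"
    and skew: "\<forall>i\<in>A. \<forall>j\<in>A. K i j + K j i = 0"
    and ij: "i \<in> A" "j \<in> A"
  shows "K i j = 0"
proof -
  have A: "finite A" using r by (simp add: orthogonal_rep_def)
  obtain v where v: "\<exists>x\<in>A. v x \<noteq> 0" "\<And>g. g \<in> carrier G \<Longrightarrow> skew_coefficient A r K v g = 0"
    using skew_coefficient_vanishes[OF r K skew] ij by blast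
  have Kv: "act A K v x = 0" if "x \<in> A" for x
    using irr v that unfolding real_irreducible_def skew_coefficient_def by blast
  have "dot A (act A K w) (act A (r g) v) = 0" if g: "g \<in> carrier G" for w g
  proof -
    have "dot A (act A K w) (act A (r g) v) = - dot A w (act A K (act A (r g) v))"
      by (rule dot_skew[OF skew])
    also have "dot A w (act A K (act A (r g) v)) = dot A w (act A (r g) (act A K v))"
      by (rule dot_cong) (simp_all add: commutes_with_act[OF K g])
    also have "act A (r g) (act A K v) = act A (r g) (\<lambda>x. 0)"
      by (rule act_cong) (rule Kv)
    finally show ?thesis by (simp add: act_def dot_def)
  qed
  then have "act A K (\<lambda>x. of_bool (x = j)) i = 0"
    using irr v(1) ij(1) unfolding real_irreducible_def by blast
  then show ?thesis using ij A by (simp add: act_def sum_of_bool)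
qed

lemma absolutely_irreducible_if_real_irreducible:
  fixes m :: nat
  assumes r: "orthogonal_rep G {..<m} r" and irr: "real_irreducible G {..<m} r" and m: "m > 0"
  shows "absolutely_irreducible G {..<m} r"
  unfolding absolutely_irreducible_def
proof (intro allI impI)
  fix X assume X: "commutes_with G {..<m} r X"
  let ?K = "\<lambda>i j. X i j - X j i"
  have "commutes_with G {..<m} r ?K"
    using X commutes_with_transpose[OF r X]
    by (simp add: commutes_with_def left_diff_distrib right_diff_distrib sum_subtractf)
  then have K0: "?K i j = 0" if "i < m" "j < m" for i j
    using skew_commutant_trivial[OF r irr, of ?K i j] that by simp
  have "\<forall>i<m. \<forall>j<m. X i j = X j i"
  proof (intro allI impI)
    fix i j assume "i < m" "j < m"
    from K0[OF this] show "X i j = X j i" by simp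
  qed
  from symmetric_commutant_scalar[OF r irr X this m]
  show "\<exists>c. \<forall>i\<in>{..<m}. \<forall>j\<in>{..<m}. X i j = c * of_bool (i = j)"
    unfolding Ball_def lessThan_iff .
qed

end

section \<open>The irreducible representations of a finite group\<close>

lemma orthogonal_repD:
  assumes "orthogonal_rep G A r"
  shows "finite A"
    and "\<And>i j. i \<in> A \<Longrightarrow> j \<in> A \<Longrightarrow> r \<one>\<^bsub>G\<^esub> i j = of_bool (i = j)"
    and "\<And>g h i j. g \<in> carrier G \<Longrightarrow> h \<in> carrier G \<Longrightarrow> i \<in> A \<Longrightarrow> j \<in> A \<Longrightarrow>
           r (g \<otimes>\<^bsub>G\<^esub> h) i j = (\<Sum>k\<in>A. r g i k * r h k j)"
    and "\<And>g i j. g \<in> carrier G \<Longrightarrow> i \<in> A \<Longrightarrow> j \<in> A \<Longrightarrow> r (inv\<^bsub>G\<^esub> g) i j = r g j i"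
  using assms by (simp_all add: orthogonal_rep_def)

context group
begin

lemma sum_translate_right:
  assumes h: "h \<in> carrier G"
  shows "(\<Sum>g\<in>carrier G. f (g \<otimes> h)) = (\<Sum>g\<in>carrier G. f g)"
  by (rule sum.reindex_bij_witness[of _ "\<lambda>g. g \<otimes> inv h" "\<lambda>g. g \<otimes> h"])
     (use h in \<open>auto simp: m_assoc\<close>)

lemma sum_translate_left:
  assumes h: "h \<in> carrier G"
  shows "(\<Sum>g\<in>carrier G. f (h \<otimes> g)) = (\<Sum>g\<in>carrier G. f g)"
  by (rule sum.reindex_bij_witness[of _ "\<lambda>g. inv h \<otimes> g" "\<lambda>g. h \<otimes> g"])
     (use h in \<open>auto simp: m_assoc[symmetric]\<close>)

text \<open>Averaging \<open>r(g) E s(g^-1)\<close>, for a matrix unit \<open>E\<close>, over the group.\<close>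

lemma coefficient_sum_intertwines:
  assumes r: "orthogonal_rep G A r" and s: "orthogonal_rep G B s"
    and h: "h \<in> carrier G" and a: "a \<in> A" "i \<in> A" and b: "b \<in> B" "j \<in> B"
  shows "(\<Sum>k\<in>A. r h a k * (\<Sum>g\<in>carrier G. r g k i * s g b j))
       = (\<Sum>k\<in>B. (\<Sum>g\<in>carrier G. r g a i * s g k j) * s h k b)"
proof -
  have "(\<Sum>k\<in>A. r h a k * (\<Sum>g\<in>carrier G. r g k i * s g b j))
      = (\<Sum>g\<in>carrier G. r (h \<otimes> g) a i * s (inv h \<otimes> (h \<otimes> g)) b j)"
    unfolding sum_distrib_left
    by (subst sum.swap, intro sum.cong refl)
       (use r h a in \<open>simp add: orthogonal_rep_def sum_distrib_right mult.assoc flip: m_assoc\<close>)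
  also have "\<dots> = (\<Sum>g\<in>carrier G. r g a i * s (inv h \<otimes> g) b j)"
    by (rule sum_translate_left[OF h, of "\<lambda>g. r g a i * s (inv h \<otimes> g) b j"])
  also have "\<dots> = (\<Sum>g\<in>carrier G. \<Sum>k\<in>B. r g a i * s g k j * s h k b)"
    using s h b by (intro sum.cong refl) (simp add: orthogonal_rep_def sum_distrib_left mult_ac)
  also have "\<dots> = (\<Sum>k\<in>B. (\<Sum>g\<in>carrier G. r g a i * s g k j) * s h k b)"
    unfolding sum_distrib_right by (rule sum.swap)
  finally show ?thesis .
qed

lemma schur_orthogonality_disjoint:
  assumes r: "orthogonal_rep G A r" and s: "orthogonal_rep G B s" and "disjoint_reps G A r B s"
    and "a \<in> A" "i \<in> A" and "b \<in> B" "j \<in> B"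
  shows "(\<Sum>g\<in>carrier G. r g a i * s g b j) = 0"
proof -
  let ?T = "\<lambda>a b. \<Sum>g\<in>carrier G. r g a i * s g b j"
  have "\<forall>h\<in>carrier G. \<forall>a\<in>A. \<forall>b\<in>B. (\<Sum>k\<in>A. r h a k * ?T k b) = (\<Sum>k\<in>B. ?T a k * s h k b)"
    using coefficient_sum_intertwines[OF r s] assms(5,7) by blast
  then have "\<forall>a\<in>A. \<forall>b\<in>B. ?T a b = 0"
    by (rule mp[OF spec[OF assms(3)[unfolded disjoint_reps_def], of ?T]])
  from this[rule_format, OF assms(4,6)] show ?thesis .
qed

lemma orthogonal_rep_columns:
  assumes r: "orthogonal_rep G A r" and g: "g \<in> carrier G" and ij: "i \<in> A" "j \<in> A"
  shows "(\<Sum>a\<in>A. r g a i * r g a j) = of_bool (i = j)"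
proof -
  have "r (inv g \<otimes> g) i j = (\<Sum>a\<in>A. r (inv g) i a * r g a j)"
    by (rule orthogonal_repD(3)[OF r]) (use g ij in auto)
  also have "\<dots> = (\<Sum>a\<in>A. r g a i * r g a j)"
    using g ij by (simp add: orthogonal_repD(4)[OF r])
  finally show ?thesis
    using g ij by (simp add: orthogonal_repD(2)[OF r])
qed

lemma schur_orthogonality:
  assumes r: "orthogonal_rep G A r" and irr: "absolutely_irreducible G A r"
    and a: "a \<in> A" "i \<in> A" and b: "b \<in> A" "j \<in> A"
  shows "(\<Sum>g\<in>carrier G. r g a i * r g b j)
       = real (card (carrier G)) / real (card A) * of_bool (a = b) * of_bool (i = j)"
proof -
  have A: "finite A" using r by (simp add: orthogonal_rep_def)
  let ?T = "\<lambda>a b. \<Sum>g\<in>carrier G. r g a i * r g b j"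
  have comm: "commutes_with G A r ?T"
    unfolding commutes_with_def
    using coefficient_sum_intertwines[OF r r _ _ a(2) _ b(2)] by simp
  then obtain c where c: "\<And>a b. a \<in> A \<Longrightarrow> b \<in> A \<Longrightarrow> ?T a b = c * of_bool (a = b)"
    using mp[OF spec[OF irr[unfolded absolutely_irreducible_def], of ?T] comm] by blast
  have "real (card A) * c = (\<Sum>a\<in>A. ?T a a)"
    by (simp add: c)
  also have "\<dots> = (\<Sum>g\<in>carrier G. \<Sum>a\<in>A. r g a i * r g a j)"
    by (rule sum.swap)
  also have "\<dots> = real (card (carrier G)) * of_bool (i = j)"
    using a b by (simp add: orthogonal_rep_columns[OF r])
  finally have *: "real (card A) * c = real (card (carrier G)) * of_bool (i = j)" .
  have "real (card A) > 0" using A a(1) by (auto simp: card_gt_0_iff)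
  then have "c = real (card (carrier G)) / real (card A) * of_bool (i = j)"
    using * by (simp add: field_simps)
  then show ?thesis by (simp add: c a b)
qed

lemma disjoint_reps_sym:
  assumes r: "orthogonal_rep G A r" and s: "orthogonal_rep G B s" and d: "disjoint_reps G A r B s"
  shows "disjoint_reps G B s A r"
  unfolding disjoint_reps_def
proof (intro allI impI)
  fix T assume T: "\<forall>g\<in>carrier G. \<forall>i\<in>B. \<forall>j\<in>A. (\<Sum>k\<in>B. s g i k * T k j) = (\<Sum>k\<in>A. T i k * r g k j)"
  have "(\<Sum>k\<in>A. r g i k * T j k) = (\<Sum>k\<in>B. T k i * s g k j)"
    if g: "g \<in> carrier G" and i: "i \<in> A" and j: "j \<in> B" for g i j
  proof -
    have "(\<Sum>k\<in>B. s (inv g) j k * T k i) = (\<Sum>k\<in>A. T j k * r (inv g) k i)"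
      using T g i j by blast
    then show ?thesis using r s g i j by (simp add: orthogonal_rep_def mult.commute)
  qed
  then have "\<forall>i\<in>A. \<forall>j\<in>B. T j i = 0"
    by (intro mp[OF spec[OF d[unfolded disjoint_reps_def], of "\<lambda>i j. T j i"]]) blast
  then show "\<forall>i\<in>B. \<forall>j\<in>A. T i j = 0" by blast
qed

definition irrep_list :: "nat \<Rightarrow> (nat \<Rightarrow> nat) \<Rightarrow> (nat \<Rightarrow> 'a \<Rightarrow> nat \<Rightarrow> nat \<Rightarrow> real) \<Rightarrow> bool" where
  "irrep_list N d r \<longleftrightarrow>
     (\<forall>p<N. d p > 0 \<and> orthogonal_rep G {..<d p} (r p) \<and> absolutely_irreducible G {..<d p} (r p)) \<and>
     (\<forall>p<N. \<forall>q<N. p \<noteq> q \<longrightarrow> disjoint_reps G {..<d p} (r p) {..<d q} (r q))"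

lemma irrep_list_orthogonality:
  assumes L: "irrep_list N d r" and pq: "p < N" "q < N" and "a < d p" "i < d p" "b < d q" "j < d q"
  shows "(\<Sum>g\<in>carrier G. r p g a i * r q g b j)
       = real (card (carrier G)) / real (d p) * of_bool (p = q \<and> a = b \<and> i = j)"
proof (cases "p = q")
  case True
  then show ?thesis
    using schur_orthogonality[of "{..<d p}" "r p" a i b j] assms by (simp add: irrep_list_def)
next
  case False
  then show ?thesis
    using schur_orthogonality_disjoint[of "{..<d p}" "r p" "{..<d q}" "r q" a i b j] assms
    by (simp add: irrep_list_def)
qed

text \<open>The top left matrix entries, suitably scaled, are orthonormal functions on the group.\<close>

lemma irrep_list_length_le:
  assumes fin: "finite (carrier G)" and L: "irrep_list N d r"
  shows "N \<le> card (carrier G)"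
proof (rule orthonormal_tuple_length_le[OF fin])
  have c: "real (card (carrier G)) > 0"
    using fin by (simp add: card_gt_0_iff) (use one_closed in blast)
  define e where "e p g = sqrt (real (d p) / real (card (carrier G))) * r p g 0 0" for p g
  have "dot (carrier G) (e p) (e q) = of_bool (p = q)" if pq: "p < N" "q < N" for p q
  proof -
    have d: "d p > 0" "d q > 0" using L pq by (auto simp: irrep_list_def)
    have "dot (carrier G) (e p) (e q)
        = sqrt (real (d p) / card (carrier G)) * sqrt (real (d q) / card (carrier G)) *
          (\<Sum>g\<in>carrier G. r p g 0 0 * r q g 0 0)"
      by (simp add: dot_def e_def sum_distrib_left mult_ac)
    also have "\<dots> = of_bool (p = q)"
      using irrep_list_orthogonality[OF L pq d(1,1,2,2)] c d by auto
    finally show ?thesis .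
  qed
  then show "orthonormal_tuple (carrier G) N e" by (simp add: orthonormal_tuple_def)
qed

text \<open>This is right translation, \<open>(g f)(x) = f(x g)\<close>.\<close>

lemma regular_rep:
  assumes fin: "finite (carrier G)"
  shows "orthogonal_rep G (carrier G) (\<lambda>g x y. of_bool (y = x \<otimes> g))"
  unfolding orthogonal_rep_def
proof (intro conjI ballI)
  fix g h x y assume g: "g \<in> carrier G" and h: "h \<in> carrier G" and x: "x \<in> carrier G" and y: "y \<in> carrier G"
  show "(of_bool (y = x \<otimes> (g \<otimes> h)) :: real) = (\<Sum>k\<in>carrier G. of_bool (k = x \<otimes> g) * of_bool (y = k \<otimes> h))"
    by (subst sum_of_bool(1)[OF fin]) (use g h x in \<open>simp add: m_assoc\<close>)
next
  fix g x y assume "g \<in> carrier G" "x \<in> carrier G" "y \<in> carrier G"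
  then have "y = x \<otimes> inv g \<longleftrightarrow> x = y \<otimes> g"
    by (metis inv_solve_right)
  then show "(of_bool (y = x \<otimes> inv g) :: real) = of_bool (x = y \<otimes> g)"
    by simp
qed (auto simp: fin)

lemma act_regular_rep:
  assumes fin: "finite (carrier G)" and "x \<in> carrier G" "g \<in> carrier G"
  shows "act (carrier G) (\<lambda>x y. of_bool (y = x \<otimes> g)) f x = f (x \<otimes> g)"
  using assms by (simp add: act_def sum_of_bool)

text \<open>The functions that are orthogonal to all matrix entries of the list form an invariant subspace of the
  regular representation. A common constituent with the list would consist of functions that are
  matrix entries of the list and at the same time orthogonal to them.\<close>

lemma disjoint_rep_exists:
  assumes fin: "finite (carrier G)" and L: "irrep_list N d r"
    and f: "\<And>p i j. p < N \<Longrightarrow> i < d p \<Longrightarrow> j < d p \<Longrightarrow> (\<Sum>x\<in>carrier G. f x * r p x i j) = 0"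
    and x: "x \<in> carrier G" "f x \<noteq> 0"
  obtains m :: nat and s where "m > 0" "orthogonal_rep G {..<m} s"
    "\<And>p. p < N \<Longrightarrow> disjoint_reps G {..<m} s {..<d p} (r p)"
proof -
  let ?C = "carrier G"
  define reg where "reg g x y = (of_bool (y = x \<otimes> g) :: real)" for g x y
  have reg: "orthogonal_rep G ?C reg"
    unfolding reg_def by (rule regular_rep[OF fin])
  have act_reg: "act ?C (reg g) u x = u (x \<otimes> g)" if "x \<in> ?C" "g \<in> ?C" for g u x
    unfolding reg_def by (rule act_regular_rep[OF fin that])
  define U where "U = {u. \<forall>p<N. \<forall>i<d p. \<forall>j<d p. (\<Sum>x\<in>?C. u x * r p x i j) = 0}"
  have U: "function_space U"
    by (simp add: function_space_def U_def algebra_simps sum.distrib flip: sum_distrib_left)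
  have inv: "act ?C (reg g) u \<in> U" if g: "g \<in> ?C" and u: "u \<in> U" for g u
    unfolding U_def
  proof (intro CollectI allI impI)
    fix p i j assume p: "p < N" and i: "i < d p" and j: "j < d p"
    have "(\<Sum>x\<in>?C. act ?C (reg g) u x * r p x i j)
        = (\<Sum>x\<in>?C. u (x \<otimes> g) * r p ((x \<otimes> g) \<otimes> inv g) i j)"
      by (rule sum.cong[OF refl]) (use g in \<open>simp add: act_reg m_assoc\<close>)
    also have "\<dots> = (\<Sum>x\<in>?C. u x * r p (x \<otimes> inv g) i j)"
      by (rule sum_translate_right[OF g, of "\<lambda>x. u x * r p (x \<otimes> inv g) i j"])
    also have "\<dots> = (\<Sum>x\<in>?C. \<Sum>k<d p. r p (inv g) k j * (u x * r p x i k))"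
      using L p i j g
      by (intro sum.cong refl) (simp add: irrep_list_def orthogonal_rep_def sum_distrib_left mult_ac)
    also have "\<dots> = (\<Sum>k<d p. r p (inv g) k j * (\<Sum>x\<in>?C. u x * r p x i k))"
      by (subst sum.swap) (simp add: sum_distrib_left)
    also have "\<dots> = 0" using u p i by (simp add: U_def)
    finally show "(\<Sum>x\<in>?C. act ?C (reg g) u x * r p x i j) = 0" .
  qed
  obtain m e s where e: "orthonormal_tuple ?C m e" "\<And>i. i < m \<Longrightarrow> e i \<in> U"
    "\<And>f x. f \<in> U \<Longrightarrow> x \<in> ?C \<Longrightarrow> f x = (\<Sum>i<m. dot ?C (e i) f * e i x)"
    and s: "orthogonal_rep G {..<m} s"
    "\<And>g j x. g \<in> ?C \<Longrightarrow> j < m \<Longrightarrow> x \<in> ?C \<Longrightarrow> act ?C (reg g) (e j) x = (\<Sum>i<m. s g i j * e i x)"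
    using subrepresentation[OF reg U inv] by blast
  have "f \<in> U" using f by (simp add: U_def)
  then have "m > 0" using e(3)[of f x] x by (cases m) auto
  moreover have "disjoint_reps G {..<m} s {..<d p} (r p)" if p: "p < N" for p
    unfolding disjoint_reps_def
  proof (intro allI impI)
    fix T assume T: "\<forall>g\<in>?C. \<forall>i\<in>{..<m}. \<forall>j\<in>{..<d p}.
      (\<Sum>k<m. s g i k * T k j) = (\<Sum>k<d p. T i k * r p g k j)"
    have "T i j = 0" if i: "i < m" and j: "j < d p" for i j
    proof -
      define u where "u = (\<lambda>x. \<Sum>k<m. T k j * e k x)"
      have uU: "u \<in> U"
        unfolding u_def by (rule function_space_sum[OF U]) (use e in auto)
      have u_eq: "u x = (\<Sum>l<d p. (\<Sum>i<m. T i l * e i \<one>) * r p x l j)" if x: "x \<in> ?C" for x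
      proof -
        have "e k x = (\<Sum>i<m. s x i k * e i \<one>)" if "k < m" for k
          using s(2)[OF x that one_closed] act_reg[OF one_closed x, of "e k"] x by simp
        then have "u x = (\<Sum>k<m. \<Sum>i<m. s x i k * T k j * e i \<one>)"
          by (simp add: u_def sum_distrib_left mult_ac)
        also have "\<dots> = (\<Sum>i<m. (\<Sum>k<m. s x i k * T k j) * e i \<one>)"
          by (subst sum.swap) (simp add: sum_distrib_right)
        also have "\<dots> = (\<Sum>i<m. \<Sum>l<d p. T i l * e i \<one> * r p x l j)"
          using T x j by (simp add: sum_distrib_right sum_distrib_left mult_ac)
        also have "\<dots> = (\<Sum>l<d p. (\<Sum>i<m. T i l * e i \<one>) * r p x l j)"
          by (subst sum.swap) (simp add: sum_distrib_right)
        finally show ?thesis .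
      qed
      have "dot ?C u u = (\<Sum>x\<in>?C. u x * (\<Sum>l<d p. (\<Sum>i<m. T i l * e i \<one>) * r p x l j))"
        unfolding dot_def by (rule sum.cong[OF refl]) (use u_eq in auto)
      also have "\<dots> = (\<Sum>l<d p. (\<Sum>i<m. T i l * e i \<one>) * (\<Sum>x\<in>?C. u x * r p x l j))"
        unfolding sum_distrib_left by (subst sum.swap) (simp add: mult_ac)
      also have "\<dots> = 0"
        using uU p j by (simp add: U_def)
      finally have "\<forall>x\<in>?C. u x = 0"
        using dot_self_eq_0_iff[OF fin] by blast
      then have "dot ?C (e i) u = 0" by (simp add: dot_def)
      moreover have "dot ?C (e i) u = T i j"
        using e(1) i by (simp add: u_def dot_sum_right orthonormal_tuple_def sum_of_bool cong: sum.cong_simp)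
      ultimately show ?thesis by simp
    qed
    then show "\<forall>i\<in>{..<m}. \<forall>j\<in>{..<d p}. T i j = 0" by simp
  qed
  ultimately show ?thesis using that s(1) by blast
qed

text \<open>A representation of least degree among those that share no constituent with the list is irreducible:
  an orbit that does not span would lie in a subrepresentation of smaller degree, which inherits the
  disjointness.\<close>

lemma irreducible_disjoint_rep_exists:
  fixes m :: nat
  assumes m: "m > 0" and s: "orthogonal_rep G {..<m} s"
    and disj: "\<And>p. p < N \<Longrightarrow> disjoint_reps G {..<m} s {..<d p} (r p)"
  obtains m' :: nat and s' where "m' > 0" "orthogonal_rep G {..<m'} s'" "real_irreducible G {..<m'} s'"
    "\<And>p. p < N \<Longrightarrow> disjoint_reps G {..<m'} s' {..<d p} (r p)"
proof -
  define P where "P m \<longleftrightarrow> m > 0 \<and> (\<exists>s. orthogonal_rep G {..<m} s \<and>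
      (\<forall>p<N. disjoint_reps G {..<m} s {..<d p} (r p)))" for m :: nat
  have "P m" using assms by (auto simp: P_def)
  then have PL: "P (LEAST m. P m)" and least: "\<And>k. P k \<Longrightarrow> (LEAST m. P m) \<le> k"
    by (auto intro: LeastI Least_le)
  define l where "l = (LEAST m. P m)"
  note PL = PL[folded l_def] and least = least[folded l_def]
  obtain t where l: "l > 0" and t: "orthogonal_rep G {..<l} t"
    and dt: "\<And>p. p < N \<Longrightarrow> disjoint_reps G {..<l} t {..<d p} (r p)"
    using PL unfolding P_def by blast
  \<comment> \<open>Minimality of \<open>l\<close> excludes the invariant space of the vectors whose orbits are orthogonal to \<open>w\<close>.\<close>
  have "real_irreducible G {..<l} t"
    unfolding real_irreducible_def
  proof (intro allI impI ballI)
    fix u w i assume u: "\<exists>i\<in>{..<l}. u i \<noteq> 0"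
      and w: "\<forall>g\<in>carrier G. dot {..<l} w (act {..<l} (t g) u) = 0" and i: "i \<in> {..<l}"
    define U where "U = {y. \<forall>g\<in>carrier G. dot {..<l} w (act {..<l} (t g) y) = 0}"
    have U: "function_space U"
      by (auto simp: function_space_def U_def act_add dot_add_right) (simp add: act_def dot_def)
    have inv: "act {..<l} (t g) y \<in> U" if g: "g \<in> carrier G" and y: "y \<in> U" for g y
      unfolding U_def
    proof (intro CollectI ballI)
      fix h assume h: "h \<in> carrier G"
      have "dot {..<l} w (act {..<l} (t h) (act {..<l} (t g) y)) = dot {..<l} w (act {..<l} (t (h \<otimes> g)) y)"
        by (rule dot_cong) (simp_all add: act_mult[OF t h g])
      then show "dot {..<l} w (act {..<l} (t h) (act {..<l} (t g) y)) = 0"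
        using y g h by (simp add: U_def)
    qed
    obtain k e q where e: "orthonormal_tuple {..<l} k e" "\<And>i. i < k \<Longrightarrow> e i \<in> U"
      "\<And>f x. f \<in> U \<Longrightarrow> x \<in> {..<l} \<Longrightarrow> f x = (\<Sum>i<k. dot {..<l} (e i) f * e i x)"
      and q: "orthogonal_rep G {..<k} q"
      "\<And>g j x. g \<in> carrier G \<Longrightarrow> j < k \<Longrightarrow> x \<in> {..<l} \<Longrightarrow> act {..<l} (t g) (e j) x = (\<Sum>i<k. q g i j * e i x)"
      using subrepresentation[OF t U inv] by blast
    have uU: "u \<in> U" using w by (simp add: U_def)
    have k0: "k > 0" using e(3)[OF uU] u by (cases k) auto
    have dq: "disjoint_reps G {..<k} q {..<d p} (r p)" if p: "p < N" for p
      unfolding disjoint_reps_def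
    proof (intro allI impI)
      fix T assume T: "\<forall>g\<in>carrier G. \<forall>i\<in>{..<k}. \<forall>j\<in>{..<d p}.
        (\<Sum>a<k. q g i a * T a j) = (\<Sum>a<d p. T i a * r p g a j)"
      define S where "S x j = (\<Sum>a<k. T a j * e a x)" for x j
      have "(\<Sum>y<l. t g x y * S y j) = (\<Sum>b<d p. S x b * r p g b j)"
        if g: "g \<in> carrier G" and x: "x < l" and j: "j < d p" for g x j
      proof -
        have "(\<Sum>y<l. t g x y * S y j) = (\<Sum>a<k. T a j * act {..<l} (t g) (e a) x)"
          using act_sum[of "{..<l}" "t g" "\<lambda>a. T a j" e "{..<k}"]
          by (simp add: S_def act_def fun_eq_iff)
        also have "\<dots> = (\<Sum>a<k. \<Sum>i<k. q g i a * T a j * e i x)"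
          using q(2)[OF g _ , of _ x] x by (simp add: sum_distrib_left mult_ac)
        also have "\<dots> = (\<Sum>i<k. (\<Sum>a<k. q g i a * T a j) * e i x)"
          by (subst sum.swap) (simp add: sum_distrib_right)
        also have "\<dots> = (\<Sum>i<k. \<Sum>b<d p. T i b * e i x * r p g b j)"
          using T g j by (simp add: sum_distrib_right sum_distrib_left mult_ac)
        also have "\<dots> = (\<Sum>b<d p. S x b * r p g b j)"
          unfolding S_def sum_distrib_right by (rule sum.swap)
        finally show ?thesis .
      qed
      then have "\<forall>x\<in>{..<l}. \<forall>j\<in>{..<d p}. S x j = 0"
        by (intro mp[OF spec[OF dt[OF p, unfolded disjoint_reps_def], of S]]) simp
      then have "dot {..<l} (e i) (\<lambda>x. S x j) = 0" if "j < d p" for i j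
        using that by (simp add: dot_def)
      moreover have "dot {..<l} (e i) (\<lambda>x. S x j) = T i j" if "i < k" for i j
        using e(1) that unfolding S_def
        by (simp add: dot_sum_right orthonormal_tuple_def sum_of_bool cong: sum.cong_simp)
      ultimately show "\<forall>i\<in>{..<k}. \<forall>j\<in>{..<d p}. T i j = 0" by (metis lessThan_iff)
    qed
    have lk: "l \<le> k" by (rule least) (use k0 q(1) dq in \<open>auto simp: P_def\<close>)
    show "w i = 0"
    proof (rule ccontr)
      assume wi: "w i \<noteq> 0"
      have ww: "dot {..<l} w w > 0"
        using dot_self_eq_0_iff[of "{..<l}" w] dot_self_nonneg[of "{..<l}" w] wi i by force
      define c where "c = 1 / sqrt (dot {..<l} w w)"
      have cc: "c * (c * dot {..<l} w w) = 1" using ww by (simp add: c_def field_simps)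
      have we: "dot {..<l} w (e j) = 0" if "j < k" for j
      proof -
        have "dot {..<l} w (e j) = dot {..<l} w (act {..<l} (t \<one>) (e j))"
          by (rule dot_cong) (simp_all add: act_one[OF t])
        then show ?thesis using e(2)[OF that] by (simp add: U_def)
      qed
      then have ew: "dot {..<l} (e j) w = 0" if "j < k" for j
        using that by (simp add: dot_commute)
      have "orthonormal_tuple {..<l} (Suc k) (e(k := \<lambda>y. c * w y))"
        using e(1) we ew cc
        by (auto simp: orthonormal_tuple_def less_Suc_eq dot_scale_left dot_scale_right)
      then have "Suc k \<le> l"
        using orthonormal_tuple_length_le[of "{..<l}"] by fastforce
      then show False using lk by simp
    qed
  qed
  with l t dt show ?thesis using that by blast
qed

end

text \<open>In a list of maximal length, the difference of the two sides is orthogonal to all matrix entries of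
  the list. If it were nonzero, the list could be extended.\<close>

lemma (in sign_structured_group) complete_irrep_list_exists:
  assumes fin: "finite (carrier G)"
  obtains N d r where "irrep_list N d r"
    "\<And>g. g \<in> carrier G \<Longrightarrow>
       (\<Sum>p<N. real (d p) / real (card (carrier G)) * (\<Sum>i<d p. r p g i i)) = of_bool (g = \<one>)"
proof -
  let ?C = "carrier G"
  have c: "real (card ?C) > 0"
    using fin by (simp add: card_gt_0_iff) (use one_closed in blast)
  define Q where "Q N \<longleftrightarrow> (\<exists>d r. irrep_list N d r)" for N
  have "Q 0" by (simp add: Q_def irrep_list_def)
  moreover have "\<forall>N. Q N \<longrightarrow> N \<le> card ?C"
    using irrep_list_length_le[OF fin] by (auto simp: Q_def)
  ultimately obtain N where "Q N" and max: "\<And>M. Q M \<Longrightarrow> M \<le> N"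
    using Nat.ex_has_greatest_nat[of Q 0 "card ?C"] by blast
  then obtain d r where L: "irrep_list N d r" by (auto simp: Q_def)
  define f where
    "f g = of_bool (g = \<one>) - (\<Sum>p<N. real (d p) / real (card ?C) * (\<Sum>i<d p. r p g i i))" for g
  have f_orth: "(\<Sum>x\<in>?C. f x * r p x i j) = 0" if p: "p < N" and i: "i < d p" and j: "j < d p" for p i j
  proof -
    have "(\<Sum>x\<in>?C. (\<Sum>q<N. real (d q) / real (card ?C) * (\<Sum>k<d q. r q x k k)) * r p x i j)
        = (\<Sum>x\<in>?C. \<Sum>q<N. \<Sum>k<d q. real (d q) / real (card ?C) * (r q x k k * r p x i j))"
      by (simp add: sum_distrib_left sum_distrib_right mult_ac)
    also have "\<dots> = (\<Sum>q<N. \<Sum>k<d q. real (d q) / real (card ?C) * (\<Sum>x\<in>?C. r q x k k * r p x i j))"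
      by (subst sum.swap, intro sum.cong refl, subst sum.swap) (simp add: sum_distrib_left)
    also have "\<dots> = (\<Sum>q<N. \<Sum>k<d q. of_bool (q = p \<and> k = i \<and> k = j))"
    proof (intro sum.cong refl)
      fix q k assume q: "q \<in> {..<N}" and k: "k \<in> {..<d q}"
      have "d q > 0" using L q by (auto simp: irrep_list_def)
      then show "real (d q) / real (card ?C) * (\<Sum>x\<in>?C. r q x k k * r p x i j) = of_bool (q = p \<and> k = i \<and> k = j)"
        using irrep_list_orthogonality[OF L _ p _ _ i j, of q k k] q k c by simp
    qed
    also have "\<dots> = (\<Sum>q<N. of_bool (q = p) * (\<Sum>k<d q. of_bool (k = i) * of_bool (i = j)))"
      unfolding sum_distrib_left by (intro sum.cong refl) auto
    also have "\<dots> = of_bool (i = j)"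
      using p i by (simp only: sum_of_bool finite_lessThan lessThan_iff) simp
    finally have *: "(\<Sum>x\<in>?C. (\<Sum>q<N. real (d q) / real (card ?C) * (\<Sum>k<d q. r q x k k)) * r p x i j)
      = of_bool (i = j)" .
    have "(\<Sum>x\<in>?C. of_bool (x = \<one>) * r p x i j) = of_bool (i = j)"
      using L p i j fin by (simp add: sum_of_bool irrep_list_def orthogonal_rep_def)
    then show ?thesis
      unfolding f_def left_diff_distrib sum_subtractf * by simp
  qed
  have "f g = 0" if g: "g \<in> ?C" for g
  proof (rule ccontr)
    assume nz: "f g \<noteq> 0"
    obtain m0 s0 where "m0 > 0" "orthogonal_rep G {..<m0::nat} s0"
      "\<And>p. p < N \<Longrightarrow> disjoint_reps G {..<m0} s0 {..<d p} (r p)"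
      using disjoint_rep_exists[OF fin L f_orth g nz] by blast
    then obtain m s where m: "m > 0" and s: "orthogonal_rep G {..<m::nat} s" "real_irreducible G {..<m} s"
      and disj: "\<And>p. p < N \<Longrightarrow> disjoint_reps G {..<m} s {..<d p} (r p)"
      using irreducible_disjoint_rep_exists by blast
    have ai: "absolutely_irreducible G {..<m} s"
      by (rule absolutely_irreducible_if_real_irreducible[OF s m])
    have rp: "orthogonal_rep G {..<d p} (r p)" if "p < N" for p
      using L that by (simp add: irrep_list_def)
    have "irrep_list (Suc N) (d(N := m)) (r(N := s))"
      using L m s(1) ai disj disjoint_reps_sym[OF s(1) rp disj]
      by (auto simp: irrep_list_def less_Suc_eq)
    then have "Q (Suc N)" unfolding Q_def by blast
    then show False using max[of "Suc N"] by simp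
  qed
  then show ?thesis using that[OF L] by (simp add: f_def)
qed

section \<open>Complex matrix representations\<close>

lemma subspace_module_vec_iff:
  "VectorSpace.subspace class_ring W (module_vec TYPE(complex) d) \<longleftrightarrow>
     W \<subseteq> carrier_vec d \<and> 0\<^sub>v d \<in> W \<and> (\<forall>v\<in>W. \<forall>w\<in>W. v + w \<in> W) \<and> (\<forall>c. \<forall>v\<in>W. c \<cdot>\<^sub>v v \<in> W)"
proof -
  have "vectorspace class_ring (module_vec TYPE(complex) d)" by (rule vec_vs)
  moreover have "Module.module class_ring (module_vec TYPE(complex) d)" by (rule vec_module)
  ultimately show ?thesis
    by (simp add: VectorSpace.subspace_def submodule_def module_vec_simps class_ring_simps Ball_def) blast
qed

lemma subspace_sum:
  assumes W: "VectorSpace.subspace class_ring W (module_vec TYPE(complex) d)"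
    and "finite I" "\<And>i. i \<in> I \<Longrightarrow> u i \<in> W"
  shows "Matrix.vec d (\<lambda>a. \<Sum>i\<in>I. c i * vec_index (u i) a) \<in> W"
  using assms(2,3)
proof (induction I rule: finite_induct)
  case empty
  have "Matrix.vec d (\<lambda>a. 0) = (0\<^sub>v d :: complex Matrix.vec)" by auto
  then show ?case using W by (simp add: subspace_module_vec_iff)
next
  case (insert i I)
  have ui: "u i \<in> carrier_vec d" using insert.prems[of i] W by (auto simp: subspace_module_vec_iff)
  have "c i \<cdot>\<^sub>v u i + Matrix.vec d (\<lambda>a. \<Sum>i\<in>I. c i * vec_index (u i) a) \<in> W"
    using insert W by (simp add: subspace_module_vec_iff)
  also have "c i \<cdot>\<^sub>v u i + Matrix.vec d (\<lambda>a. \<Sum>i\<in>I. c i * vec_index (u i) a)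
      = Matrix.vec d (\<lambda>a. \<Sum>i\<in>insert i I. c i * vec_index (u i) a)"
    using insert.hyps ui by (intro eq_vecI) auto
  finally show ?case .
qed

lemma mult_mat_vec_index:
  assumes "A \<in> carrier_mat n m" "v \<in> carrier_vec m" "i < n"
  shows "vec_index (A *\<^sub>v v) i = (\<Sum>j<m. A $$ (i, j) * vec_index v j)"
  using assms by (simp add: scalar_prod_def lessThan_atLeast0)

lemma mult_mat_index:
  assumes "A \<in> carrier_mat n m" "B \<in> carrier_mat m l" "i < n" "j < l"
  shows "(A * B) $$ (i, j) = (\<Sum>k<m. A $$ (i, k) * B $$ (k, j))"
  using assms by (simp add: scalar_prod_def lessThan_atLeast0)

lemma mat_mult_unit_vec:
  assumes "A \<in> carrier_mat n m" "j < m"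
  shows "A *\<^sub>v unit_vec m j = (col A j :: complex Matrix.vec)"
  using assms by (intro eq_vecI) auto

lemma mult_mat_vec_eq_0D:
  assumes S: "S \<in> carrier_mat n m" and z: "\<And>v. v \<in> carrier_vec m \<Longrightarrow> S *\<^sub>v v = (0\<^sub>v n :: complex Matrix.vec)"
  shows "S = 0\<^sub>m n m"
proof (rule eq_matI)
  fix i j assume ij: "i < dim_row (0\<^sub>m n m :: complex mat)" "j < dim_col (0\<^sub>m n m :: complex mat)"
  have "vec_index (S *\<^sub>v unit_vec m j) i = 0" using z[of "unit_vec m j"] ij by simp
  then show "S $$ (i, j) = 0\<^sub>m n m $$ (i, j)" using S ij by (simp add: mat_mult_unit_vec[OF S])
qed (use S in auto)

lemma mult_mat_zero_vec: "A \<in> carrier_mat n m \<Longrightarrow> A *\<^sub>v 0\<^sub>v m = (0\<^sub>v n :: complex Matrix.vec)"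
  by (intro eq_vecI) auto

text \<open>Schur's lemma: the kernel and the image of an intertwiner are invariant.\<close>

lemma schur_complex:
  assumes irr: "irreducible_representation G d \<Gamma>" "irreducible_representation G d' \<Gamma>'"
    and S: "S \<in> carrier_mat d' d" and int: "\<And>g. g \<in> G \<Longrightarrow> S * \<Gamma> g = \<Gamma>' g * S" and nz: "S \<noteq> 0\<^sub>m d' d"
  shows "d = d' \<and> invertible_mat S"
proof -
  have G: "\<Gamma> g \<in> carrier_mat d d" "\<Gamma>' g \<in> carrier_mat d' d'" if "g \<in> G" for g
    using irr that by (auto simp: irreducible_representation_def matrix_representation_def)
  have min: "W = {0\<^sub>v d} \<or> W = carrier_vec d"
    if "VectorSpace.subspace class_ring W (module_vec TYPE(complex) d)" "\<And>g w. g \<in> G \<Longrightarrow> w \<in> W \<Longrightarrow> \<Gamma> g *\<^sub>v w \<in> W" for W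
    using irr(1) that unfolding irreducible_representation_def by blast
  have min': "W = {0\<^sub>v d'} \<or> W = carrier_vec d'"
    if "VectorSpace.subspace class_ring W (module_vec TYPE(complex) d')" "\<And>g w. g \<in> G \<Longrightarrow> w \<in> W \<Longrightarrow> \<Gamma>' g *\<^sub>v w \<in> W" for W
    using irr(2) that unfolding irreducible_representation_def by blast
  let ?ker = "{v \<in> carrier_vec d. S *\<^sub>v v = 0\<^sub>v d'}"
  let ?im = "(\<lambda>v. S *\<^sub>v v) ` carrier_vec d"
  have "?ker = {0\<^sub>v d} \<or> ?ker = carrier_vec d"
  proof (rule min)
    show "VectorSpace.subspace class_ring ?ker (module_vec TYPE(complex) d)"
      using S by (auto simp: subspace_module_vec_iff mult_add_distrib_mat_vec mult_mat_vec mult_mat_zero_vec)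
    fix g w assume g: "g \<in> G" and w: "w \<in> ?ker"
    have wd: "w \<in> carrier_vec d" and Sw: "S *\<^sub>v w = 0\<^sub>v d'" using w by auto
    have "S *\<^sub>v (\<Gamma> g *\<^sub>v w) = (S * \<Gamma> g) *\<^sub>v w"
      by (rule assoc_mult_mat_vec[OF S G(1)[OF g] wd, symmetric])
    also have "\<dots> = (\<Gamma>' g * S) *\<^sub>v w" by (simp only: int[OF g])
    also have "\<dots> = \<Gamma>' g *\<^sub>v (S *\<^sub>v w)"
      by (rule assoc_mult_mat_vec[OF G(2)[OF g] S wd])
    also have "\<dots> = 0\<^sub>v d'" unfolding Sw using G(2)[OF g] by (rule mult_mat_zero_vec)
    finally show "\<Gamma> g *\<^sub>v w \<in> ?ker" using G[OF g] w by auto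
  qed
  then have ker: "?ker = {0\<^sub>v d}"
    using mult_mat_vec_eq_0D[OF S] nz by blast
  have "?im = {0\<^sub>v d'} \<or> ?im = carrier_vec d'"
  proof (rule min')
    have "S *\<^sub>v v + S *\<^sub>v w \<in> ?im" if "v \<in> carrier_vec d" "w \<in> carrier_vec d" for v w
      using S that by (intro image_eqI[of _ _ "v + w"]) (auto simp: mult_add_distrib_mat_vec)
    moreover have "c \<cdot>\<^sub>v (S *\<^sub>v v) \<in> ?im" if "v \<in> carrier_vec d" for v c
      using S that by (intro image_eqI[of _ _ "c \<cdot>\<^sub>v v"]) (auto simp: mult_mat_vec)
    moreover have "0\<^sub>v d' \<in> ?im"
      using S by (intro image_eqI[of _ _ "0\<^sub>v d"]) (auto simp: mult_mat_zero_vec)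
    ultimately show "VectorSpace.subspace class_ring ?im (module_vec TYPE(complex) d')"
      using S by (auto simp: subspace_module_vec_iff)
    fix g w assume g: "g \<in> G" and "w \<in> ?im"
    then obtain v where v: "v \<in> carrier_vec d" "w = S *\<^sub>v v" by blast
    have "\<Gamma>' g *\<^sub>v w = (\<Gamma>' g * S) *\<^sub>v v"
      unfolding v(2) by (rule assoc_mult_mat_vec[OF G(2)[OF g] S v(1), symmetric])
    also have "\<dots> = (S * \<Gamma> g) *\<^sub>v v" by (simp only: int[OF g])
    also have "\<dots> = S *\<^sub>v (\<Gamma> g *\<^sub>v v)"
      by (rule assoc_mult_mat_vec[OF S G(1)[OF g] v(1)])
    finally show "\<Gamma>' g *\<^sub>v w \<in> ?im" using G[OF g] v(1) by auto
  qed
  moreover have "?im \<noteq> {0\<^sub>v d'}"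
    using mult_mat_vec_eq_0D[OF S] nz by blast
  ultimately have im: "?im = carrier_vec d'" by blast
  define v where "v i = (SOME v. v \<in> carrier_vec d \<and> S *\<^sub>v v = unit_vec d' i)" for i
  have v: "v i \<in> carrier_vec d \<and> S *\<^sub>v v i = unit_vec d' i" for i
    unfolding v_def
  proof (rule someI_ex)
    have "unit_vec d' i \<in> ?im" unfolding im by simp
    then show "\<exists>v. v \<in> carrier_vec d \<and> S *\<^sub>v v = unit_vec d' i" by force
  qed
  define R where "R = Matrix.mat d d' (\<lambda>(a, i). vec_index (v i) a)"
  have R: "R \<in> carrier_mat d d'" by (simp add: R_def)
  have Rx: "R $$ (k, b) = vec_index (v b) k" if "k < d" "b < d'" for k b
    using that by (simp add: R_def)
  have SR: "S * R = 1\<^sub>m d'"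
  proof (rule eq_matI)
    fix a b assume ab: "a < dim_row (1\<^sub>m d' :: complex mat)" "b < dim_col (1\<^sub>m d' :: complex mat)"
    have "(S * R) $$ (a, b) = (\<Sum>k<d. S $$ (a, k) * vec_index (v b) k)"
      using ab by (simp add: mult_mat_index[OF S R] Rx del: index_mult_mat(1))
    also have "\<dots> = vec_index (S *\<^sub>v v b) a"
      by (rule mult_mat_vec_index[OF S, symmetric]) (use v[of b] ab in auto)
    finally show "(S * R) $$ (a, b) = 1\<^sub>m d' $$ (a, b)"
      using v[of b] ab by simp
  qed (use S R in auto)
  have RSv: "(R * S) *\<^sub>v w = w" if w: "w \<in> carrier_vec d" for w
  proof -
    let ?u = "(R * S) *\<^sub>v w"
    have u: "?u \<in> carrier_vec d" using R S w by simp
    have RSc: "R * S \<in> carrier_mat d d" using R S by simp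
    have "S *\<^sub>v ?u = (S * (R * S)) *\<^sub>v w"
      by (rule assoc_mult_mat_vec[OF S RSc w, symmetric])
    also have "S * (R * S) = (S * R) * S" by (rule assoc_mult_mat[OF S R S, symmetric])
    also have "\<dots> *\<^sub>v w = S *\<^sub>v w" using S SR by simp
    finally have "S *\<^sub>v (?u - w) = 0\<^sub>v d'"
      using S u w by (simp add: mult_minus_distrib_mat_vec)
    then have "?u - w \<in> ?ker" using u w by simp
    then have d0: "?u - w = 0\<^sub>v d" using ker by blast
    show ?thesis
    proof (rule eq_vecI)
      fix i assume "i < dim_vec w"
      then show "vec_index ?u i = vec_index w i"
        using arg_cong[OF d0, of "\<lambda>x. vec_index x i"] u w by simp
    qed (use R w in auto)
  qed
  have RS: "R * S = 1\<^sub>m d"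
  proof (rule eq_matI)
    fix a b assume ab: "a < dim_row (1\<^sub>m d :: complex mat)" "b < dim_col (1\<^sub>m d :: complex mat)"
    have RSc: "R * S \<in> carrier_mat d d" using R S by simp
    have "(R * S) $$ (a, b) = vec_index ((R * S) *\<^sub>v unit_vec d b) a"
      using ab carrier_matD[OF RSc] by (simp add: mat_mult_unit_vec[OF RSc] del: index_mult_mat)
    also have "\<dots> = 1\<^sub>m d $$ (a, b)" using RSv[of "unit_vec d b"] ab by simp
    finally show "(R * S) $$ (a, b) = 1\<^sub>m d $$ (a, b)" .
  qed (use S R in auto)
  \<comment> \<open>Comparing traces shows that the two degrees agree.\<close>
  have "of_nat d' = (\<Sum>i<d'. (S * R) $$ (i, i))" by (simp add: SR)
  also have "\<dots> = (\<Sum>i<d'. \<Sum>k<d. S $$ (i, k) * R $$ (k, i))"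
    by (simp add: mult_mat_index[OF S R] del: index_mult_mat(1))
  also have "\<dots> = (\<Sum>k<d. \<Sum>i<d'. R $$ (k, i) * S $$ (i, k))"
    by (subst sum.swap) (simp add: mult.commute)
  also have "\<dots> = (\<Sum>k<d. (R * S) $$ (k, k))"
    by (simp add: mult_mat_index[OF R S] del: index_mult_mat(1))
  also have "\<dots> = of_nat d" by (simp add: RS)
  finally have "of_nat d' = (of_nat d :: complex)" .
  then have dd: "d = d'" by simp
  then have "invertible_mat S"
    using S R SR RS unfolding invertible_mat_def inverts_mat_def by (auto intro!: exI[of _ R])
  with dd show ?thesis by blast
qed

definition matrix_group :: "(real^3^3) set \<Rightarrow> (real^3^3) monoid" where
  "matrix_group G = \<lparr>carrier = G, mult = (**), one = mat 1\<rparr>"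

lemma matrix_group_simps [simp]:
  "carrier (matrix_group G) = G" "mult (matrix_group G) = (**)" "one (matrix_group G) = mat 1"
  by (simp_all add: matrix_group_def)

definition complex_rep :: "nat \<Rightarrow> ('g \<Rightarrow> nat \<Rightarrow> nat \<Rightarrow> real) \<Rightarrow> 'g \<Rightarrow> complex mat" where
  "complex_rep d r g = Matrix.mat d d (\<lambda>(i, j). complex_of_real (r g i j))"

lemma complex_rep_carrier [simp]: "complex_rep d r g \<in> carrier_mat d d"
  by (simp add: complex_rep_def)

lemma complex_rep_index [simp]: "i < d \<Longrightarrow> j < d \<Longrightarrow> complex_rep d r g $$ (i, j) = complex_of_real (r g i j)"
  by (simp add: complex_rep_def)

lemma complex_rep_dim [simp]: "dim_row (complex_rep d r g) = d" "dim_col (complex_rep d r g) = d"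
  by (simp_all add: complex_rep_def)

locale finite_matrix_group = group "matrix_group G" for G :: "(real^3^3) set" +
  assumes finite_group: "finite G"
begin

lemma complex_rep_representation:
  assumes r: "orthogonal_rep (matrix_group G) {..<d} r"
  shows "matrix_representation G d (complex_rep d r)"
  unfolding matrix_representation_def
proof (intro conjI ballI)
  show "complex_rep d r (mat 1) = 1\<^sub>m d"
    using orthogonal_repD(2)[OF r] by (intro eq_matI) auto
  fix g h assume g: "g \<in> G" and h: "h \<in> G"
  show "complex_rep d r (g ** h) = complex_rep d r g * complex_rep d r h"
  proof (rule eq_matI)
    fix i j assume "i < dim_row (complex_rep d r g * complex_rep d r h)" "j < dim_col (complex_rep d r g * complex_rep d r h)"
    then have ij: "i < d" "j < d" by auto
    then show "complex_rep d r (g ** h) $$ (i, j) = (complex_rep d r g * complex_rep d r h) $$ (i, j)"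
      using orthogonal_repD(3)[OF r, of g h i j] g h
      by (simp add: mult_mat_index[OF complex_rep_carrier complex_rep_carrier] del: index_mult_mat(1))
  qed auto
qed simp

lemma complex_rep_unitary:
  assumes r: "orthogonal_rep (matrix_group G) {..<d} r" and g: "g \<in> G"
  shows "unitary_matrix (complex_rep d r g)"
proof -
  let ?g = "inv\<^bsub>matrix_group G\<^esub> g"
  have ig: "?g \<in> G" using inv_closed[of g] g by simp
  have adj: "mat_adjoint (complex_rep d r g) = complex_rep d r ?g"
  proof (rule eq_matI)
    fix i j assume "i < dim_row (complex_rep d r ?g)" "j < dim_col (complex_rep d r ?g)"
    then have ij: "i < d" "j < d" by auto
    then show "mat_adjoint (complex_rep d r g) $$ (i, j) = complex_rep d r ?g $$ (i, j)"
      using orthogonal_repD(4)[OF r, of g i j] g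
      by (simp add: mat_adjoint_def mat_of_rows_index)
  qed (simp_all add: mat_adjoint_def)
  have rep: "complex_rep d r (mat 1) = 1\<^sub>m d"
    "complex_rep d r (a ** b) = complex_rep d r a * complex_rep d r b" if "a \<in> G" "b \<in> G" for a b
    using complex_rep_representation[OF r] that by (auto simp: matrix_representation_def)
  have inv: "?g ** g = mat 1" "g ** ?g = mat 1"
    using l_inv[of g] r_inv[of g] g by simp_all
  show ?thesis
    unfolding unitary_matrix_def inverts_mat_def adj
    using rep(2)[OF g ig] rep(2)[OF ig g] rep(1)[OF g g] inv by simp
qed

text \<open>Schur orthogonality expresses every vector as a combination of the orbit of a given nonzero vector
  \<open>w\<close>: the coefficient at \<open>g\<close> is a multiple of the inner product with \<open>g w\<close>.\<close>

lemma complex_rep_irreducible: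
  assumes r: "orthogonal_rep (matrix_group G) {..<d} r" and irr: "absolutely_irreducible (matrix_group G) {..<d} r"
    and d: "d > 0"
  shows "irreducible_representation G d (complex_rep d r)"
  unfolding irreducible_representation_def
proof (intro conjI allI impI)
  show "matrix_representation G d (complex_rep d r)" by (rule complex_rep_representation[OF r])
  fix W assume W: "VectorSpace.subspace class_ring W (module_vec TYPE(complex) d) \<and>
      (\<forall>g\<in>G. \<forall>w\<in>W. complex_rep d r g *\<^sub>v w \<in> W)"
  have Wc: "W \<subseteq> carrier_vec d" "0\<^sub>v d \<in> W" using W by (auto simp: subspace_module_vec_iff)
  have "W = carrier_vec d" if ne: "W \<noteq> {0\<^sub>v d}"
  proof
    show "carrier_vec d \<subseteq> W"
    proof
      fix z :: "complex Matrix.vec" assume z: "z \<in> carrier_vec d"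
      obtain w where w: "w \<in> W" "w \<noteq> 0\<^sub>v d" using ne Wc(2) by blast
      have wd: "w \<in> carrier_vec d" using w Wc by blast
      define x where "x i = vec_index w i" for i
      define y where "y i = vec_index z i" for i
      define q where "q = (\<Sum>i<d. (cmod (x i))\<^sup>2)"
      obtain i where i: "i < d" "x i \<noteq> 0"
        using w(2) wd unfolding x_def by (metis carrier_vecD eq_vecI index_zero_vec)
      have q: "q > 0"
        unfolding q_def by (rule sum_pos2[of _ i]) (use i in auto)
      have cG: "real (card G) > 0"
        using finite_group one_closed by (auto simp: card_gt_0_iff)
      define K where "K = complex_of_real (real d / (real (card G) * q))"
      define c where "c g = K * (\<Sum>b<d. cnj (\<Sum>j<d. of_real (r g b j) * x j) * y b)" for g
      have "Matrix.vec d (\<lambda>a. \<Sum>g\<in>G. c g * vec_index (complex_rep d r g *\<^sub>v w) a) \<in> W"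
        by (rule subspace_sum[OF conjunct1[OF W] finite_group]) (use W w in blast)
      also have "Matrix.vec d (\<lambda>a. \<Sum>g\<in>G. c g * vec_index (complex_rep d r g *\<^sub>v w) a) = z"
      proof (rule eq_vecI)
        fix a assume "a < dim_vec z"
        then have a: "a < d" using z by simp
        have ob: "(\<Sum>i<d. f i * of_bool (i = j)) = f j" "(\<Sum>i<d. f i * of_bool (j = i)) = f j"
          if "j < d" for f :: "nat \<Rightarrow> complex" and j
          using that by (simp_all add: of_bool_def if_distrib cong: if_cong)
        have "(\<Sum>g\<in>G. c g * vec_index (complex_rep d r g *\<^sub>v w) a)
            = (\<Sum>g\<in>G. \<Sum>b<d. \<Sum>j<d. \<Sum>i<d. K * y b * cnj (x j) * x i * of_real (r g b j * r g a i))"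
          using a wd by (simp add: mult_mat_vec_index[OF complex_rep_carrier] c_def x_def sum_distrib_left
              sum_distrib_right mult_ac del: index_mult_mat_vec)
        also have "\<dots> = (\<Sum>b<d. \<Sum>j<d. \<Sum>i<d. K * y b * cnj (x j) * x i * of_real (\<Sum>g\<in>G. r g b j * r g a i))"
          unfolding of_real_sum sum_distrib_left
          by (subst sum.swap, intro sum.cong refl, subst sum.swap, intro sum.cong refl, rule sum.swap)
        also have "\<dots> = (\<Sum>b<d. \<Sum>j<d. \<Sum>i<d. K * y b * cnj (x j) * x i *
            of_real (real (card G) / real d) * of_bool (b = a) * of_bool (j = i))"
          using schur_orthogonality[OF r irr] a by (intro sum.cong refl) (simp add: of_bool_def)
        also have "\<dots> = (\<Sum>b<d. \<Sum>j<d. K * y b * cnj (x j) * x j *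
            of_real (real (card G) / real d) * of_bool (b = a))"
          by (intro sum.cong refl, subst ob(2)) (simp_all add: mult_ac)
        also have "\<dots> = (\<Sum>j<d. \<Sum>b<d. K * y b * cnj (x j) * x j *
            of_real (real (card G) / real d) * of_bool (b = a))"
          by (rule sum.swap)
        also have "\<dots> = (\<Sum>j<d. K * y a * cnj (x j) * x j * of_real (real (card G) / real d))"
          by (intro sum.cong refl, subst ob(1)) (simp_all add: a)
        also have "\<dots> = K * y a * of_real (real (card G) / real d) * of_real q"
          by (simp add: q_def sum_distrib_left sum_divide_distrib complex_norm_square mult_ac del: of_real_power)
        also have "\<dots> = y a"
          using q cG d by (simp add: K_def)
        finally show "vec_index (Matrix.vec d (\<lambda>a. \<Sum>g\<in>G. c g * vec_index (complex_rep d r g *\<^sub>v w) a)) a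
          = vec_index z a"
          using a by (simp add: y_def)
      qed (use z in auto)
      finally show "z \<in> W" .
    qed
  qed (rule Wc)
  then show "W = {0\<^sub>v d} \<or> W = carrier_vec d" by blast
qed (rule d)

text \<open>The real and the imaginary part of an intertwiner are real intertwiners.\<close>

lemma complex_rep_inequivalent:
  assumes disj: "disjoint_reps (matrix_group G) {..<d'} r' {..<d} r" and d: "d > 0"
  shows "\<not> equivalent_representations G d (complex_rep d r) d' (complex_rep d' r')"
proof
  assume "equivalent_representations G d (complex_rep d r) d' (complex_rep d' r')"
  then obtain T where dd: "d' = d" and T: "T \<in> carrier_mat d d" and inv: "invertible_mat T"
    and int: "\<And>g. g \<in> G \<Longrightarrow> T * complex_rep d r g = complex_rep d r' g * T"
    by (auto simp: equivalent_representations_def)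
  have e: "(\<Sum>k<d. complex_of_real (r' g i k) * T $$ (k, j)) = (\<Sum>k<d. T $$ (i, k) * complex_of_real (r g k j))"
    if "g \<in> G" "i < d" "j < d" for g i j
    using arg_cong[OF int[OF that(1)], of "\<lambda>M. M $$ (i, j)"] that
    by (simp add: mult_mat_index[OF T complex_rep_carrier] mult_mat_index[OF complex_rep_carrier T] del: index_mult_mat(1))
  note disj = disj[unfolded dd disjoint_reps_def matrix_group_simps]
  have "\<forall>i\<in>{..<d}. \<forall>j\<in>{..<d}. Re (T $$ (i, j)) = 0"
    by (intro mp[OF spec[OF disj, of "\<lambda>i j. Re (T $$ (i, j))"]] ballI)
       (use arg_cong[OF e, of _ _ _ Re] in simp)
  moreover have "\<forall>i\<in>{..<d}. \<forall>j\<in>{..<d}. Im (T $$ (i, j)) = 0"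
    by (intro mp[OF spec[OF disj, of "\<lambda>i j. Im (T $$ (i, j))"]] ballI)
       (use arg_cong[OF e, of _ _ _ Im] in simp)
  ultimately have T0: "T = 0\<^sub>m d d"
    using T by (intro eq_matI) (auto simp: complex_eq_iff)
  obtain B where "inverts_mat T B" "inverts_mat B T" using inv by (auto simp: invertible_mat_def)
  then have "T * B = 1\<^sub>m d" using T by (simp add: inverts_mat_def)
  moreover have "dim_col B = d" using arg_cong[OF calculation, of dim_col] by simp
  ultimately have "(0\<^sub>m d d * B) $$ (0, 0) = (1 :: complex)" using d T0 by simp
  moreover have "dim_row B = d"
    using \<open>inverts_mat B T\<close> T unfolding inverts_mat_def
    by (metis carrier_matD(2) index_mult_mat(3) index_one_mat(3))
  ultimately show False
    using d \<open>dim_col B = d\<close> by (simp add: scalar_prod_def)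
qed

text \<open>Multiplying the identity for the unit element by an irreducible representation and summing over the
  group shows that some average of matrix entries of the two is nonzero. Such averages are the entries
  of intertwiners, to which Schur's lemma applies.\<close>

theorem unitary_irreps_of_irrep_list:
  assumes L: "irrep_list N d r"
    and delta: "\<And>g. g \<in> G \<Longrightarrow> (\<Sum>p<N. real (d p) / real (card G) * (\<Sum>i<d p. r p g i i))
      = of_bool (g = mat 1)"
  shows "unitary_irreps G N d (\<lambda>p. complex_rep (d p) (r p))"
  unfolding unitary_irreps_def
proof (intro conjI allI impI ballI)
  fix p assume p: "p < N"
  have rp: "d p > 0" "orthogonal_rep (matrix_group G) {..<d p} (r p)" "absolutely_irreducible (matrix_group G) {..<d p} (r p)"
    using L p by (auto simp: irrep_list_def)
  show "irreducible_representation G (d p) (complex_rep (d p) (r p))"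
    by (rule complex_rep_irreducible[OF rp(2,3,1)])
  show "unitary_matrix (complex_rep (d p) (r p) g)" if "g \<in> G" for g
    by (rule complex_rep_unitary[OF rp(2) that])
  fix q assume "q < N" "p \<noteq> q"
  then show "\<not> equivalent_representations G (d p) (complex_rep (d p) (r p)) (d q) (complex_rep (d q) (r q))"
    using L p rp(1) by (intro complex_rep_inequivalent) (auto simp: irrep_list_def)
next
  fix d' \<Gamma>' assume irr: "irreducible_representation G d' \<Gamma>'"
  have G': "\<And>g. g \<in> G \<Longrightarrow> \<Gamma>' g \<in> carrier_mat d' d'" "\<Gamma>' (mat 1) = 1\<^sub>m d'"
    "\<And>g h. g \<in> G \<Longrightarrow> h \<in> G \<Longrightarrow> \<Gamma>' (g ** h) = \<Gamma>' g * \<Gamma>' h" and d': "d' > 0"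
    using irr by (auto simp: irreducible_representation_def matrix_representation_def)
  have oneG: "mat 1 \<in> G" using one_closed by simp
  have "(\<Sum>p<N. \<Sum>j<d p. of_real (real (d p) / real (card G)) * (\<Sum>g\<in>G. of_real (r p g j j) * \<Gamma>' g $$ (0, 0)))
      = (\<Sum>p<N. \<Sum>g\<in>G. \<Sum>j<d p. of_real (real (d p) / real (card G)) * (of_real (r p g j j) * \<Gamma>' g $$ (0, 0)))"
    unfolding sum_distrib_left by (intro sum.cong refl, rule sum.swap)
  also have "\<dots> = (\<Sum>g\<in>G. of_real (\<Sum>p<N. real (d p) / real (card G) * (\<Sum>i<d p. r p g i i)) * \<Gamma>' g $$ (0, 0))"
    by (subst sum.swap) (simp add: sum_distrib_left sum_distrib_right mult_ac)
  also have "\<dots> = (\<Sum>g\<in>G. if g = mat 1 then \<Gamma>' g $$ (0, 0) else 0)"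
  proof (rule sum.cong[OF refl])
    fix g assume g: "g \<in> G"
    show "of_real (\<Sum>p<N. real (d p) / real (card G) * (\<Sum>i<d p. r p g i i)) * \<Gamma>' g $$ (0, 0)
        = (if g = mat 1 then \<Gamma>' g $$ (0, 0) else 0)"
      unfolding delta[OF g] by simp
  qed
  also have "\<dots> = 1" using finite_group oneG G'(2) d' by simp
  finally have "(\<Sum>p<N. \<Sum>j<d p. of_real (real (d p) / real (card G)) *
      (\<Sum>g\<in>G. of_real (r p g j j) * \<Gamma>' g $$ (0, 0))) \<noteq> (0 :: complex)" by simp
  then obtain p where "p \<in> {..<N}" and pnz: "(\<Sum>j<d p. of_real (real (d p) / real (card G)) *
      (\<Sum>g\<in>G. of_real (r p g j j) * \<Gamma>' g $$ (0, 0))) \<noteq> (0 :: complex)"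
    by (rule sum.not_neutral_contains_not_neutral)
  then have p: "p < N" by simp
  from pnz obtain j where "j \<in> {..<d p}" and jnz: "of_real (real (d p) / real (card G)) *
      (\<Sum>g\<in>G. of_real (r p g j j) * \<Gamma>' g $$ (0, 0)) \<noteq> (0 :: complex)"
    by (rule sum.not_neutral_contains_not_neutral)
  then have j: "j < d p" and nz: "(\<Sum>g\<in>G. of_real (r p g j j) * \<Gamma>' g $$ (0, 0)) \<noteq> (0 :: complex)"
    by auto
  have rp: "d p > 0" "orthogonal_rep (matrix_group G) {..<d p} (r p)" "absolutely_irreducible (matrix_group G) {..<d p} (r p)"
    using L p by (auto simp: irrep_list_def)
  define S where "S = Matrix.mat d' (d p) (\<lambda>(a, b). \<Sum>g\<in>G. \<Gamma>' g $$ (a, 0) * of_real (r p g b j))"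
  have S: "S \<in> carrier_mat d' (d p)" by (simp add: S_def)
  have Sx: "S $$ (a, b) = (\<Sum>g\<in>G. \<Gamma>' g $$ (a, 0) * of_real (r p g b j))" if "a < d'" "b < d p" for a b
    using that by (simp add: S_def)
  have "S $$ (0, j) \<noteq> 0" using nz d' j by (simp add: Sx mult.commute)
  then have S0: "S \<noteq> 0\<^sub>m d' (d p)" using d' j by auto
  have int: "S * complex_rep (d p) (r p) h = \<Gamma>' h * S" if h: "h \<in> G" for h
  proof (rule eq_matI)
    fix a b assume "a < dim_row (\<Gamma>' h * S)" "b < dim_col (\<Gamma>' h * S)"
    then have ab: "a < d'" "b < d p" using G'(1)[OF h] S by auto
    let ?h = "inv\<^bsub>matrix_group G\<^esub> h"
    have ih: "?h \<in> G" using inv_closed[of h] h by simp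
    have hh: "?h ** (h ** g) = g" for g
      using l_inv[of h] h by (simp add: matrix_mul_assoc)
    have "(\<Gamma>' h * S) $$ (a, b) = (\<Sum>k<d'. \<Sum>g\<in>G. \<Gamma>' h $$ (a, k) * \<Gamma>' g $$ (k, 0) * of_real (r p g b j))"
      using ab by (simp add: mult_mat_index[OF G'(1)[OF h] S] Sx sum_distrib_left mult.assoc del: index_mult_mat(1))
    also have "\<dots> = (\<Sum>g\<in>G. (\<Gamma>' h * \<Gamma>' g) $$ (a, 0) * of_real (r p g b j))"
      using ab d' by (subst sum.swap)
        (simp add: mult_mat_index[OF G'(1)[OF h] G'(1)] sum_distrib_right del: index_mult_mat(1))
    also have "\<dots> = (\<Sum>g\<in>G. \<Gamma>' (h ** g) $$ (a, 0) * of_real (r p (?h ** (h ** g)) b j))"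
      by (rule sum.cong[OF refl]) (simp add: G'(3)[OF h] hh)
    also have "\<dots> = (\<Sum>g\<in>G. \<Gamma>' g $$ (a, 0) * of_real (r p (?h ** g) b j))"
      using sum_translate_left[of h "\<lambda>g. \<Gamma>' g $$ (a, 0) * of_real (r p (?h ** g) b j)"] h by simp
    also have "\<dots> = (\<Sum>g\<in>G. \<Sum>k<d p. \<Gamma>' g $$ (a, 0) * of_real (r p g k j) * of_real (r p h k b))"
    proof (rule sum.cong[OF refl])
      fix g assume g: "g \<in> G"
      have "r p (?h ** g) b j = (\<Sum>k<d p. r p h k b * r p g k j)"
        using orthogonal_repD(3)[OF rp(2), of ?h g b j] orthogonal_repD(4)[OF rp(2), of h b] ih h g ab j by simp
      then show "\<Gamma>' g $$ (a, 0) * of_real (r p (?h ** g) b j)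
          = (\<Sum>k<d p. \<Gamma>' g $$ (a, 0) * of_real (r p g k j) * of_real (r p h k b))"
        by (simp add: sum_distrib_left mult_ac)
    qed
    also have "\<dots> = (S * complex_rep (d p) (r p) h) $$ (a, b)"
      using ab by (subst sum.swap)
        (simp add: mult_mat_index[OF S complex_rep_carrier] Sx sum_distrib_right del: index_mult_mat(1))
    finally show "(S * complex_rep (d p) (r p) h) $$ (a, b) = (\<Gamma>' h * S) $$ (a, b)" ..
  qed (use S G'(1)[OF h] in auto)
  have "d p = d' \<and> invertible_mat S"
    by (rule schur_complex[OF complex_rep_irreducible[OF rp(2,3,1)] irr S int S0])
  then show "\<exists>p<N. equivalent_representations G (d p) (complex_rep (d p) (r p)) d' \<Gamma>'"
    using p S int by (intro exI[of _ p]) (auto simp: equivalent_representations_def)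
qed

end

section \<open>The surface measure of the sphere\<close>

lemma space_sphere_measure: "space sphere_measure = sphere 0 1"
  by (simp add: sphere_measure_def space_scale_measure space_restrict_space)

lemma sets_sphere_measure: "sets sphere_measure = sets (restrict_space borel (sphere 0 1))"
  by (simp add: sphere_measure_def)

lemma sets_sphere_measure_iff: "A \<in> sets sphere_measure \<longleftrightarrow> A \<in> sets borel \<and> A \<subseteq> sphere 0 1"
  by (auto simp: sets_sphere_measure sets_restrict_space_iff)

lemma borel_measurable_sphere_measure:
  "f \<in> borel_measurable borel \<Longrightarrow> f \<in> borel_measurable sphere_measure"
  by (subst measurable_cong_sets[OF sets_sphere_measure refl]) (rule measurable_restrict_space1)

lemma continuous_borel_measurable_sphere_measure:
  "continuous_on UNIV f \<Longrightarrow> f \<in> borel_measurable sphere_measure"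
  by (intro borel_measurable_sphere_measure borel_measurable_continuous_onI)

lemma radial_projection_measurable:
  "(\<lambda>x::real^3. x /\<^sub>R norm x) \<in> measurable (restrict_space lborel (ball 0 1 - {0})) (restrict_space borel (sphere 0 1))"
  by (rule measurable_restrict_space3) (auto simp: norm_inverse)

lemma emeasure_sphere_measure:
  assumes "A \<in> sets sphere_measure"
  shows "emeasure sphere_measure A = 3 * emeasure lborel {x \<in> ball 0 1 - {0}. x /\<^sub>R norm x \<in> A}"
proof -
  let ?B = "ball 0 1 - {0} :: (real^3) set"
  have "emeasure sphere_measure A
      = 3 * emeasure (restrict_space lborel ?B) ((\<lambda>x. x /\<^sub>R norm x) -` A \<inter> space (restrict_space lborel ?B))"
    unfolding sphere_measure_def emeasure_scale_measure
    by (subst emeasure_distr[OF radial_projection_measurable]) (use assms in \<open>simp_all add: sets_sphere_measure\<close>)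
  also have "emeasure (restrict_space lborel ?B) ((\<lambda>x. x /\<^sub>R norm x) -` A \<inter> space (restrict_space lborel ?B))
      = emeasure lborel ((\<lambda>x. x /\<^sub>R norm x) -` A \<inter> space (restrict_space lborel ?B))"
    by (rule emeasure_restrict_space) (auto simp: space_restrict_space)
  also have "(\<lambda>x. x /\<^sub>R norm x) -` A \<inter> space (restrict_space lborel ?B) = {x \<in> ?B. x /\<^sub>R norm x \<in> A}"
    by (auto simp: space_restrict_space)
  finally show ?thesis .
qed

lemma radial_cone_sets:
  assumes "A \<in> sets sphere_measure"
  shows "{x \<in> ball 0 1 - {0}. x /\<^sub>R norm x \<in> A} \<in> sets (borel :: (real^3) measure)"
proof -
  have "A \<in> sets borel" using assms by (simp add: sets_sphere_measure_iff)
  then have "(\<lambda>x::real^3. x /\<^sub>R norm x) -` A \<inter> space borel \<in> sets borel"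
    by (intro measurable_sets[of _ borel borel]) simp_all
  moreover have "{x \<in> ball 0 1 - {0}. x /\<^sub>R norm x \<in> A}
      = ((\<lambda>x::real^3. x /\<^sub>R norm x) -` A \<inter> space borel) \<inter> (ball 0 1 - {0})"
    by (simp add: set_eq_iff conj_commute)
  moreover have "ball 0 1 - {0} \<in> sets (borel :: (real^3) measure)"
    by (intro borel_open open_delete open_ball)
  ultimately show ?thesis by (simp only: sets.Int)
qed

lemma finite_sphere_measure: "finite_measure sphere_measure"
proof
  have "emeasure lborel {x \<in> ball 0 1 - {0}. x /\<^sub>R norm x \<in> sphere (0::real^3) 1} \<le> emeasure lborel (ball 0 1 :: (real^3) set)"
    by (rule emeasure_mono) auto
  also have "\<dots> < \<infinity>"
    using emeasure_lborel_ball_finite[of "0::real^3" 1] by simp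
  finally have "emeasure lborel {x \<in> ball 0 1 - {0}. x /\<^sub>R norm x \<in> sphere (0::real^3) 1} < \<infinity>" .
  then show "emeasure sphere_measure (space sphere_measure) \<noteq> \<infinity>"
    unfolding space_sphere_measure
    by (subst emeasure_sphere_measure)
       (auto simp: sets_sphere_measure_iff ennreal_mult_eq_top_iff less_top)
qed

interpretation sphere: finite_measure sphere_measure
  by (rule finite_sphere_measure)

lemma integrable_continuous_sphere_measure:
  fixes f :: "real^3 \<Rightarrow> 'b::{banach, second_countable_topology}"
  assumes f: "continuous_on UNIV f"
  shows "integrable sphere_measure f"
proof -
  have "compact (f ` sphere 0 1)"
    by (rule compact_continuous_image) (auto intro: continuous_on_subset[OF f])
  then obtain B where "\<And>x. x \<in> sphere 0 1 \<Longrightarrow> norm (f x) \<le> B"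
    using compact_imp_bounded bounded_iff by (metis image_eqI)
  then show ?thesis
    by (intro sphere.integrable_const_bound[where B = B] AE_I2)
       (auto simp: space_sphere_measure continuous_borel_measurable_sphere_measure f)
qed

lemma orthogonal_matrix_norm:
  fixes A :: "real^3^3"
  assumes "orthogonal_matrix A"
  shows "norm (A *v x) = norm x"
proof -
  have "orthogonal_transformation ((*v) A)"
    using assms by (simp add: orthogonal_transformation_matrix matrix_vector_mul_linear)
  then show ?thesis by (simp add: orthogonal_transformation_norm)
qed

lemma orthogonal_matrix_mul_transpose:
  fixes A :: "real^3^3"
  assumes "orthogonal_matrix A"
  shows "A *v (transpose A *v x) = x" "transpose A *v (A *v x) = x"
  using assms by (simp_all only: orthogonal_matrix_def matrix_vector_mul_assoc matrix_vector_mul_lid)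

lemma measurable_rotation_sphere_measure:
  assumes A: "orthogonal_matrix (A :: real^3^3)"
  shows "(\<lambda>x. A *v x) \<in> measurable sphere_measure sphere_measure"
proof -
  have "(\<lambda>x. A *v x) \<in> measurable (restrict_space borel (sphere 0 1)) (restrict_space borel (sphere 0 1))"
    by (rule measurable_restrict_space3)
       (auto simp: orthogonal_matrix_norm[OF A] intro!: borel_measurable_continuous_onI matrix_vector_mult_linear_continuous_on)
  then show ?thesis
    by (simp add: measurable_cong_sets[OF sets_sphere_measure sets_sphere_measure])
qed

text \<open>The radial projection commutes with rotations, which preserve the volume of cones.\<close>

lemma distr_sphere_measure_rotation:
  assumes A: "orthogonal_matrix (A :: real^3^3)"
  shows "distr sphere_measure sphere_measure (\<lambda>x. A *v x) = sphere_measure"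
proof (rule measure_eqI)
  define B where "B = transpose A"
  have B: "orthogonal_matrix B" and AB: "A *v (B *v x) = x" "B *v (A *v x) = x" for x
    using A orthogonal_matrix_mul_transpose[OF A] by (simp_all add: B_def del: transpose_matrix_vector)
  fix X assume "X \<in> sets (distr sphere_measure sphere_measure (\<lambda>x. A *v x))"
  then have X: "X \<in> sets sphere_measure" by simp
  let ?X' = "(\<lambda>x. A *v x) -` X \<inter> space sphere_measure"
  let ?C = "\<lambda>X. {x \<in> ball 0 1 - {0} :: (real^3) set. x /\<^sub>R norm x \<in> X}"
  have X': "?X' \<in> sets sphere_measure"
    by (rule measurable_sets[OF measurable_rotation_sphere_measure[OF A] X])
  have img: "?C ?X' = (\<lambda>x. B *v x) ` ?C X"
  proof
    show "(\<lambda>x. B *v x) ` ?C X \<subseteq> ?C ?X'"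
    proof
      fix y assume "y \<in> (\<lambda>x. B *v x) ` ?C X"
      then obtain x where y: "y = B *v x" and x: "norm x < 1" "x \<noteq> 0" "x /\<^sub>R norm x \<in> X"
        by auto
      have n: "norm y = norm x"
        unfolding y by (rule orthogonal_matrix_norm[OF B])
      then have "y \<noteq> 0" using x(2) by auto
      moreover have "A *v (y /\<^sub>R norm y) = x /\<^sub>R norm x"
        unfolding n by (simp add: y matrix_vector_mult_scaleR AB)
      ultimately show "y \<in> ?C ?X'"
        using x n by (simp add: space_sphere_measure norm_inverse)
    qed
    show "?C ?X' \<subseteq> (\<lambda>x. B *v x) ` ?C X"
    proof
      fix x assume x: "x \<in> ?C ?X'"
      then have "A *v x \<in> ?C X"
        using orthogonal_matrix_norm[OF A, of x]
        by (auto simp: matrix_vector_mult_scaleR)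
      then show "x \<in> (\<lambda>x. B *v x) ` ?C X"
        using AB(2)[of x] by (metis (no_types, lifting) image_eqI)
    qed
  qed
  have fin: "emeasure lborel (?C X) \<noteq> \<infinity>" for X
  proof -
    have "emeasure lborel (?C X) \<le> emeasure lborel (ball 0 1 :: (real^3) set)"
      by (rule emeasure_mono) auto
    then show ?thesis using emeasure_lborel_ball_finite[of "0::real^3" 1] by (auto simp: top_unique)
  qed
  have lm: "?C X \<in> lmeasurable" if "X \<in> sets sphere_measure" for X
    using radial_cone_sets[OF that] fin[of X] by (intro fmeasurableI) (auto simp: less_top)
  have ot: "orthogonal_transformation (\<lambda>x. B *v x)"
    using B by (simp add: orthogonal_transformation_matrix matrix_vector_mul_linear)
  have lb: "measure lebesgue (?C X) = measure lborel (?C X)" if "X \<in> sets sphere_measure" for X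
    by (rule measure_completion) (simp only: sets_lborel radial_cone_sets[OF that])
  have "measure lborel (?C ?X') = measure lborel (?C X)"
    using measure_orthogonal_image[OF ot lm[OF X]] unfolding img[symmetric] lb[OF X'] lb[OF X] .
  then have "emeasure lborel (?C ?X') = emeasure lborel (?C X)"
    by (simp only: emeasure_eq_ennreal_measure[OF fin[unfolded infinity_ennreal_def]])
  then have "emeasure sphere_measure ?X' = emeasure sphere_measure X"
    by (simp add: emeasure_sphere_measure X X')
  then show "emeasure (distr sphere_measure sphere_measure (\<lambda>x. A *v x)) X = emeasure sphere_measure X"
    by (simp add: emeasure_distr[OF measurable_rotation_sphere_measure[OF A] X])
qed simp

lemma integral_sphere_measure_rotation:
  fixes f :: "real^3 \<Rightarrow> 'b::{banach, second_countable_topology}"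
  assumes A: "orthogonal_matrix (A :: real^3^3)" and f: "f \<in> borel_measurable sphere_measure"
  shows "(LINT x|sphere_measure. f (A *v x)) = (LINT x|sphere_measure. f x)"
  using integral_distr[OF measurable_rotation_sphere_measure[OF A] f]
  by (simp add: distr_sphere_measure_rotation[OF A])

text \<open>The points of the ball in whose direction the function does not vanish form a nonempty open set.\<close>

lemma sphere_norm_pos:
  fixes f :: "real^3 \<Rightarrow> complex"
  assumes f: "continuous_on UNIV f" and x0: "norm x0 = 1" "f x0 \<noteq> 0"
  shows "(LINT x|sphere_measure. (cmod (f x))\<^sup>2) > 0"
proof (rule ccontr)
  assume neg: "\<not> ?thesis"
  have int: "integrable sphere_measure (\<lambda>x. (cmod (f x))\<^sup>2)"
    by (intro integrable_continuous_sphere_measure continuous_intros f)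
  have "(LINT x|sphere_measure. (cmod (f x))\<^sup>2) \<ge> 0" by simp
  then have "(LINT x|sphere_measure. (cmod (f x))\<^sup>2) = 0" using neg by linarith
  then have ae: "AE x in sphere_measure. (cmod (f x))\<^sup>2 = 0"
    using integral_nonneg_eq_0_iff_AE[OF int] by simp
  let ?Z = "{x \<in> space sphere_measure. f x \<noteq> 0}"
  have Z: "?Z \<in> sets sphere_measure"
    using continuous_borel_measurable_sphere_measure[OF f] by measurable
  have "emeasure sphere_measure ?Z = 0"
    using ae by (subst (asm) AE_iff_measurable[OF Z]) auto
  then have 0: "emeasure lborel {x \<in> ball 0 1 - {0}. x /\<^sub>R norm x \<in> ?Z} = 0"
    by (simp add: emeasure_sphere_measure[OF Z])
  let ?B = "ball 0 1 - {0} :: (real^3) set"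
  have eq: "{x \<in> ?B. x /\<^sub>R norm x \<in> ?Z} = ?B \<inter> (\<lambda>x. f (x /\<^sub>R norm x)) -` (- {0})"
    by (auto simp: space_sphere_measure)
  have "continuous_on ?B (\<lambda>x. f (x /\<^sub>R norm x))"
    by (rule continuous_on_compose2[OF f]) (auto intro!: continuous_intros)
  then have "open {x \<in> ?B. x /\<^sub>R norm x \<in> ?Z}"
    unfolding eq by (rule continuous_open_preimage) auto
  moreover have "(1/2) *\<^sub>R x0 \<in> {x \<in> ?B. x /\<^sub>R norm x \<in> ?Z}"
    using x0 by (auto simp: space_sphere_measure)
  ultimately have "\<not> negligible {x \<in> ?B. x /\<^sub>R norm x \<in> ?Z}"
    using open_not_negligible by blast
  moreover have "{x \<in> ?B. x /\<^sub>R norm x \<in> ?Z} \<in> null_sets lborel"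
    using 0 radial_cone_sets[OF Z] by (auto simp: null_sets_def)
  ultimately show False
    by (simp add: negligible_iff_null_sets null_sets_completionI)
qed

section \<open>Square integrable functions on the sphere\<close>

definition mean_square :: "(real^3 \<Rightarrow> complex) \<Rightarrow> real" where
  "mean_square f = (LINT x|sphere_measure. (cmod (f x))\<^sup>2)"

lemma sphere_L2D:
  assumes "f \<in> sphere_L2"
  shows "f \<in> borel_measurable sphere_measure" "integrable sphere_measure (\<lambda>x. (cmod (f x))\<^sup>2)"
  using assms by (auto simp: sphere_L2_def)

lemma sphere_L2_continuous: "continuous_on UNIV f \<Longrightarrow> f \<in> sphere_L2"
  by (simp add: sphere_L2_def continuous_borel_measurable_sphere_measure)
     (intro integrable_continuous_sphere_measure continuous_intros)

lemma cmod_add_sq: "(cmod (a + b))\<^sup>2 \<le> 2 * (cmod a)\<^sup>2 + 2 * (cmod b)\<^sup>2"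
proof -
  have "(cmod (a + b))\<^sup>2 \<le> (cmod a + cmod b)\<^sup>2"
    by (intro power_mono norm_triangle_ineq) simp
  also have "\<dots> \<le> 2 * (cmod a)\<^sup>2 + 2 * (cmod b)\<^sup>2"
    using sum_squares_ge_zero[of "cmod a - cmod b" 0] by (simp add: power2_eq_square algebra_simps)
  finally show ?thesis .
qed

lemma sphere_L2_add:
  assumes f: "f \<in> sphere_L2" and g: "g \<in> sphere_L2"
  shows "(\<lambda>x. f x + g x) \<in> sphere_L2"
  unfolding sphere_L2_def
proof (intro CollectI conjI)
  show m: "(\<lambda>x. f x + g x) \<in> borel_measurable sphere_measure"
    using sphere_L2D(1)[OF f] sphere_L2D(1)[OF g] by measurable
  show "integrable sphere_measure (\<lambda>x. (cmod (f x + g x))\<^sup>2)"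
    by (rule Bochner_Integration.integrable_bound[of _ "\<lambda>x. 2 * (cmod (f x))\<^sup>2 + 2 * (cmod (g x))\<^sup>2"])
       (use f g m in \<open>auto simp: sphere_L2D cmod_add_sq\<close>)
qed

lemma sphere_L2_scale: "f \<in> sphere_L2 \<Longrightarrow> (\<lambda>x. c * f x) \<in> sphere_L2"
  by (auto simp: sphere_L2_def norm_mult power_mult_distrib)

lemma sphere_L2_diff:
  assumes "f \<in> sphere_L2" "g \<in> sphere_L2"
  shows "(\<lambda>x. f x - g x) \<in> sphere_L2"
  using sphere_L2_add[OF assms(1) sphere_L2_scale[OF assms(2), of "-1"]] by simp

lemma sphere_L2_sum:
  "(\<And>i. i \<in> I \<Longrightarrow> f i \<in> sphere_L2) \<Longrightarrow> (\<lambda>x. \<Sum>i\<in>I. f i x) \<in> sphere_L2"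
proof (induction I rule: infinite_finite_induct)
  case (insert i I)
  then show ?case by (simp add: sphere_L2_add)
qed (auto intro: sphere_L2_continuous)

lemma integrable_sphere_product:
  assumes f: "f \<in> sphere_L2" and g: "g \<in> sphere_L2"
  shows "integrable sphere_measure (\<lambda>x. cnj (f x) * g x)"
proof (rule Bochner_Integration.integrable_bound)
  show "integrable sphere_measure (\<lambda>x. (cmod (f x))\<^sup>2 + (cmod (g x))\<^sup>2)"
    using f g by (simp add: sphere_L2D)
  have "(\<lambda>x. cnj (f x)) \<in> borel_measurable sphere_measure"
    by (rule borel_measurable_continuous_on[OF _ sphere_L2D(1)[OF f]]) (intro continuous_intros)
  then show "(\<lambda>x. cnj (f x) * g x) \<in> borel_measurable sphere_measure"
    by (rule borel_measurable_times[OF _ sphere_L2D(1)[OF g]])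
  have "a * b \<le> a\<^sup>2 + b\<^sup>2" for a b :: real
    using zero_le_power2[of "a - b"] zero_le_power2[of a] zero_le_power2[of b]
    unfolding power2_diff by linarith
  then show "AE x in sphere_measure. norm (cnj (f x) * g x) \<le> norm ((cmod (f x))\<^sup>2 + (cmod (g x))\<^sup>2)"
    by (intro AE_I2) (simp add: norm_mult)
qed

lemma mean_square_nonneg: "mean_square f \<ge> 0"
  by (simp add: mean_square_def)

text \<open>A weak form of the triangle inequality, in which the squares are kept.\<close>

lemma mean_square_add:
  assumes "f \<in> sphere_L2" "g \<in> sphere_L2"
  shows "mean_square (\<lambda>x. f x + g x) \<le> 2 * mean_square f + 2 * mean_square g"
proof -
  have "mean_square (\<lambda>x. f x + g x) \<le> (LINT x|sphere_measure. 2 * (cmod (f x))\<^sup>2 + 2 * (cmod (g x))\<^sup>2)"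
    unfolding mean_square_def
    by (rule integral_mono) (use assms sphere_L2_add[OF assms] in \<open>auto simp: sphere_L2D cmod_add_sq\<close>)
  then show ?thesis using assms by (simp add: sphere_L2D mean_square_def)
qed

lemma mean_square_scale: "mean_square (\<lambda>x. c * f x) = (cmod c)\<^sup>2 * mean_square f"
  by (simp add: mean_square_def norm_mult power_mult_distrib)

lemma mean_square_triangle:
  assumes "f \<in> sphere_L2" "g \<in> sphere_L2" "h \<in> sphere_L2"
  shows "mean_square (\<lambda>x. f x - h x) \<le> 2 * mean_square (\<lambda>x. f x - g x) + 2 * mean_square (\<lambda>x. g x - h x)"
  using mean_square_add[OF sphere_L2_diff[OF assms(1,2)] sphere_L2_diff[OF assms(2,3)]] by simp

text \<open>Functions that agree almost everywhere are not identified; closedness includes them, as their mean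
  square distance is zero.\<close>

definition closed_subspace :: "(real^3 \<Rightarrow> complex) set \<Rightarrow> bool" where
  "closed_subspace V \<longleftrightarrow> V \<subseteq> sphere_L2 \<and>
     (\<forall>f\<in>V. \<forall>g\<in>V. (\<lambda>x. f x + g x) \<in> V) \<and> (\<forall>f\<in>V. \<forall>c. (\<lambda>x. c * f x) \<in> V) \<and>
     (\<forall>f\<in>sphere_L2. (\<forall>\<epsilon>>0. \<exists>g\<in>V. mean_square (\<lambda>x. f x - g x) < \<epsilon>) \<longrightarrow> f \<in> V)"

definition mean_square_span :: "'k set \<Rightarrow> ('k \<Rightarrow> real^3 \<Rightarrow> complex) \<Rightarrow> (real^3 \<Rightarrow> complex) set" where
  "mean_square_span K e = {f \<in> sphere_L2. \<forall>\<epsilon>>0. \<exists>S c. finite S \<and> S \<subseteq> K \<and>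
     mean_square (\<lambda>x. f x - (\<Sum>k\<in>S. c k * e k x)) < \<epsilon>}"

lemma mean_square_span_closed:
  assumes e: "\<And>k. k \<in> K \<Longrightarrow> e k \<in> sphere_L2"
  shows "closed_subspace (mean_square_span K e)"
proof -
  let ?V = "mean_square_span K e"
  have comb: "(\<lambda>x. \<Sum>k\<in>S. c k * e k x) \<in> sphere_L2" if "S \<subseteq> K" for S c
    by (rule sphere_L2_sum, rule sphere_L2_scale, rule e) (use that in auto)
  have add: "(\<lambda>x. f x + g x) \<in> ?V" if f: "f \<in> ?V" and g: "g \<in> ?V" for f g
    unfolding mean_square_span_def
  proof (intro CollectI conjI allI impI)
    show "(\<lambda>x. f x + g x) \<in> sphere_L2"
      using f g by (simp add: mean_square_span_def sphere_L2_add)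
    fix \<epsilon> :: real assume "\<epsilon> > 0"
    then have \<epsilon>: "\<epsilon> / 4 > 0" by simp
    obtain S c where S: "finite S" "S \<subseteq> K" "mean_square (\<lambda>x. f x - (\<Sum>k\<in>S. c k * e k x)) < \<epsilon> / 4"
      using f \<epsilon> unfolding mean_square_span_def by blast
    obtain T d where T: "finite T" "T \<subseteq> K" "mean_square (\<lambda>x. g x - (\<Sum>k\<in>T. d k * e k x)) < \<epsilon> / 4"
      using g \<epsilon> unfolding mean_square_span_def by blast
    let ?c = "\<lambda>k. (if k \<in> S then c k else 0) + (if k \<in> T then d k else 0)"
    have "(\<Sum>k\<in>S \<union> T. ?c k * e k x) = (\<Sum>k\<in>S. c k * e k x) + (\<Sum>k\<in>T. d k * e k x)" for x
    proof -
      have "(\<Sum>k\<in>S \<union> T. ?c k * e k x) = (\<Sum>k\<in>S \<union> T. if k \<in> S then c k * e k x else 0)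
          + (\<Sum>k\<in>S \<union> T. if k \<in> T then d k * e k x else 0)"
        unfolding sum.distrib[symmetric] by (rule sum.cong) (auto simp: algebra_simps)
      also have "(\<Sum>k\<in>S \<union> T. if k \<in> S then c k * e k x else 0) = (\<Sum>k\<in>S. c k * e k x)"
        using S(1) T(1) by (intro sum.mono_neutral_cong_right) auto
      also have "(\<Sum>k\<in>S \<union> T. if k \<in> T then d k * e k x else 0) = (\<Sum>k\<in>T. d k * e k x)"
        using S(1) T(1) by (intro sum.mono_neutral_cong_right) auto
      finally show ?thesis .
    qed
    then have "mean_square (\<lambda>x. f x + g x - (\<Sum>k\<in>S \<union> T. ?c k * e k x))
        = mean_square (\<lambda>x. (f x - (\<Sum>k\<in>S. c k * e k x)) + (g x - (\<Sum>k\<in>T. d k * e k x)))"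
      by (simp add: algebra_simps)
    also have "\<dots> \<le> 2 * mean_square (\<lambda>x. f x - (\<Sum>k\<in>S. c k * e k x))
        + 2 * mean_square (\<lambda>x. g x - (\<Sum>k\<in>T. d k * e k x))"
      by (rule mean_square_add; rule sphere_L2_diff)
         (use f g comb S T in \<open>auto simp: mean_square_span_def\<close>)
    also have "\<dots> < \<epsilon>" using S(3) T(3) by simp
    finally show "\<exists>S c. finite S \<and> S \<subseteq> K \<and> mean_square (\<lambda>x. f x + g x - (\<Sum>k\<in>S. c k * e k x)) < \<epsilon>"
      using S(1,2) T(1,2) by (intro exI[of _ "S \<union> T"] exI[of _ ?c]) auto
  qed
  have scale: "(\<lambda>x. a * f x) \<in> ?V" if f: "f \<in> ?V" for f a
    unfolding mean_square_span_def
  proof (intro CollectI conjI allI impI)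
    show "(\<lambda>x. a * f x) \<in> sphere_L2"
      using f by (simp add: mean_square_span_def sphere_L2_scale)
    fix \<epsilon> :: real assume "\<epsilon> > 0"
    moreover have a1: "(cmod a)\<^sup>2 + 1 > 0" by (simp add: add_nonneg_pos)
    ultimately have \<epsilon>: "\<epsilon> / ((cmod a)\<^sup>2 + 1) > 0" by simp
    obtain S c where S: "finite S" "S \<subseteq> K"
      "mean_square (\<lambda>x. f x - (\<Sum>k\<in>S. c k * e k x)) < \<epsilon> / ((cmod a)\<^sup>2 + 1)"
      using f \<epsilon> unfolding mean_square_span_def by blast
    have "mean_square (\<lambda>x. a * f x - (\<Sum>k\<in>S. (a * c k) * e k x))
        = mean_square (\<lambda>x. a * (f x - (\<Sum>k\<in>S. c k * e k x)))"
      by (simp add: algebra_simps sum_distrib_left)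
    also have "\<dots> = (cmod a)\<^sup>2 * mean_square (\<lambda>x. f x - (\<Sum>k\<in>S. c k * e k x))"
      by (rule mean_square_scale)
    also have "\<dots> \<le> ((cmod a)\<^sup>2 + 1) * mean_square (\<lambda>x. f x - (\<Sum>k\<in>S. c k * e k x))"
      by (intro mult_right_mono mean_square_nonneg) simp
    also have "\<dots> < \<epsilon>"
      using mult_strict_left_mono[OF S(3) a1] a1 by simp
    finally show "\<exists>S c. finite S \<and> S \<subseteq> K \<and> mean_square (\<lambda>x. a * f x - (\<Sum>k\<in>S. c k * e k x)) < \<epsilon>"
      using S(1,2) by (intro exI[of _ S] exI[of _ "\<lambda>k. a * c k"] conjI)
  qed
  have lim: "f \<in> ?V" if f: "f \<in> sphere_L2" and lim: "\<forall>\<epsilon>>0. \<exists>g\<in>?V. mean_square (\<lambda>x. f x - g x) < \<epsilon>" for f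
    unfolding mean_square_span_def
  proof (intro CollectI conjI allI impI f)
    fix \<epsilon> :: real assume "\<epsilon> > 0"
    then have \<epsilon>: "\<epsilon> / 4 > 0" by simp
    obtain g where g: "g \<in> ?V" "mean_square (\<lambda>x. f x - g x) < \<epsilon> / 4" using lim \<epsilon> by blast
    obtain S c where S: "finite S" "S \<subseteq> K" "mean_square (\<lambda>x. g x - (\<Sum>k\<in>S. c k * e k x)) < \<epsilon> / 4"
      using g(1) \<epsilon> unfolding mean_square_span_def by blast
    have "mean_square (\<lambda>x. f x - (\<Sum>k\<in>S. c k * e k x)) \<le> 2 * mean_square (\<lambda>x. f x - g x)
        + 2 * mean_square (\<lambda>x. g x - (\<Sum>k\<in>S. c k * e k x))"
      by (rule mean_square_triangle) (use f g(1) comb S(2) in \<open>auto simp: mean_square_span_def\<close>)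
    also have "\<dots> < \<epsilon>" using g(2) S(3) by simp
    finally show "\<exists>S c. finite S \<and> S \<subseteq> K \<and> mean_square (\<lambda>x. f x - (\<Sum>k\<in>S. c k * e k x)) < \<epsilon>"
      using S(1,2) by blast
  qed
  show ?thesis
    unfolding closed_subspace_def using add scale lim by (auto simp: mean_square_span_def)
qed

lemma mean_square_span_base:
  assumes "k \<in> K" "e k \<in> sphere_L2"
  shows "e k \<in> mean_square_span K e"
  unfolding mean_square_span_def
proof (intro CollectI conjI allI impI assms)
  fix \<epsilon> :: real assume "\<epsilon> > 0"
  then show "\<exists>S c. finite S \<and> S \<subseteq> K \<and> mean_square (\<lambda>x. e k x - (\<Sum>k\<in>S. c k * e k x)) < \<epsilon>"
    using assms by (intro exI[of _ "{k}"] exI[of _ "\<lambda>_. 1"]) (simp add: mean_square_def)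
qed

section \<open>Density of the polynomials\<close>

lemma closed_subspaceD:
  assumes "closed_subspace V"
  shows "V \<subseteq> sphere_L2"
    and "\<And>f g. f \<in> V \<Longrightarrow> g \<in> V \<Longrightarrow> (\<lambda>x. f x + g x) \<in> V"
    and "\<And>f c. f \<in> V \<Longrightarrow> (\<lambda>x. c * f x) \<in> V"
    and "\<And>f. f \<in> sphere_L2 \<Longrightarrow> (\<And>\<epsilon>. \<epsilon> > 0 \<Longrightarrow> \<exists>g\<in>V. mean_square (\<lambda>x. f x - g x) < \<epsilon>) \<Longrightarrow> f \<in> V"
  using assms by (auto simp: closed_subspace_def)

lemma closed_subspace_cong:
  assumes V: "closed_subspace V" and f: "f \<in> sphere_L2" and g: "g \<in> V" and eq: "mean_square (\<lambda>x. f x - g x) = 0"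
  shows "f \<in> V"
  by (rule closed_subspaceD(4)[OF V f], rule bexI[OF _ g]) (simp add: eq)

lemma closed_subspace_sum:
  assumes V: "closed_subspace V" and z: "(\<lambda>x. 0) \<in> V"
  shows "finite I \<Longrightarrow> (\<And>i. i \<in> I \<Longrightarrow> f i \<in> V) \<Longrightarrow> (\<lambda>x. \<Sum>i\<in>I. c i * f i x) \<in> V"
proof (induction I rule: finite_induct)
  case (insert i I)
  then show ?case
    using closed_subspaceD(2)[OF V closed_subspaceD(3)[OF V, of "f i" "c i"], of "\<lambda>x. \<Sum>i\<in>I. c i * f i x"] by simp
qed (simp add: z)

lemma closed_subspace_dominated_limit:
  assumes V: "closed_subspace V" and f: "f \<in> sphere_L2" and s: "\<And>n. s n \<in> V"
    and lim: "\<And>x. norm x = 1 \<Longrightarrow> (\<lambda>n. s n x) \<longlonglongrightarrow> f x"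
    and w: "integrable sphere_measure (\<lambda>x. (w x)\<^sup>2)"
    and bound: "\<And>n x. norm x = 1 \<Longrightarrow> cmod (s n x) \<le> w x"
  shows "f \<in> V"
proof (rule closed_subspaceD(4)[OF V f])
  fix \<epsilon> :: real assume \<epsilon>: "\<epsilon> > 0"
  have sL: "s n \<in> sphere_L2" for n using s closed_subspaceD(1)[OF V] by blast
  have "(\<lambda>n. LINT x|sphere_measure. (cmod (f x - s n x))\<^sup>2) \<longlonglongrightarrow> (LINT x|sphere_measure. 0)"
  proof (rule integral_dominated_convergence[where w = "\<lambda>x. 4 * (w x)\<^sup>2"])
    show "(\<lambda>x. (cmod (f x - s n x))\<^sup>2) \<in> borel_measurable sphere_measure" for n
      using sphere_L2D(2)[OF sphere_L2_diff[OF f sL]] by (rule borel_measurable_integrable)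
    show "integrable sphere_measure (\<lambda>x. 4 * (w x)\<^sup>2)" using w by simp
    show "AE x in sphere_measure. (\<lambda>n. (cmod (f x - s n x))\<^sup>2) \<longlonglongrightarrow> 0"
    proof (rule AE_I2)
      fix x assume "x \<in> space sphere_measure"
      then have "(\<lambda>n. s n x) \<longlonglongrightarrow> f x" using lim by (simp add: space_sphere_measure)
      then have "(\<lambda>n. (cmod (f x - s n x))\<^sup>2) \<longlonglongrightarrow> (cmod (f x - f x))\<^sup>2"
        by (intro tendsto_intros)
      then show "(\<lambda>n. (cmod (f x - s n x))\<^sup>2) \<longlonglongrightarrow> 0" by simp
    qed
    show "AE x in sphere_measure. norm ((cmod (f x - s n x))\<^sup>2) \<le> 4 * (w x)\<^sup>2" for n
    proof (rule AE_I2)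
      fix x assume "x \<in> space sphere_measure"
      then have x: "norm x = 1" by (simp add: space_sphere_measure)
      have "cmod (f x) \<le> w x"
        by (rule LIMSEQ_le_const2[OF tendsto_norm[OF lim[OF x]]]) (use bound[OF x] in auto)
      then have "cmod (f x - s n x) \<le> 2 * w x"
        using norm_triangle_ineq4[of "f x" "s n x"] bound[OF x, of n] by linarith
      then have "(cmod (f x - s n x))\<^sup>2 \<le> (2 * w x)\<^sup>2"
        by (intro power_mono) auto
      then show "norm ((cmod (f x - s n x))\<^sup>2) \<le> 4 * (w x)\<^sup>2"
        by (simp add: power_mult_distrib)
    qed
  qed simp
  then have "(\<lambda>n. mean_square (\<lambda>x. f x - s n x)) \<longlonglongrightarrow> 0"
    by (simp add: mean_square_def)
  then have "\<forall>\<^sub>F n in sequentially. mean_square (\<lambda>x. f x - s n x) < \<epsilon>"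
    using \<epsilon> by (rule order_tendstoD(2))
  then show "\<exists>g\<in>V. mean_square (\<lambda>x. f x - g x) < \<epsilon>"
    using s unfolding eventually_sequentially by blast
qed

definition monomial :: "nat \<times> nat \<times> nat \<Rightarrow> real^3 \<Rightarrow> real" where
  "monomial = (\<lambda>(a, b, c) x. (x $ 1) ^ a * (x $ 2) ^ b * (x $ 3) ^ c)"

lemma continuous_on_monomial [continuous_intros]: "continuous_on S (monomial m)"
  by (cases m) (auto simp: monomial_def intro!: continuous_intros)

lemma monomial_times_coordinate:
  "\<exists>m'. \<forall>x. monomial m x * x $ i = monomial m' x"
proof -
  obtain a b c where m: "m = (a, b, c)" by (cases m)
  consider "i = 1" | "i = 2" | "i = 3" using exhaust_3 by blast
  then show ?thesis
  proof cases
    case 1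
    then show ?thesis by (intro exI[of _ "(Suc a, b, c)"]) (simp add: m monomial_def)
  next
    case 2
    then show ?thesis by (intro exI[of _ "(a, Suc b, c)"]) (simp add: m monomial_def)
  next
    case 3
    then show ?thesis by (intro exI[of _ "(a, b, Suc c)"]) (simp add: m monomial_def)
  qed
qed

context
  fixes V :: "(real^3 \<Rightarrow> complex) set"
  assumes V: "closed_subspace V" and mono: "\<And>m. (\<lambda>x. of_real (monomial m x)) \<in> V"
begin

lemma closed_subspace_zero: "(\<lambda>x. 0) \<in> V"
  using closed_subspaceD(3)[OF V mono, of 0 undefined] by simp

text \<open>The factor \<open>g\<close> lets the induction pass through products: for \<open>f h\<close>, the claim for \<open>f\<close> is the
  premise of the claim for \<open>h\<close>.\<close>

lemma polynomial_in_closed_subspace_aux: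
  assumes p: "real_polynomial_function (p :: real^3 \<Rightarrow> real)"
    and g: "\<And>m. (\<lambda>x. of_real (g x * monomial m x)) \<in> V"
  shows "(\<lambda>x. of_real (g x * p x * monomial m x)) \<in> V"
  using p g
proof (induction p arbitrary: g m rule: real_polynomial_function.induct)
  case (linear f)
  have fx: "f x = (\<Sum>i\<in>UNIV. f (axis i 1) * x $ i)" for x
  proof -
    have "f x = f (\<Sum>i\<in>UNIV. (x $ i) *\<^sub>R axis i 1)"
      by (simp add: basis_expansion flip: scalar_mult_eq_scaleR)
    also have "\<dots> = (\<Sum>i\<in>UNIV. f (axis i 1) * x $ i)"
      using bounded_linear.linear[OF linear(1)]
      by (simp add: linear_sum linear_scale mult.commute)
    finally show ?thesis .
  qed
  have eq: "(\<lambda>x. complex_of_real (g x * f x * monomial m x))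
      = (\<lambda>x. \<Sum>i\<in>UNIV. of_real (f (axis i 1)) * of_real (g x * (monomial m x * x $ i)))"
    by (rule ext, subst fx) (simp add: sum_distrib_left sum_distrib_right mult_ac)
  show ?case
    unfolding eq
  proof (rule closed_subspace_sum[OF V closed_subspace_zero finite])
    fix i :: 3
    obtain m' where "\<forall>x. monomial m x * x $ i = monomial m' x"
      using monomial_times_coordinate by blast
    then show "(\<lambda>x. of_real (g x * (monomial m x * x $ i))) \<in> V"
      using linear(2)[of m'] by simp
  qed
next
  case (const c)
  show ?case
    using closed_subspaceD(3)[OF V const[of m], of "of_real c"] by (simp add: mult_ac)
next
  case (add f h)
  show ?case
    using closed_subspaceD(2)[OF V add.IH(1)[OF add.prems] add.IH(2)[OF add.prems], of m m]
    by (simp add: algebra_simps)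
next
  case (mult f h)
  show ?case
    using mult.IH(2)[of "\<lambda>x. g x * f x" m] mult.IH(1)[OF mult.prems]
    by (simp add: mult.assoc)
qed

lemma polynomial_in_closed_subspace:
  assumes "real_polynomial_function (p :: real^3 \<Rightarrow> real)"
  shows "(\<lambda>x. of_real (p x)) \<in> V"
  using polynomial_in_closed_subspace_aux[OF assms, of "\<lambda>_. 1" "(0, 0, 0)"] mono
  by (simp add: monomial_def)

text \<open>The Weierstrass approximation theorem, as uniform approximation on the sphere implies approximation in
  the mean.\<close>

lemma continuous_in_closed_subspace:
  assumes f: "continuous_on UNIV (f :: real^3 \<Rightarrow> real)"
  shows "(\<lambda>x. of_real (f x)) \<in> V"
proof (rule closed_subspaceD(4)[OF V])
  show "(\<lambda>x. complex_of_real (f x)) \<in> sphere_L2"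
    by (intro sphere_L2_continuous continuous_intros f)
  fix \<epsilon> :: real assume \<epsilon>: "\<epsilon> > 0"
  define D where "D = measure sphere_measure (space sphere_measure)"
  have D: "D \<ge> 0" by (simp add: D_def)
  define \<delta> where "\<delta> = sqrt (\<epsilon> / (D + 1))"
  have \<delta>: "\<delta> > 0" "\<delta>\<^sup>2 = \<epsilon> / (D + 1)" using \<epsilon> D by (auto simp: \<delta>_def)
  obtain p where p: "real_polynomial_function p" "\<And>x. x \<in> sphere 0 1 \<Longrightarrow> \<bar>f x - p x\<bar> < \<delta>"
    using Stone_Weierstrass_real_polynomial_function[OF compact_sphere continuous_on_subset[OF f subset_UNIV] \<delta>(1)]
    by blast
  have pc: "continuous_on UNIV p"
    using p(1) by (simp add: real_polynomial_function_eq continuous_on_polymonial_function)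
  have "mean_square (\<lambda>x. of_real (f x) - of_real (p x)) \<le> (LINT x|sphere_measure. \<delta>\<^sup>2)"
    unfolding mean_square_def
  proof (rule integral_mono)
    show "integrable sphere_measure (\<lambda>x. (cmod (complex_of_real (f x) - complex_of_real (p x)))\<^sup>2)"
      by (intro integrable_continuous_sphere_measure continuous_intros f pc)
    fix x :: "real^3" assume "x \<in> space sphere_measure"
    then have "\<bar>f x - p x\<bar> \<le> \<delta>" using p(2)[of x] by (simp add: space_sphere_measure)
    then have "\<bar>f x - p x\<bar>\<^sup>2 \<le> \<delta>\<^sup>2" by (intro power_mono) auto
    then show "(cmod (complex_of_real (f x) - complex_of_real (p x)))\<^sup>2 \<le> \<delta>\<^sup>2"
      by (simp flip: of_real_diff)
  qed simp
  also have "\<dots> = D * (\<epsilon> / (D + 1))" by (simp add: D_def \<delta>(2))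
  also have "\<dots> < \<epsilon>" using \<epsilon> D by (simp add: field_simps)
  finally show "\<exists>g\<in>V. mean_square (\<lambda>x. complex_of_real (f x) - g x) < \<epsilon>"
    by (rule bexI[OF _ polynomial_in_closed_subspace[OF p(1)]])
qed

lemma indicator_sphere_L2:
  assumes "A \<in> sets borel"
  shows "(\<lambda>x. of_real (indicator A x)) \<in> sphere_L2"
proof -
  have m: "(\<lambda>x. complex_of_real (indicator A x)) \<in> borel_measurable sphere_measure"
    using assms by (intro borel_measurable_sphere_measure borel_measurable_of_real borel_measurable_indicator) simp
  moreover have "integrable sphere_measure (\<lambda>x. (cmod (complex_of_real (indicator A x)))\<^sup>2)"
  proof (rule sphere.integrable_const_bound[where B = 1])
    show "(\<lambda>x. (cmod (complex_of_real (indicator A x)))\<^sup>2) \<in> borel_measurable sphere_measure"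
      by (intro borel_measurable_power measurable_compose[OF m borel_measurable_norm])
  qed (auto simp: indicator_def)
  ultimately show ?thesis by (simp add: sphere_L2_def)
qed

text \<open>The functions \<open>max 0 (1 - n dist(x, C))\<close> decrease to the indicator.\<close>

lemma closed_indicator_in_closed_subspace:
  assumes C: "closed (C :: (real^3) set)"
  shows "(\<lambda>x. of_real (indicator C x)) \<in> V"
proof (cases "C = {}")
  case True
  then show ?thesis using closed_subspace_zero by simp
next
  case False
  define s where "s n x = max 0 (1 - real n * infdist x C)" for n x
  show ?thesis
  proof (rule closed_subspace_dominated_limit[OF V, where s = "\<lambda>n x. of_real (s n x)" and w = "\<lambda>_. 1"])
    show "(\<lambda>x. complex_of_real (indicator C x)) \<in> sphere_L2"
      using C by (intro indicator_sphere_L2) simp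
    show "(\<lambda>x. complex_of_real (s n x)) \<in> V" for n
      unfolding s_def by (intro continuous_in_closed_subspace continuous_intros)
    show "cmod (complex_of_real (s n x)) \<le> 1" for n x
      using infdist_nonneg[of x C] by (simp add: s_def)
    show "(\<lambda>n. complex_of_real (s n x)) \<longlonglongrightarrow> complex_of_real (indicator C x)" for x
    proof (cases "x \<in> C")
      case True
      then show ?thesis by (simp add: s_def)
    next
      case x: False
      then have pos: "infdist x C > 0"
        using infdist_pos_not_in_closed[OF C False x] by simp
      obtain N :: nat where N: "1 / infdist x C < real N" using reals_Archimedean2 by blast
      have "s n x = 0" if "n \<ge> N" for n
      proof -
        have "1 < real N * infdist x C" using N pos by (simp add: field_simps)
        also have "\<dots> \<le> real n * infdist x C" using that pos by (intro mult_right_mono) auto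
        finally show ?thesis by (simp add: s_def)
      qed
      then have "\<forall>\<^sub>F n in sequentially. complex_of_real (s n x) = complex_of_real (indicator C x)"
        using x unfolding eventually_sequentially by (intro exI[of _ N]) auto
      then show ?thesis by (rule tendsto_eventually)
    qed
  qed simp
qed

text \<open>The sets in question form a Dynkin system that contains the closed sets.\<close>

lemma borel_indicator_in_closed_subspace:
  assumes A: "A \<in> sets (borel :: (real^3) measure)"
  shows "(\<lambda>x. of_real (indicator A x)) \<in> V"
proof -
  have eq: "sets (borel :: (real^3) measure) = sigma_sets UNIV (Collect closed)"
    by (subst borel_eq_closed) (simp add: sets_measure_of)
  have st: "Int_stable (Collect closed :: (real^3) set set)"
    by (auto simp: Int_stable_def)
  show ?thesis
  proof (rule sigma_sets_induct_disjoint[OF st, of UNIV A])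
    show "A \<in> sigma_sets UNIV (Collect closed)" using A by (simp add: eq)
    show "(\<lambda>x. of_real (indicator A x)) \<in> V" if "A \<in> Collect closed" for A
      using that closed_indicator_in_closed_subspace by simp
    show "(\<lambda>x. of_real (indicator {} x)) \<in> V"
      using closed_subspace_zero by simp
    show "(\<lambda>x. of_real (indicator (UNIV - A) x)) \<in> V"
      if "(\<lambda>x. of_real (indicator A x)) \<in> V" for A
    proof -
      have "(\<lambda>x. of_real 1 + (-1) * complex_of_real (indicator A x)) \<in> V"
        by (rule closed_subspaceD(2)[OF V continuous_in_closed_subspace closed_subspaceD(3)[OF V that]]) simp
      moreover have "of_real 1 + (-1) * complex_of_real (indicator A x) = of_real (indicator (UNIV - A) x)" for x
        by (auto simp: indicator_def)
      ultimately show ?thesis by simp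
    qed
    show "(\<lambda>x. of_real (indicator (\<Union>i. A i) x)) \<in> V"
      if d: "disjoint_family A" and ms: "range A \<subseteq> sigma_sets UNIV (Collect closed)"
        and AV: "\<And>i. (\<lambda>x. of_real (indicator (A i) x)) \<in> V" for A :: "nat \<Rightarrow> (real^3) set"
    proof (rule closed_subspace_dominated_limit[OF V, where w = "\<lambda>_. 1"
          and s = "\<lambda>n x. \<Sum>i<n. 1 * complex_of_real (indicator (A i) x)"])
      have "(\<Union>i. A i) \<in> sets borel" using ms unfolding eq[symmetric] by blast
      then show "(\<lambda>x. complex_of_real (indicator (\<Union>i. A i) x)) \<in> sphere_L2"
        by (rule indicator_sphere_L2)
      show "(\<lambda>x. \<Sum>i<n. 1 * complex_of_real (indicator (A i) x)) \<in> V" for n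
        by (rule closed_subspace_sum[OF V closed_subspace_zero]) (simp_all add: AV)
      have partial: "(\<Sum>i<n. 1 * complex_of_real (indicator (A i) x)) = of_real (indicator (\<Union>i<n. A i) x)" for n x
      proof -
        have "disjoint_family_on A {..<n}"
          by (rule disjoint_family_on_mono[OF _ d]) simp
        then have "(\<Sum>i<n. indicator (A i) x) = (indicator (\<Union>i<n. A i) x :: real)"
          by (simp add: indicator_UN_disjoint)
        then show ?thesis by (simp flip: of_real_sum)
      qed
      show "cmod (\<Sum>i<n. 1 * complex_of_real (indicator (A i) x)) \<le> 1" for n x
        unfolding partial by (simp add: indicator_def)
      show "(\<lambda>n. \<Sum>i<n. 1 * complex_of_real (indicator (A i) x)) \<longlonglongrightarrow> complex_of_real (indicator (\<Union>i. A i) x)" for x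
        unfolding partial by (intro tendsto_of_real LIMSEQ_indicator_UN)
    qed simp
  qed auto
qed

text \<open>A square integrable function is a dominated limit of simple functions.\<close>

theorem closed_subspace_eq_L2: "V = sphere_L2"
proof
  show "V \<subseteq> sphere_L2" by (rule closed_subspaceD(1)[OF V])
  show "sphere_L2 \<subseteq> V"
  proof
    fix f assume f: "f \<in> sphere_L2"
    obtain s where s: "\<And>i. simple_function sphere_measure (s i)"
      "\<And>x. x \<in> space sphere_measure \<Longrightarrow> (\<lambda>i. s i x) \<longlonglongrightarrow> f x"
      "\<And>i x. x \<in> space sphere_measure \<Longrightarrow> dist (s i x) 0 \<le> 2 * dist (f x) 0"
      using borel_measurable_implies_sequence_metric[OF sphere_L2D(1)[OF f], of 0] by blast
    define t where "t i x = (\<Sum>y\<in>s i ` space sphere_measure. y * of_real (indicator (s i -` {y} \<inter> space sphere_measure) x))" for i x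
    have ts: "t i x = s i x" if "norm x = 1" for i x
    proof -
      have x: "x \<in> space sphere_measure" using that by (simp add: space_sphere_measure)
      have "t i x = (\<Sum>y\<in>s i ` space sphere_measure. indicator (s i -` {y} \<inter> space sphere_measure) x *\<^sub>R y)"
        unfolding t_def by (intro sum.cong refl) (simp only: scaleR_conv_of_real mult.commute)
      also have "\<dots> = s i x"
        by (rule simple_function_indicator_representation_banach[OF s(1) x, symmetric])
      finally show ?thesis .
    qed
    show "f \<in> V"
    proof (rule closed_subspace_dominated_limit[OF V f, where s = t and w = "\<lambda>x. 2 * cmod (f x)"])
      show "t i \<in> V" for i
        unfolding t_def
      proof (rule closed_subspace_sum[OF V closed_subspace_zero])
        show "finite (s i ` space sphere_measure)" by (rule simple_functionD(1)[OF s(1)])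
        fix y
        show "(\<lambda>x. of_real (indicator (s i -` {y} \<inter> space sphere_measure) x)) \<in> V"
          using simple_functionD(2)[OF s(1), of i "{y}"]
          by (intro borel_indicator_in_closed_subspace) (simp add: sets_sphere_measure_iff)
      qed
      show "(\<lambda>n. t n x) \<longlonglongrightarrow> f x" if "norm x = 1" for x
        using s(2)[of x] that by (simp add: ts space_sphere_measure)
      show "integrable sphere_measure (\<lambda>x. (2 * cmod (f x))\<^sup>2)"
        using sphere_L2D(2)[OF f] by (simp add: power_mult_distrib)
      show "cmod (t n x) \<le> 2 * cmod (f x)" if "norm x = 1" for n x
        using s(3)[of x n] that by (simp add: ts space_sphere_measure)
    qed
  qed
qed

end


section \<open>Rotation groups of the platonic solids\<close>

text \<open>Points of a sphere are extreme points of every convex set in the ball that contains them.\<close>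

lemma vertex_of_convex_hull_sphere:
  fixes V :: "'a::euclidean_space set"
  assumes V: "\<And>v. v \<in> V \<Longrightarrow> norm v = R" and x: "x \<in> convex hull V" "norm x = R"
  shows "x \<in> V"
proof -
  have sub: "convex hull V \<subseteq> cball 0 R"
    by (rule hull_minimal) (use V in auto)
  have "x extreme_point_of (convex hull V)"
    unfolding extreme_point_of_def
  proof (intro conjI ballI notI x)
    fix a b assume ab: "a \<in> convex hull V" "b \<in> convex hull V" "x \<in> open_segment a b"
    then have "dist 0 x < dist 0 a \<or> dist 0 x < dist 0 b"
      by (intro dist_decreases_open_segment) auto
    moreover have "norm a \<le> R" "norm b \<le> R" using ab sub by auto
    ultimately show False using x(2) by auto
  qed
  then show ?thesis by (rule extreme_point_of_convex_hull)
qed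

lemma rotation_matrix_norm:
  fixes A :: "real^3^3"
  assumes "rotation_matrix A"
  shows "norm (A *v x) = norm x"
proof -
  have "orthogonal_transformation ((*v) A)"
    using assms by (simp add: rotation_matrix_def orthogonal_transformation_matrix matrix_vector_mul_linear)
  then show ?thesis by (simp add: orthogonal_transformation_norm)
qed

lemma rotational_symmetry_vertices:
  assumes V: "\<And>v. v \<in> V \<Longrightarrow> norm v = R" and A: "A \<in> rotational_symmetries (convex hull V)" and v: "v \<in> V"
  shows "A *v v \<in> V"
proof (rule vertex_of_convex_hull_sphere[OF V])
  have "v \<in> convex hull V" using v by (rule hull_inc)
  then show "A *v v \<in> convex hull V"
    using A unfolding rotational_symmetries_def by blast
  show "norm (A *v v) = R"
    using A V[OF v] by (simp add: rotational_symmetries_def rotation_matrix_norm)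
qed simp

lemma rotational_symmetryI:
  assumes V: "finite V" "\<And>v. v \<in> V \<Longrightarrow> A *v v \<in> V" and A: "rotation_matrix A"
  shows "A \<in> rotational_symmetries (convex hull V)"
proof -
  have "inj ((*v) A)"
    using rotation_matrix_norm[OF A] by (intro inj_onI) (metis eq_iff_diff_eq_0 matrix_vector_mult_diff_distrib norm_eq_zero)
  then have "(\<lambda>x. A *v x) ` V = V"
    by (intro endo_inj_surj V(1)) (use V(2) in \<open>auto intro: inj_on_subset\<close>)
  moreover have "(\<lambda>x. A *v x) ` (convex hull V) = convex hull ((\<lambda>x. A *v x) ` V)"
    by (rule convex_hull_linear_image) (rule matrix_vector_mul_linear)
  ultimately show ?thesis using A by (simp add: rotational_symmetries_def)
qed

subsection \<open>Matrices of order three\<close>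

definition mat3 :: "real \<Rightarrow> real \<Rightarrow> real \<Rightarrow> real \<Rightarrow> real \<Rightarrow> real \<Rightarrow> real \<Rightarrow> real \<Rightarrow> real \<Rightarrow> real^3^3" where
  "mat3 a b c d e f g h i = vector [vector [a, b, c], vector [d, e, f], vector [g, h, i]]"

lemma mat3_nth [simp]:
  "mat3 a b c d e f g h i $ 1 $ 1 = a" "mat3 a b c d e f g h i $ 1 $ 2 = b" "mat3 a b c d e f g h i $ 1 $ 3 = c"
  "mat3 a b c d e f g h i $ 2 $ 1 = d" "mat3 a b c d e f g h i $ 2 $ 2 = e" "mat3 a b c d e f g h i $ 2 $ 3 = f"
  "mat3 a b c d e f g h i $ 3 $ 1 = g" "mat3 a b c d e f g h i $ 3 $ 2 = h" "mat3 a b c d e f g h i $ 3 $ 3 = i"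
  by (simp_all add: mat3_def)

lemma mat3_eq: "(A::real^3^3) = mat3 (A $ 1 $ 1) (A $ 1 $ 2) (A $ 1 $ 3) (A $ 2 $ 1) (A $ 2 $ 2) (A $ 2 $ 3) (A $ 3 $ 1) (A $ 3 $ 2) (A $ 3 $ 3)"
  by (simp add: vec_eq_iff forall_3)

lemma mat3_eq_iff: "mat3 a b c d e f g h i = mat3 a' b' c' d' e' f' g' h' i' \<longleftrightarrow>
   a = a' \<and> b = b' \<and> c = c' \<and> d = d' \<and> e = e' \<and> f = f' \<and> g = g' \<and> h = h' \<and> i = i'"
  by (auto simp: vec_eq_iff forall_3)

lemma mat3_mult: "mat3 a b c d e f g h i ** mat3 a' b' c' d' e' f' g' h' i' =
  mat3 (a * a' + b * d' + c * g') (a * b' + b * e' + c * h') (a * c' + b * f' + c * i')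
       (d * a' + e * d' + f * g') (d * b' + e * e' + f * h') (d * c' + e * f' + f * i')
       (g * a' + h * d' + i * g') (g * b' + h * e' + i * h') (g * c' + h * f' + i * i')"
  by (simp add: vec_eq_iff forall_3 matrix_matrix_mult_def sum_3)

lemma mat3_one: "mat 1 = mat3 1 0 0 0 1 0 0 0 1"
  by (simp add: vec_eq_iff forall_3 mat_def)

lemma mat3_transpose: "transpose (mat3 a b c d e f g h i) = mat3 a d g b e h c f i"
  by (simp add: vec_eq_iff forall_3 transpose_def)

lemma mat3_det: "det (mat3 a b c d e f g h i) = a * e * i + b * f * g + c * d * h - a * f * h - b * d * i - c * e * g"
  by (simp add: det_3)

lemma mat3_mult_vector: "mat3 a b c d e f g h i *v vector [x, y, z] =
  vector [a * x + b * y + c * z, d * x + e * y + f * z, g * x + h * y + i * z]"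
  by (simp add: vec_eq_iff forall_3 matrix_vector_mult_def sum_3)

lemma vector3_eq_iff: "(vector [a, b, c] :: real^3) = vector [a', b', c'] \<longleftrightarrow> a = a' \<and> b = b' \<and> c = c'"
  by (auto simp: vec_eq_iff forall_3)

lemma rotation_mat3_iff: "rotation_matrix (mat3 a b c d e f g h i) \<longleftrightarrow>
    a * a + d * d + g * g = 1 \<and> b * b + e * e + h * h = 1 \<and> c * c + f * f + i * i = 1 \<and>
    a * b + d * e + g * h = 0 \<and> a * c + d * f + g * i = 0 \<and> b * c + e * f + h * i = 0 \<and>
    a * e * i + b * f * g + c * d * h - a * f * h - b * d * i - c * e * g = 1"
  by (auto simp: rotation_matrix_def orthogonal_matrix mat3_one mat3_transpose mat3_mult mat3_eq_iff mat3_det algebra_simps)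

definition diag3 :: "real \<Rightarrow> real \<Rightarrow> real \<Rightarrow> real^3^3" where
  "diag3 a b c = mat3 a 0 0 0 b 0 0 0 c"

definition cyc3 :: "real^3^3" where
  "cyc3 = mat3 0 0 1 1 0 0 0 1 0"

definition four_group :: "(real^3^3) set" where
  "four_group = {mat 1, diag3 1 (-1) (-1), diag3 (-1) 1 (-1), diag3 (-1) (-1) 1}"

lemma sign_diag_in_four_group:
  assumes "a = 1 \<or> a = -1" "b = 1 \<or> b = -1" "c = 1 \<or> c = -1" "a * b * c = 1"
  shows "diag3 a b c \<in> four_group"
  using assms by (auto simp: four_group_def diag3_def mat3_one mat3_eq_iff)

text \<open>Choosing signs \<open>t_i\<close> with \<open>t_i a_ij = t_j a_ji\<close> makes the matrix symmetric, hence an involution as it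
  is orthogonal. The three conditions are consistent if an off-diagonal pair vanishes; if none does,
  comparing the inner product of the first two columns with that of the first two rows shows that they
  are.\<close>

lemma four_group_symmetrize:
  assumes rot: "rotation_matrix A"
    and sym: "\<bar>A $ 1 $ 2\<bar> = \<bar>A $ 2 $ 1\<bar>" "\<bar>A $ 1 $ 3\<bar> = \<bar>A $ 3 $ 1\<bar>" "\<bar>A $ 2 $ 3\<bar> = \<bar>A $ 3 $ 2\<bar>"
  obtains d where "d \<in> four_group" "(d ** A) ** (d ** A) = mat 1"
proof -
  obtain a b c d e f g h i where A: "A = mat3 a b c d e f g h i" using mat3_eq by blast
  have sg: "\<exists>s. (s = 1 \<or> s = -1) \<and> y = s * x" if "\<bar>x\<bar> = \<bar>y\<bar>" for x y :: real
    using that by (cases "x = y") (auto simp: abs_eq_iff)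
  obtain s12 where s12: "s12 = 1 \<or> s12 = -1" "d = s12 * b" using sg[of b d] sym by (auto simp: A)
  obtain s13 where s13: "s13 = 1 \<or> s13 = -1" "g = s13 * c" using sg[of c g] sym by (auto simp: A)
  obtain s23 where s23: "s23 = 1 \<or> s23 = -1" "h = s23 * f" using sg[of f h] sym by (auto simp: A)
  have "\<exists>t1 t2 t3. (t1 = 1 \<or> t1 = -1) \<and> (t2 = 1 \<or> t2 = -1) \<and> (t3 = 1 \<or> t3 = -1) \<and> t1 * t2 * t3 = 1
      \<and> t1 * b = t2 * d \<and> t1 * c = t3 * g \<and> t2 * f = t3 * h"
  proof -
    consider "b = 0" | "c = 0" | "f = 0" | "b \<noteq> 0" "c \<noteq> 0" "f \<noteq> 0" by blast
    then show ?thesis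
    proof cases
      case 1
      show ?thesis
        by (rule exI[of _ s23], rule exI[of _ s13], rule exI[of _ "s23 * s13"]) (use 1 s12 s13 s23 in auto)
    next
      case 2
      show ?thesis
        by (rule exI[of _ s23], rule exI[of _ "s23 * s12"], rule exI[of _ s12]) (use 2 s12 s13 s23 in auto)
    next
      case 3
      show ?thesis
        by (rule exI[of _ "s13 * s12"], rule exI[of _ s13], rule exI[of _ s12]) (use 3 s12 s13 s23 in auto)
    next
      case 4
      have o1: "a * b + d * e + g * h = 0"
        using rot unfolding A rotation_mat3_iff by blast
      have "rotation_matrix (transpose A)"
        using rot by (simp add: rotation_matrix_def det_transpose)
      then have o2: "a * d + b * e + c * f = 0"
        unfolding A mat3_transpose rotation_mat3_iff by blast
      have sq: "s12 * s12 = 1" using s12(1) by auto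
      have sq': "s12 * (s12 * y) = y" for y using sq by (simp flip: mult.assoc)
      have "(s13 * s23 - s12) * (c * f) = (a * b + d * e + g * h) - s12 * (a * d + b * e + c * f)"
        unfolding s12(2) s13(2) s23(2) by (simp add: algebra_simps sq sq')
      then have "s13 * s23 = s12" using o1 o2 4 by simp
      then have "s12 * s13 * s23 = 1" using sq by (simp add: mult.assoc)
      then show ?thesis
        by (intro exI[of _ s23] exI[of _ s13] exI[of _ s12]) (use s12 s13 s23 in auto)
    qed
  qed
  then obtain t1 t2 t3 where t: "t1 = 1 \<or> t1 = -1" "t2 = 1 \<or> t2 = -1" "t3 = 1 \<or> t3 = -1" "t1 * t2 * t3 = 1"
    and eq: "t1 * b = t2 * d" "t1 * c = t3 * g" "t2 * f = t3 * h" by blast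
  define D where "D = diag3 t1 t2 t3"
  have DV: "D \<in> four_group" unfolding D_def by (rule sign_diag_in_four_group[OF t])
  have symD: "transpose (D ** A) = D ** A"
    by (simp add: D_def A diag3_def mat3_mult mat3_transpose mat3_eq_iff eq)
  have "orthogonal_matrix D"
    unfolding D_def orthogonal_matrix diag3_def using t
    by (auto simp: mat3_transpose mat3_mult mat3_one mat3_eq_iff)
  then have "orthogonal_matrix (D ** A)"
    using rot by (simp add: rotation_matrix_def orthogonal_matrix_mul)
  then have "(D ** A) ** (D ** A) = mat 1"
    using symD by (simp add: orthogonal_matrix_def)
  then show ?thesis using that DV by blast
qed

definition golden :: real where
  "golden = (1 + sqrt 5) / 2"

lemma golden_square: "golden * golden = golden + 1"
  by (simp add: golden_def field_simps)

lemma golden_bounds: "golden > 3/2" "golden < 2"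
proof -
  have "sqrt 5 > 2" by (rule real_less_rsqrt) simp
  then show "golden > 3/2" by (simp add: golden_def)
  have "sqrt 5 < 3" by (rule real_less_lsqrt) simp_all
  then show "golden < 2" by (simp add: golden_def)
qed

text \<open>The absolute values of the coordinates of the edge midpoints of the icosahedron, normalised to unit
  length. The first three triples also describe the vertices of the octahedron.\<close>

definition edge_pattern :: "real \<Rightarrow> real \<Rightarrow> real \<Rightarrow> bool" where
  "edge_pattern x y z \<longleftrightarrow>
     (\<bar>x\<bar>, \<bar>y\<bar>, \<bar>z\<bar>) \<in> {(1, 0, 0), (0, 1, 0), (0, 0, 1),
       ((golden - 1) / 2, golden / 2, 1 / 2), (1 / 2, (golden - 1) / 2, golden / 2),
       (golden / 2, 1 / 2, (golden - 1) / 2)}"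

text \<open>A row without zeros determines the three columns by their first entries, and the square that results is
  symmetric. With zeros the matrix is a permutation matrix, and only the two cyclic permutations of order
  three are not symmetric.\<close>

lemma permutation_like_pattern:
  fixes \<alpha> \<beta> \<gamma> :: real
  defines "P x y z \<equiv> (x = 1 \<and> y = 0 \<and> z = 0) \<or> (x = 0 \<and> y = 1 \<and> z = 0) \<or> (x = 0 \<and> y = 0 \<and> z = 1) \<or>
      (x = \<alpha> \<and> y = \<beta> \<and> z = \<gamma>) \<or> (x = \<gamma> \<and> y = \<alpha> \<and> z = \<beta>) \<or> (x = \<beta> \<and> y = \<gamma> \<and> z = \<alpha>)"
  assumes ord: "0 < \<alpha>" "\<alpha> < \<gamma>" "\<gamma> < \<beta>" "\<beta> < 1"
    and rows: "P a b c" "P d e f" "P g h i" and cols: "P a d g" "P b e h" "P c f i"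
  shows "(b = d \<and> c = g \<and> f = h) \<or>
    (a = 0 \<and> b = 0 \<and> c = 1 \<and> d = 1 \<and> e = 0 \<and> f = 0 \<and> g = 0 \<and> h = 1 \<and> i = 0) \<or>
    (a = 0 \<and> b = 1 \<and> c = 0 \<and> d = 0 \<and> e = 0 \<and> f = 1 \<and> g = 1 \<and> h = 0 \<and> i = 0)"
proof -
  have dist: "\<alpha> \<noteq> 0" "\<beta> \<noteq> 0" "\<gamma> \<noteq> 0" "\<alpha> \<noteq> 1" "\<beta> \<noteq> 1" "\<gamma> \<noteq> 1" "\<alpha> \<noteq> \<beta>" "\<beta> \<noteq> \<gamma>" "\<alpha> \<noteq> \<gamma>" "\<beta> \<noteq> \<alpha>" "\<gamma> \<noteq> \<beta>" "\<gamma> \<noteq> \<alpha>"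
    using ord by auto
  have P: "P x y z \<longleftrightarrow> (x = 1 \<and> y = 0 \<and> z = 0) \<or> (x = 0 \<and> y = 1 \<and> z = 0) \<or> (x = 0 \<and> y = 0 \<and> z = 1) \<or>
      (x = \<alpha> \<and> y = \<beta> \<and> z = \<gamma>) \<or> (x = \<gamma> \<and> y = \<alpha> \<and> z = \<beta>) \<or> (x = \<beta> \<and> y = \<gamma> \<and> z = \<alpha>)" for x y z
    unfolding P_def ..
  have one: "P 1 y z \<longleftrightarrow> y = 0 \<and> z = 0" and zero: "P 0 y z \<longleftrightarrow> (y = 1 \<and> z = 0) \<or> (y = 0 \<and> z = 1)"
    and \<alpha>: "P \<alpha> y z \<longleftrightarrow> y = \<beta> \<and> z = \<gamma>" and \<beta>: "P \<beta> y z \<longleftrightarrow> y = \<gamma> \<and> z = \<alpha>"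
    and \<gamma>: "P \<gamma> y z \<longleftrightarrow> y = \<alpha> \<and> z = \<beta>" for y z
    unfolding P using dist by auto
  from rows(1)[unfolded P] show ?thesis
  proof (elim disjE conjE)
    assume "a = 1" "b = 0" "c = 0"
    with rows(2,3) cols show ?thesis by (auto simp: one zero)
  next
    assume "a = 0" "b = 1" "c = 0"
    with rows(2,3) cols show ?thesis by (auto simp: one zero)
  next
    assume "a = 0" "b = 0" "c = 1"
    with rows(2,3) cols show ?thesis by (auto simp: one zero)
  qed (use cols in \<open>simp_all add: \<alpha> \<beta> \<gamma>\<close>)
qed

lemma edge_pattern_matrix:
  fixes a b c :: real
  assumes "edge_pattern a b c" "edge_pattern d e f" "edge_pattern g h i"
    and "edge_pattern a d g" "edge_pattern b e h" "edge_pattern c f i"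
  shows "(\<bar>b\<bar> = \<bar>d\<bar> \<and> \<bar>c\<bar> = \<bar>g\<bar> \<and> \<bar>f\<bar> = \<bar>h\<bar>) \<or>
    (a = 0 \<and> b = 0 \<and> \<bar>c\<bar> = 1 \<and> \<bar>d\<bar> = 1 \<and> e = 0 \<and> f = 0 \<and> g = 0 \<and> \<bar>h\<bar> = 1 \<and> i = 0) \<or>
    (a = 0 \<and> \<bar>b\<bar> = 1 \<and> c = 0 \<and> d = 0 \<and> e = 0 \<and> \<bar>f\<bar> = 1 \<and> \<bar>g\<bar> = 1 \<and> h = 0 \<and> i = 0)"
proof -
  define \<alpha> \<beta> \<gamma> :: real where "\<alpha> = (golden - 1) / 2" and "\<beta> = golden / 2" and "\<gamma> = 1 / 2"
  have ne: "0 < \<alpha>" "\<alpha> < \<gamma>" "\<gamma> < \<beta>" "\<beta> < 1"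
    using golden_bounds by (simp_all add: \<alpha>_def \<beta>_def \<gamma>_def)
  have ep: "edge_pattern x y z \<longleftrightarrow>
      (\<bar>x\<bar> = 1 \<and> \<bar>y\<bar> = 0 \<and> \<bar>z\<bar> = 0) \<or> (\<bar>x\<bar> = 0 \<and> \<bar>y\<bar> = 1 \<and> \<bar>z\<bar> = 0) \<or> (\<bar>x\<bar> = 0 \<and> \<bar>y\<bar> = 0 \<and> \<bar>z\<bar> = 1) \<or>
      (\<bar>x\<bar> = \<alpha> \<and> \<bar>y\<bar> = \<beta> \<and> \<bar>z\<bar> = \<gamma>) \<or> (\<bar>x\<bar> = \<gamma> \<and> \<bar>y\<bar> = \<alpha> \<and> \<bar>z\<bar> = \<beta>) \<or> (\<bar>x\<bar> = \<beta> \<and> \<bar>y\<bar> = \<gamma> \<and> \<bar>z\<bar> = \<alpha>)" for x y z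
    unfolding edge_pattern_def \<alpha>_def \<beta>_def \<gamma>_def by simp
  show ?thesis
    using permutation_like_pattern[of \<alpha> \<gamma> \<beta> "\<bar>a\<bar>" "\<bar>b\<bar>" "\<bar>c\<bar>" "\<bar>d\<bar>" "\<bar>e\<bar>" "\<bar>f\<bar>" "\<bar>g\<bar>" "\<bar>h\<bar>" "\<bar>i\<bar>"] ne
      assms[unfolded ep]
    by (simp only: abs_eq_0)
qed


lemma rotation_edge_pattern_cover:
  assumes rot: "rotation_matrix A"
    and cols: "\<And>j. edge_pattern (A $ 1 $ j) (A $ 2 $ j) (A $ 3 $ j)"
    and rows: "\<And>i. edge_pattern (A $ i $ 1) (A $ i $ 2) (A $ i $ 3)"
  obtains d where "d \<in> four_group"
    "(d ** A) ** (d ** A) = mat 1 \<or> d ** A = cyc3 \<or> d ** A = transpose cyc3"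
proof -
  obtain a b c d e f g h i where A: "A = mat3 a b c d e f g h i" using mat3_eq by blast
  \<comment> \<open>For a signed cyclic permutation matrix the determinant is the product of the signs.\<close>
  have dt: "a * e * i + b * f * g + c * d * h - a * f * h - b * d * i - c * e * g = 1"
    using rot unfolding A rotation_mat3_iff by blast
  consider "\<bar>b\<bar> = \<bar>d\<bar> \<and> \<bar>c\<bar> = \<bar>g\<bar> \<and> \<bar>f\<bar> = \<bar>h\<bar>"
    | "a = 0" "b = 0" "\<bar>c\<bar> = 1" "\<bar>d\<bar> = 1" "e = 0" "f = 0" "g = 0" "\<bar>h\<bar> = 1" "i = 0"
    | "a = 0" "\<bar>b\<bar> = 1" "c = 0" "d = 0" "e = 0" "\<bar>f\<bar> = 1" "\<bar>g\<bar> = 1" "h = 0" "i = 0"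
    using edge_pattern_matrix[of a b c d e f g h i] rows[of 1] rows[of 2] rows[of 3] cols[of 1] cols[of 2] cols[of 3]
    by (auto simp: A)
  then show ?thesis
  proof cases
    case 1
    then show ?thesis
      using four_group_symmetrize[OF rot] that by (auto simp: A)
  next
    case 2
    have pm: "c = 1 \<or> c = -1" "d = 1 \<or> d = -1" "h = 1 \<or> h = -1" using 2 by linarith+
    have "c * d * h = 1" using dt 2 by simp
    then have "diag3 c d h \<in> four_group" using pm by (intro sign_diag_in_four_group)
    moreover have "diag3 c d h ** A = cyc3"
      using pm by (auto simp: A 2 diag3_def cyc3_def mat3_mult mat3_eq_iff)
    ultimately show ?thesis using that by blast
  next
    case 3
    have pm: "b = 1 \<or> b = -1" "f = 1 \<or> f = -1" "g = 1 \<or> g = -1" using 3 by linarith+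
    have "b * f * g = 1" using dt 3 by simp
    then have "diag3 b f g \<in> four_group" using pm by (intro sign_diag_in_four_group)
    moreover have "diag3 b f g ** A = transpose cyc3"
      using pm by (auto simp: A 3 diag3_def cyc3_def mat3_mult mat3_eq_iff mat3_transpose)
    ultimately show ?thesis using that by blast
  qed
qed

lemma transpose_rotational_symmetry:
  assumes "A \<in> rotational_symmetries S"
  shows "transpose A \<in> rotational_symmetries S"
proof -
  have o: "transpose A ** A = mat 1"
    using assms by (simp add: rotational_symmetries_def rotation_matrix_def orthogonal_matrix_def)
  have "(\<lambda>x. transpose A *v x) ` S = (\<lambda>x. transpose A *v x) ` ((\<lambda>x. A *v x) ` S)"
    using assms by (simp add: rotational_symmetries_def)
  also have "\<dots> = (\<lambda>x. (transpose A ** A) *v x) ` S"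
    by (simp only: image_image matrix_vector_mul_assoc)
  also have "\<dots> = S" by (simp add: o)
  finally show ?thesis
    using assms by (simp add: rotational_symmetries_def rotation_matrix_def det_transpose del: transpose_matrix_vector)
qed

text \<open>The coordinate vectors are scaled midpoints of pairs of vertices with a given inner product. A symmetry
  maps such pairs to such pairs, which restricts the columns of its matrix, and the rows by
  transposition.\<close>

lemma rotational_symmetries_cover:
  fixes V :: "(real^3) set"
  assumes norm: "\<And>v. v \<in> V \<Longrightarrow> norm v = R"
    and axes: "\<exists>p\<in>V. \<exists>q\<in>V. p \<bullet> q = t \<and> vector [1, 0, 0] = k *\<^sub>R (p + q)"
      "\<exists>p\<in>V. \<exists>q\<in>V. p \<bullet> q = t \<and> vector [0, 1, 0] = k *\<^sub>R (p + q)"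
      "\<exists>p\<in>V. \<exists>q\<in>V. p \<bullet> q = t \<and> vector [0, 0, 1] = k *\<^sub>R (p + q)"
    and mid: "\<And>p q x. p \<in> V \<Longrightarrow> q \<in> V \<Longrightarrow> p \<bullet> q = t \<Longrightarrow> x = k *\<^sub>R (p + q) \<Longrightarrow> edge_pattern (x $ 1) (x $ 2) (x $ 3)"
    and A: "A \<in> rotational_symmetries (convex hull V)"
  shows "\<exists>d\<in>four_group. (d ** A) ** (d ** A) = mat 1 \<or>
    d ** A = cyc3 \<or> d ** A = transpose cyc3"
proof -
  have col: "edge_pattern (A $ 1 $ j) (A $ 2 $ j) (A $ 3 $ j)"
    if A: "A \<in> rotational_symmetries (convex hull V)" for A j
  proof -
    have ot: "orthogonal_transformation ((*v) A)"
      using A by (simp add: rotational_symmetries_def rotation_matrix_def orthogonal_transformation_matrix matrix_vector_mul_linear)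
    have gen: "edge_pattern ((A *v x) $ 1) ((A *v x) $ 2) ((A *v x) $ 3)"
      if ex: "\<exists>p\<in>V. \<exists>q\<in>V. p \<bullet> q = t \<and> x = k *\<^sub>R (p + q)" for x
    proof -
      obtain p q where pq: "p \<in> V" "q \<in> V" "p \<bullet> q = t" "x = k *\<^sub>R (p + q)" using ex by blast
      show ?thesis
      proof (rule mid)
        show "A *v p \<in> V" "A *v q \<in> V"
          using rotational_symmetry_vertices[OF norm A] pq by auto
        show "(A *v p) \<bullet> (A *v q) = t"
          using ot pq(3) by (simp add: orthogonal_transformation_def)
        show "A *v x = k *\<^sub>R (A *v p + A *v q)"
          by (simp add: pq(4) matrix_vector_mult_scaleR matrix_vector_right_distrib)
      qed
    qed
    obtain a b c d e f g h i where A: "A = mat3 a b c d e f g h i" using mat3_eq by blast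
    have "j = 1 \<or> j = 2 \<or> j = 3" using exhaust_3 .
    then show ?thesis
      using gen[OF axes(1)] gen[OF axes(2)] gen[OF axes(3)]
      by (auto simp: A mat3_mult_vector)
  qed
  have row: "edge_pattern (A $ i $ 1) (A $ i $ 2) (A $ i $ 3)" for i
    using col[OF transpose_rotational_symmetry[OF A], of i] by (simp add: transpose_def)
  have "rotation_matrix A" using A by (simp add: rotational_symmetries_def)
  from rotation_edge_pattern_cover[OF this col[OF A] row] show ?thesis by blast
qed

lemma finite_rotational_symmetries:
  fixes V :: "(real^3) set"
  assumes V: "finite V" and norm: "\<And>v. v \<in> V \<Longrightarrow> norm v = R"
    and axes: "\<exists>p\<in>V. \<exists>q\<in>V. vector [1, 0, 0] = k *\<^sub>R (p + q)"
      "\<exists>p\<in>V. \<exists>q\<in>V. vector [0, 1, 0] = k *\<^sub>R (p + q)"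
      "\<exists>p\<in>V. \<exists>q\<in>V. vector [0, 0, 1] = k *\<^sub>R (p + q)"
  shows "finite (rotational_symmetries (convex hull V))"
proof -
  let ?G = "rotational_symmetries (convex hull V)"
  let ?r = "\<lambda>A. restrict ((*v) A) V"
  have "?r ` ?G \<subseteq> (\<Pi>\<^sub>E v\<in>V. V)"
    using rotational_symmetry_vertices[OF norm] by auto
  then have "finite (?r ` ?G)"
    using V by (meson finite_PiE finite_subset)
  moreover have "inj_on ?r ?G"
  proof (rule inj_onI)
    fix A B :: "real^3^3" assume eq: "?r A = ?r B"
    have v: "A *v v = B *v v" if "v \<in> V" for v
      using fun_cong[OF eq, of v] that by simp
    have gen: "A *v x = B *v x" if "\<exists>p\<in>V. \<exists>q\<in>V. x = k *\<^sub>R (p + q)" for x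
      using that v by (auto simp: matrix_vector_mult_scaleR matrix_vector_right_distrib)
    obtain a b c d e f g h i where A: "A = mat3 a b c d e f g h i" using mat3_eq by blast
    obtain a' b' c' d' e' f' g' h' i' where B: "B = mat3 a' b' c' d' e' f' g' h' i'" using mat3_eq by blast
    show "A = B"
      using gen[OF axes(1)] gen[OF axes(2)] gen[OF axes(3)]
      by (simp add: A B mat3_mult_vector vector3_eq_iff mat3_eq_iff)
  qed
  ultimately show ?thesis by (rule finite_imageD)
qed

lemma norm_vector3: "norm (vector [x, y, z] :: real^3) = sqrt (x * x + y * y + z * z)"
  by (simp add: norm_eq_sqrt_inner inner_vec_def sum_3)

lemma inner_vector3: "(vector [x, y, z] :: real^3) \<bullet> vector [x', y', z'] = x * x' + y * y' + z * z'"
  by (simp add: inner_vec_def sum_3)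

lemma scale_add_vector3: "k *\<^sub>R ((vector [x, y, z] :: real^3) + vector [x', y', z']) = vector [k * (x + x'), k * (y + y'), k * (z + z')]"
  by (simp add: vec_eq_iff forall_3)

definition octahedron_vertices :: "(real^3) set" where
  "octahedron_vertices = {vector [1, 0, 0], vector [-1, 0, 0], vector [0, 1, 0], vector [0, -1, 0],
      vector [0, 0, 1], vector [0, 0, -1]}"

definition icosahedron_vertices :: "(real^3) set" where
  "icosahedron_vertices = {v. \<exists>a b. (a = 1 \<or> a = -1) \<and> (b = golden \<or> b = -golden) \<and>
     (v = vector [0, a, b] \<or> v = vector [a, b, 0] \<or> v = vector [b, 0, a])}"

lemma std_icosahedron_eq: "std_icosahedron = convex hull icosahedron_vertices"
proof -
  have "(\<Union>a\<in>{-1, 1}. \<Union>b\<in>{-golden, golden}. {vector [0, a, b], vector [a, b, 0], vector [b, 0, a]})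
      = icosahedron_vertices"
    unfolding icosahedron_vertices_def by auto
  then show ?thesis by (simp add: std_icosahedron_def Let_def golden_def[symmetric])
qed

lemma finite_icosahedron_vertices: "finite icosahedron_vertices"
proof -
  have "icosahedron_vertices \<subseteq> (\<Union>a\<in>{-1, 1}. \<Union>b\<in>{-golden, golden}. {vector [0, a, b], vector [a, b, 0], vector [b, 0, a]})"
    unfolding icosahedron_vertices_def by auto
  then show ?thesis by (rule finite_subset) auto
qed

lemma icosahedron_vertexI:
  assumes "a = 1 \<or> a = -1" "b = golden \<or> b = -golden"
  shows "vector [0, a, b] \<in> icosahedron_vertices" "vector [a, b, 0] \<in> icosahedron_vertices"
    "vector [b, 0, a] \<in> icosahedron_vertices"
  using assms by (auto simp: icosahedron_vertices_def)

lemma icosahedron_vertexE: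
  assumes "v \<in> icosahedron_vertices"
  obtains a b where "a = 1 \<or> a = -1" "b = golden \<or> b = -golden" "v = vector [0, a, b]"
  | a b where "a = 1 \<or> a = -1" "b = golden \<or> b = -golden" "v = vector [a, b, 0]"
  | a b where "a = 1 \<or> a = -1" "b = golden \<or> b = -golden" "v = vector [b, 0, a]"
proof -
  obtain a b where ab: "a = 1 \<or> a = -1" "b = golden \<or> b = -golden"
    and v: "v = vector [0, a, b] \<or> v = vector [a, b, 0] \<or> v = vector [b, 0, a]"
    using assms unfolding icosahedron_vertices_def mem_Collect_eq by (elim exE conjE)
  from v show thesis
  proof (elim disjE)
    assume "v = vector [0, a, b]"
    with ab show thesis by (rule that(1))
  next
    assume "v = vector [a, b, 0]"
    with ab show thesis by (rule that(2))
  next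
    assume "v = vector [b, 0, a]"
    with ab show thesis by (rule that(3))
  qed
qed

lemma icosahedron_norm: "v \<in> icosahedron_vertices \<Longrightarrow> norm v = sqrt (1 + golden * golden)"
  by (erule icosahedron_vertexE; elim disjE) (simp_all add: norm_vector3 add.commute)

text \<open>The half turn about the axis \<open>(golden, -1, 1 - golden)\<close>. This is the midpoint of an edge up to scaling,
  and it is orthogonal to the axis \<open>(1, 1, 1)\<close> of the cyclic permutation, which is therefore inverted.\<close>

definition half_turn :: "real^3^3" where
  "half_turn = mat3 ((golden - 1) / 2) (- golden / 2) (- 1 / 2) (- golden / 2) (- 1 / 2) ((golden - 1) / 2)
     (- 1 / 2) ((golden - 1) / 2) (- golden / 2)"

lemma half_turn_vertices:
    "half_turn *v vector [0, 1, golden] = vector [-golden, 0, -1]"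
    "half_turn *v vector [1, golden, 0] = vector [-1, -golden, 0]"
    "half_turn *v vector [golden, 0, 1] = vector [0, -1, -golden]"
    "half_turn *v vector [0, 1, -golden] = vector [0, -1, golden]"
    "half_turn *v vector [1, -golden, 0] = vector [golden, 0, -1]"
    "half_turn *v vector [-golden, 0, 1] = vector [-1, golden, 0]"
    "half_turn *v vector [0, -1, golden] = vector [0, 1, -golden]"
    "half_turn *v vector [-1, golden, 0] = vector [-golden, 0, 1]"
    "half_turn *v vector [golden, 0, -1] = vector [1, -golden, 0]"
    "half_turn *v vector [0, -1, -golden] = vector [golden, 0, 1]"
    "half_turn *v vector [-1, -golden, 0] = vector [1, golden, 0]"
    "half_turn *v vector [-golden, 0, -1] = vector [0, 1, golden]"
  unfolding half_turn_def mat3_mult_vector vector3_eq_iff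
  by (simp_all add: field_simps golden_square)

lemma half_turn_properties:
  "rotation_matrix half_turn" "half_turn ** half_turn = mat 1"
  "half_turn ** cyc3 ** half_turn = transpose cyc3"
  using golden_square
  by (simp_all add: half_turn_def cyc3_def rotation_mat3_iff mat3_mult mat3_one mat3_transpose mat3_eq_iff field_simps golden_square)

lemma golden_products:
  "(golden - 1) / 2 * (1 + golden) = golden / 2" "(golden - 1) / 2 * golden = 1 / 2"
  by (simp_all add: field_simps golden_square)

text \<open>Two vertices with inner product \<open>golden\<close> are the ends of an edge. The squared norm of a vertex is
  \<open>golden + 2\<close>, and the sum of the ends of an edge has norm \<open>2 golden\<close>; the inverse of \<open>golden\<close> is
  \<open>golden - 1\<close>.\<close>

lemma edge_midpoint_same_type:
  assumes "a = 1 \<or> a = -1" "a' = 1 \<or> a' = -1" "b = golden \<or> b = -golden" "b' = golden \<or> b' = -golden"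
    and "a * a' + b * b' = golden"
  shows "\<bar>(golden - 1) / 2 * (a + a')\<bar> = 0" "\<bar>(golden - 1) / 2 * (b + b')\<bar> = 1"
proof -
  have "a' = -a \<and> b' = b"
    using assms golden_bounds by (elim disjE) (auto simp: golden_square)
  moreover have "(golden - 1) / 2 * (golden + golden) = 1"
    using golden_products(2) by (simp add: algebra_simps)
  moreover have "(golden - 1) / 2 * (-golden + -golden) = -1"
    using golden_products(2) by (simp add: algebra_simps)
  ultimately show "\<bar>(golden - 1) / 2 * (a + a')\<bar> = 0" "\<bar>(golden - 1) / 2 * (b + b')\<bar> = 1"
    using assms(3) by auto
qed

lemma edge_midpoint_different_type:
  assumes a: "a = 1 \<or> a = -1" "a' = 1 \<or> a' = -1" "b = golden \<or> b = -golden" "b' = golden \<or> b' = -golden"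
    and ab: "a * b' = golden"
  shows "\<bar>(golden - 1) / 2 * (a + b')\<bar> = golden / 2" "\<bar>(golden - 1) / 2 * (b' + a)\<bar> = golden / 2"
    "\<bar>(golden - 1) / 2 * b\<bar> = 1 / 2" "\<bar>(golden - 1) / 2 * a'\<bar> = (golden - 1) / 2"
proof -
  have b': "b' = a * golden" using a(1) ab by auto
  have "(golden - 1) / 2 * (a + b') = a * ((golden - 1) / 2 * (1 + golden))"
    by (simp add: b' algebra_simps)
  also have "\<dots> = a * (golden / 2)" by (simp only: golden_products)
  finally show 1: "\<bar>(golden - 1) / 2 * (a + b')\<bar> = golden / 2"
    using a(1) golden_bounds by (auto simp: abs_mult)
  then show "\<bar>(golden - 1) / 2 * (b' + a)\<bar> = golden / 2" by (simp only: add.commute)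
  have "\<bar>(golden - 1) / 2 * b\<bar> = \<bar>(golden - 1) / 2 * golden\<bar>"
    using a(3) unfolding abs_mult by auto
  then show "\<bar>(golden - 1) / 2 * b\<bar> = 1 / 2" unfolding golden_products by simp
  show "\<bar>(golden - 1) / 2 * a'\<bar> = (golden - 1) / 2"
    using a(2) golden_bounds by (auto simp: abs_mult)
qed

lemma icosahedron_edge_midpoints:
  assumes p: "p \<in> icosahedron_vertices" and q: "q \<in> icosahedron_vertices" and pq: "p \<bullet> q = golden"
    and x: "x = ((golden - 1) / 2) *\<^sub>R (p + q)"
  shows "edge_pattern (x $ 1) (x $ 2) (x $ 3)"
proof -
  note same = edge_midpoint_same_type and diff = edge_midpoint_different_type
  note simps = x scale_add_vector3 vector_3 edge_pattern_def mult_zero_right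
    add_0_left add_0_right abs_zero insert_iff prod.inject simp_thms
  from p show ?thesis
  proof (cases rule: icosahedron_vertexE)
    case p: (1 a b)
    from q show ?thesis
    proof (cases rule: icosahedron_vertexE)
      case q: (1 c d)
      have "a * c + b * d = golden" using pq by (simp add: p q inner_vector3 mult.commute)
      from same[OF p(1) q(1) p(2) q(2) this] show ?thesis by (simp only: p(3) q(3) simps)
    next
      case q: (2 c d)
      have "a * d = golden" using pq by (simp add: p q inner_vector3 mult.commute)
      from diff[OF p(1) q(1) p(2) q(2) this] show ?thesis by (simp only: p(3) q(3) simps)
    next
      case q: (3 c d)
      have "c * b = golden" using pq by (simp add: p q inner_vector3 mult.commute)
      from diff[OF q(1) p(1) q(2) p(2) this] show ?thesis by (simp only: p(3) q(3) simps)
    qed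
  next
    case p: (2 a b)
    from q show ?thesis
    proof (cases rule: icosahedron_vertexE)
      case q: (1 c d)
      have "c * b = golden" using pq by (simp add: p q inner_vector3 mult.commute)
      from diff[OF q(1) p(1) q(2) p(2) this] show ?thesis by (simp only: p(3) q(3) simps)
    next
      case q: (2 c d)
      have "a * c + b * d = golden" using pq by (simp add: p q inner_vector3 mult.commute)
      from same[OF p(1) q(1) p(2) q(2) this] show ?thesis by (simp only: p(3) q(3) simps)
    next
      case q: (3 c d)
      have "a * d = golden" using pq by (simp add: p q inner_vector3 mult.commute)
      from diff[OF p(1) q(1) p(2) q(2) this] show ?thesis by (simp only: p(3) q(3) simps)
    qed
  next
    case p: (3 a b)
    from q show ?thesis
    proof (cases rule: icosahedron_vertexE)
      case q: (1 c d)
      have "a * d = golden" using pq by (simp add: p q inner_vector3 mult.commute)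
      from diff[OF p(1) q(1) p(2) q(2) this] show ?thesis by (simp only: p(3) q(3) simps)
    next
      case q: (2 c d)
      have "c * b = golden" using pq by (simp add: p q inner_vector3 mult.commute)
      from diff[OF q(1) p(1) q(2) p(2) this] show ?thesis by (simp only: p(3) q(3) simps)
    next
      case q: (3 c d)
      have "a * c + b * d = golden" using pq by (simp add: p q inner_vector3 mult.commute)
      from same[OF p(1) q(1) p(2) q(2) this] show ?thesis by (simp only: p(3) q(3) simps)
    qed
  qed
qed

text \<open>The part of the structure that is common to the octahedral and the icosahedral group.\<close>

definition sign_structured :: "(real^3^3) set \<Rightarrow> bool" where
  "sign_structured G \<longleftrightarrow> finite G \<and> four_group \<subseteq> G \<and> cyc3 \<in> G \<and>
     (\<exists>s\<in>G. s ** s = mat 1 \<and> s ** cyc3 ** s = transpose cyc3) \<and>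
     (\<forall>A\<in>G. \<exists>d\<in>four_group. (d ** A) ** (d ** A) = mat 1 \<or>
        d ** A = cyc3 \<or> d ** A = transpose cyc3)"

lemma four_group_rotation: "A \<in> four_group \<Longrightarrow> rotation_matrix A"
  by (auto simp: four_group_def diag3_def mat3_one rotation_mat3_iff)

lemma cyc3_rotation: "rotation_matrix cyc3"
  by (simp add: cyc3_def rotation_mat3_iff)

lemma sign_structured_icosahedron: "sign_structured (rotational_symmetries std_icosahedron)"
proof -
  let ?V = icosahedron_vertices
  have e: "(golden - 1) / 2 * (golden + golden) = 1"
    using golden_products(2) by (simp add: algebra_simps)
  have k: "vector [1, 0, 0] = ((golden - 1) / 2) *\<^sub>R (vector [golden, 0, 1] + vector [golden, 0, -1] :: real^3)"
    "vector [0, 1, 0] = ((golden - 1) / 2) *\<^sub>R (vector [1, golden, 0] + vector [-1, golden, 0] :: real^3)"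
    "vector [0, 0, 1] = ((golden - 1) / 2) *\<^sub>R (vector [0, 1, golden] + vector [0, -1, golden] :: real^3)"
    by (simp_all only: scale_add_vector3 vector3_eq_iff e add_0_left right_minus mult_zero_right simp_thms)
  have i: "(vector [golden, 0, 1] :: real^3) \<bullet> vector [golden, 0, -1] = golden"
    "(vector [1, golden, 0] :: real^3) \<bullet> vector [-1, golden, 0] = golden"
    "(vector [0, 1, golden] :: real^3) \<bullet> vector [0, -1, golden] = golden"
    by (simp_all add: inner_vector3 golden_square)
  have m: "vector [golden, 0, 1] \<in> ?V" "vector [golden, 0, -1] \<in> ?V" "vector [1, golden, 0] \<in> ?V"
    "vector [-1, golden, 0] \<in> ?V" "vector [0, 1, golden] \<in> ?V" "vector [0, -1, golden] \<in> ?V"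
    by (simp_all add: icosahedron_vertexI)
  have axes: "\<exists>p\<in>?V. \<exists>q\<in>?V. p \<bullet> q = golden \<and> vector [1, 0, 0] = ((golden - 1) / 2) *\<^sub>R (p + q)"
      "\<exists>p\<in>?V. \<exists>q\<in>?V. p \<bullet> q = golden \<and> vector [0, 1, 0] = ((golden - 1) / 2) *\<^sub>R (p + q)"
      "\<exists>p\<in>?V. \<exists>q\<in>?V. p \<bullet> q = golden \<and> vector [0, 0, 1] = ((golden - 1) / 2) *\<^sub>R (p + q)"
    using k i m by metis+
  have "finite (rotational_symmetries std_icosahedron)"
    unfolding std_icosahedron_eq
    by (rule finite_rotational_symmetries[OF finite_icosahedron_vertices icosahedron_norm]) (use axes in blast)+
  moreover have "four_group \<subseteq> rotational_symmetries std_icosahedron"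
  proof
    fix A assume A: "A \<in> four_group"
    have "A *v v \<in> ?V" if "v \<in> ?V" for v
      using A that
      by (auto simp: four_group_def diag3_def mat3_mult_vector elim!: icosahedron_vertexE intro!: icosahedron_vertexI)
    then show "A \<in> rotational_symmetries std_icosahedron"
      unfolding std_icosahedron_eq
      by (intro rotational_symmetryI finite_icosahedron_vertices four_group_rotation A)
  qed
  moreover have "cyc3 \<in> rotational_symmetries std_icosahedron"
    unfolding std_icosahedron_eq
    by (rule rotational_symmetryI[OF finite_icosahedron_vertices _ cyc3_rotation])
       (auto simp: cyc3_def mat3_mult_vector elim!: icosahedron_vertexE intro!: icosahedron_vertexI)
  moreover have "half_turn \<in> rotational_symmetries std_icosahedron"
    unfolding std_icosahedron_eq
    by (rule rotational_symmetryI[OF finite_icosahedron_vertices _ half_turn_properties(1)])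
       (erule icosahedron_vertexE; elim disjE; simp add: half_turn_vertices icosahedron_vertexI)
  moreover have "\<exists>d\<in>four_group. (d ** A) ** (d ** A) = mat 1 \<or>
        d ** A = cyc3 \<or> d ** A = transpose cyc3" if "A \<in> rotational_symmetries std_icosahedron" for A
    by (rule rotational_symmetries_cover[OF _ axes, OF icosahedron_norm _ that[unfolded std_icosahedron_eq]])
       (assumption | erule (3) icosahedron_edge_midpoints)+
  ultimately show ?thesis
    unfolding sign_structured_def using half_turn_properties(2,3) by blast
qed

lemma sign_structured_octahedron: "sign_structured (rotational_symmetries std_octahedron)"
proof -
  let ?V = octahedron_vertices
  have eq: "std_octahedron = convex hull ?V"
    by (simp add: std_octahedron_def octahedron_vertices_def)
  have fin: "finite ?V" by (simp add: octahedron_vertices_def)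
  have norm: "norm v = 1" if "v \<in> ?V" for v
    using that by (auto simp: octahedron_vertices_def norm_vector3)
  have half: "v = (1/2) *\<^sub>R (v + v)" for v :: "real^3"
    by (simp add: vec_eq_iff)
  have m: "vector [1, 0, 0] \<in> ?V" "vector [0, 1, 0] \<in> ?V" "vector [0, 0, 1] \<in> ?V"
    by (simp_all add: octahedron_vertices_def)
  have self: "p \<bullet> p = 1" if "p \<in> ?V" for p using norm[OF that] by (simp add: norm_eq_1)
  have "\<exists>p\<in>?V. \<exists>q\<in>?V. p \<bullet> q = 1 \<and> v = (1/2) *\<^sub>R (p + q)" if "v \<in> ?V" for v
    by (rule bexI, rule bexI, rule conjI, rule self, rule that, rule half, rule that, rule that)
  note axes = this[OF m(1)] this[OF m(2)] this[OF m(3)]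
  have mid: "edge_pattern (x $ 1) (x $ 2) (x $ 3)"
    if "p \<in> ?V" "q \<in> ?V" "p \<bullet> q = 1" "x = (1/2) *\<^sub>R (p + q)" for p q x
  proof -
    have "(p - q) \<bullet> (p - q) = 0"
      using self[OF that(1)] self[OF that(2)] that(3)
      by (simp add: inner_diff_left inner_diff_right inner_commute[of q p])
    then have "q = p" by simp
    then have "x = p" using that(4) half[of p] by (simp only:)
    moreover have "edge_pattern (p $ 1) (p $ 2) (p $ 3)"
      using that(1) unfolding octahedron_vertices_def insert_iff empty_iff
      by (elim disjE) (simp_all add: edge_pattern_def)
    ultimately show ?thesis by (simp only:)
  qed
  have "finite (rotational_symmetries std_octahedron)"
    unfolding eq by (rule finite_rotational_symmetries[OF fin norm]) (use axes in blast)+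
  moreover have "four_group \<subseteq> rotational_symmetries std_octahedron"
  proof
    fix A assume A: "A \<in> four_group"
    have "A *v v \<in> ?V" if "v \<in> ?V" for v
      using A that by (auto simp: four_group_def diag3_def mat3_mult_vector octahedron_vertices_def)
    then show "A \<in> rotational_symmetries std_octahedron"
      unfolding eq by (intro rotational_symmetryI fin four_group_rotation A)
  qed
  moreover have "cyc3 \<in> rotational_symmetries std_octahedron"
    unfolding eq
    by (rule rotational_symmetryI[OF fin _ cyc3_rotation])
       (auto simp: cyc3_def mat3_mult_vector octahedron_vertices_def)
  moreover define s where "s = mat3 0 (-1) 0 (-1) 0 0 0 0 (-1)"
  have "rotation_matrix s" by (simp add: s_def rotation_mat3_iff)
  then have "s \<in> rotational_symmetries std_octahedron"
    unfolding eq
    by (intro rotational_symmetryI fin) (auto simp: s_def mat3_mult_vector octahedron_vertices_def)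
  moreover have "s ** s = mat 1" "s ** cyc3 ** s = transpose cyc3"
    by (simp_all add: s_def cyc3_def mat3_mult mat3_one mat3_transpose)
  moreover have "\<exists>d\<in>four_group. (d ** A) ** (d ** A) = mat 1 \<or>
        d ** A = cyc3 \<or> d ** A = transpose cyc3" if "A \<in> rotational_symmetries std_octahedron" for A
    by (rule rotational_symmetries_cover[OF _ axes, OF norm _ that[unfolded eq]])
       (assumption | erule (3) mid)+
  ultimately show ?thesis
    unfolding sign_structured_def by blast
qed

lemma matrix_inv_orthogonal:
  assumes "orthogonal_matrix (A :: real^3^3)"
  shows "matrix_inv A = transpose A"
  unfolding matrix_inv_def
proof (rule some_equality)
  show *: "A ** transpose A = mat 1 \<and> transpose A ** A = mat 1"
    using assms by (simp add: orthogonal_matrix_def)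
  fix B assume B: "A ** B = mat 1 \<and> B ** A = mat 1"
  have "B = (transpose A ** A) ** B" using * by simp
  also have "\<dots> = transpose A ** (A ** B)" by (simp only: matrix_mul_assoc)
  finally show "B = transpose A" using B by simp
qed

text \<open>A similarity conjugates the groups; the scaling factor cancels.\<close>

lemma rotational_symmetries_similar:
  assumes Q: "orthogonal_matrix Q" and c: "c > 0"
  shows "rotational_symmetries ((\<lambda>x. c *\<^sub>R (Q *v x)) ` S)
    = (\<lambda>B. Q ** B ** transpose Q) ` rotational_symmetries S"
proof -
  let ?T = "\<lambda>x. c *\<^sub>R (Q *v x)"
  have QQ: "transpose Q ** Q = mat 1" "Q ** transpose Q = mat 1"
    using Q by (simp_all add: orthogonal_matrix_def)
  have cancel: "transpose Q ** (Q ** B ** transpose Q) ** Q = B" "Q ** (transpose Q ** B ** Q) ** transpose Q = B" for B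
  proof -
    have "transpose Q ** (Q ** B ** transpose Q) ** Q = (transpose Q ** Q) ** B ** (transpose Q ** Q)"
      by (simp only: matrix_mul_assoc)
    then show "transpose Q ** (Q ** B ** transpose Q) ** Q = B" by (simp add: QQ)
    have "Q ** (transpose Q ** B ** Q) ** transpose Q = (Q ** transpose Q) ** B ** (Q ** transpose Q)"
      by (simp only: matrix_mul_assoc)
    then show "Q ** (transpose Q ** B ** Q) ** transpose Q = B" by (simp add: QQ)
  qed
  have dq: "det Q * det Q = 1"
    using det_orthogonal_matrix[OF Q] by auto
  have rot: "rotation_matrix (Q ** B ** transpose Q)" if "rotation_matrix B" for B
    using that Q dq by (auto simp: rotation_matrix_def orthogonal_matrix_mul det_mul det_transpose)
  have rot': "rotation_matrix (transpose Q ** B ** Q)" if "rotation_matrix B" for B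
    using that Q dq by (auto simp: rotation_matrix_def orthogonal_matrix_mul det_mul det_transpose)
  have inj: "inj ?T"
  proof (rule inj_onI)
    fix x y assume "?T x = ?T y"
    then have "Q *v x = Q *v y" using c by simp
    then show "x = y" by (metis QQ(1) matrix_vector_mul_assoc matrix_vector_mul_lid)
  qed
  have comm: "(Q ** B ** transpose Q) *v ?T x = ?T (B *v x)" for B x
  proof -
    have "(Q ** B ** transpose Q) *v (Q *v x) = (Q ** B ** (transpose Q ** Q)) *v x"
      by (simp only: matrix_vector_mul_assoc matrix_mul_assoc)
    then show ?thesis by (simp add: QQ matrix_vector_mult_scaleR flip: matrix_vector_mul_assoc)
  qed
  have img: "(\<lambda>x. (Q ** B ** transpose Q) *v x) ` ?T ` S = ?T ` S \<longleftrightarrow> (\<lambda>x. B *v x) ` S = S" for B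
  proof -
    have "(\<lambda>x. (Q ** B ** transpose Q) *v x) ` ?T ` S = ?T ` (\<lambda>x. B *v x) ` S"
      unfolding image_image by (simp only: comm)
    then show ?thesis using inj_image_eq_iff[OF inj] by simp
  qed
  show ?thesis
  proof
    show "rotational_symmetries (?T ` S) \<subseteq> (\<lambda>B. Q ** B ** transpose Q) ` rotational_symmetries S"
    proof
      fix A assume A: "A \<in> rotational_symmetries (?T ` S)"
      have "transpose Q ** A ** Q \<in> rotational_symmetries S"
        using A rot'[of A] img[of "transpose Q ** A ** Q"] by (simp add: rotational_symmetries_def cancel)
      then show "A \<in> (\<lambda>B. Q ** B ** transpose Q) ` rotational_symmetries S"
        by (rule rev_image_eqI) (simp add: cancel)
    qed
    show "(\<lambda>B. Q ** B ** transpose Q) ` rotational_symmetries S \<subseteq> rotational_symmetries (?T ` S)"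
    proof
      fix A assume "A \<in> (\<lambda>B. Q ** B ** transpose Q) ` rotational_symmetries S"
      then obtain B where B: "B \<in> rotational_symmetries S" and A: "A = Q ** B ** transpose Q" by blast
      show "A \<in> rotational_symmetries (?T ` S)"
        using B rot[of B] img[of B] unfolding rotational_symmetries_def A mem_Collect_eq by blast
    qed
  qed
qed

lemma rotational_symmetries_mult:
  assumes "A \<in> rotational_symmetries S" "B \<in> rotational_symmetries S"
  shows "A ** B \<in> rotational_symmetries S"
proof -
  have "(\<lambda>x. (A ** B) *v x) ` S = (\<lambda>x. A *v x) ` (\<lambda>x. B *v x) ` S"
    unfolding image_image by (simp only: matrix_vector_mul_assoc)
  then show ?thesis
    using assms by (simp add: rotational_symmetries_def rotation_matrix_def orthogonal_matrix_mul det_mul)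
qed

lemma rotational_symmetries_one: "mat 1 \<in> rotational_symmetries S"
  by (simp add: rotational_symmetries_def rotation_matrix_def orthogonal_matrix_id)

lemma rotational_symmetries_orthogonal: "A \<in> rotational_symmetries S \<Longrightarrow> orthogonal_matrix A"
  by (simp add: rotational_symmetries_def rotation_matrix_def)

section \<open>The tetrahedral group\<close>

definition tetrahedron_vertices :: "(real^3) set" where
  "tetrahedron_vertices = {vector [1, 1, 1], vector [1, -1, -1], vector [-1, 1, -1], vector [-1, -1, 1]}"

lemma tetrahedron_vertexD:
  assumes "vector [x, y, z] \<in> tetrahedron_vertices"
  shows "x = 1 \<or> x = -1" "y = 1 \<or> y = -1" "z = 1 \<or> z = -1" "x * y * z = 1"
  using assms by (auto simp: tetrahedron_vertices_def vector3_eq_iff)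

text \<open>The four expressions add up to zero, so two of them are \<open>1\<close> and two are \<open>-1\<close>.\<close>

lemma tetrahedron_row:
  fixes a b c :: real
  assumes "a + b + c = 1 \<or> a + b + c = -1" "a - b - c = 1 \<or> a - b - c = -1"
    "- a + b - c = 1 \<or> - a + b - c = -1" "- a - b + c = 1 \<or> - a - b + c = -1"
  shows "(b = 0 \<and> c = 0) \<or> (a = 0 \<and> c = 0) \<or> (a = 0 \<and> b = 0)"
  using assms by argo

text \<open>Each row is a signed unit vector. The images of the vertices force the product of the signs to be \<open>1\<close>,
  so that the determinant is the sign of the underlying permutation, which is therefore even.\<close>

lemma tetrahedral_rotation_shape:
  assumes A: "mat3 a b c d e f g h i \<in> rotational_symmetries std_tetrahedron"
  shows "(b = 0 \<and> c = 0 \<and> d = 0 \<and> f = 0 \<and> g = 0 \<and> h = 0 \<and> a * a = 1 \<and> e * e = 1 \<and> i * i = 1) \<or>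
    (a = 0 \<and> c = 0 \<and> d = 0 \<and> e = 0 \<and> h = 0 \<and> i = 0 \<and> b * b = 1 \<and> f * f = 1 \<and> g * g = 1) \<or>
    (a = 0 \<and> b = 0 \<and> e = 0 \<and> f = 0 \<and> g = 0 \<and> i = 0 \<and> c * c = 1 \<and> d * d = 1 \<and> h * h = 1)"
proof -
  have norm: "norm v = sqrt 3" if "v \<in> tetrahedron_vertices" for v
    using that by (auto simp: tetrahedron_vertices_def norm_vector3)
  have A': "mat3 a b c d e f g h i \<in> rotational_symmetries (convex hull tetrahedron_vertices)"
    using A by (simp add: std_tetrahedron_def tetrahedron_vertices_def)
  have V: "mat3 a b c d e f g h i *v v \<in> tetrahedron_vertices" if "v \<in> tetrahedron_vertices" for v
    using rotational_symmetry_vertices[OF norm A' that] .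
  have "vector [a + b + c, d + e + f, g + h + i] \<in> tetrahedron_vertices"
    "vector [a - b - c, d - e - f, g - h - i] \<in> tetrahedron_vertices"
    "vector [- a + b - c, - d + e - f, - g + h - i] \<in> tetrahedron_vertices"
    "vector [- a - b + c, - d - e + f, - g - h + i] \<in> tetrahedron_vertices"
    using V[of "vector [1, 1, 1]"] V[of "vector [1, -1, -1]"] V[of "vector [-1, 1, -1]"] V[of "vector [-1, -1, 1]"]
    by (simp_all add: mat3_mult_vector tetrahedron_vertices_def)
  note D = this[THEN tetrahedron_vertexD(1)] this[THEN tetrahedron_vertexD(2)] this[THEN tetrahedron_vertexD(3)]
    tetrahedron_vertexD(4)[OF this(1)]
  have det: "a * e * i + b * f * g + c * d * h - a * f * h - b * d * i - c * e * g = 1"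
    using A by (simp add: rotational_symmetries_def rotation_mat3_iff)
  have rows: "(b = 0 \<and> c = 0) \<or> (a = 0 \<and> c = 0) \<or> (a = 0 \<and> b = 0)"
    "(e = 0 \<and> f = 0) \<or> (d = 0 \<and> f = 0) \<or> (d = 0 \<and> e = 0)"
    "(h = 0 \<and> i = 0) \<or> (g = 0 \<and> i = 0) \<or> (g = 0 \<and> h = 0)"
    by (rule tetrahedron_row[OF D(1-4)], rule tetrahedron_row[OF D(5-8)], rule tetrahedron_row[OF D(9-12)])
  have sq: "(a + b + c) * (a + b + c) = 1" "(d + e + f) * (d + e + f) = 1" "(g + h + i) * (g + h + i) = 1"
    using D(1,5,9) by auto
  have prod: "(a + b + c) * (d + e + f) * (g + h + i) = 1" by (rule D(13))
  show ?thesis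
    using rows sq prod det by (elim disjE conjE) (simp_all add: mult_ac)
qed

definition third_root :: complex where
  "third_root = Complex (- 1 / 2) (sqrt 3 / 2)"

lemma third_root_cube: "third_root * third_root * third_root = 1"
  by (simp add: third_root_def complex_eq_iff)

text \<open>A semi-invariant of the tetrahedral group whose character has non-real values.\<close>

definition tetrahedral_form :: "real^3 \<Rightarrow> complex" where
  "tetrahedral_form x = of_real (x $ 1 * x $ 1) + third_root * of_real (x $ 2 * x $ 2)
     + third_root * third_root * of_real (x $ 3 * x $ 3)"

lemma mat3_mult_vec_nth:
  "(mat3 a b c d e f g h i *v x) $ 1 = a * x $ 1 + b * x $ 2 + c * x $ 3"
  "(mat3 a b c d e f g h i *v x) $ 2 = d * x $ 1 + e * x $ 2 + f * x $ 3"
  "(mat3 a b c d e f g h i *v x) $ 3 = g * x $ 1 + h * x $ 2 + i * x $ 3"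
  by (simp_all add: matrix_vector_mult_def sum_3)

lemma tetrahedral_form_cyc3:
  "tetrahedral_form (transpose cyc3 *v x) = third_root * third_root * tetrahedral_form x"
proof -
  have w: "third_root * (third_root * (third_root * y)) = y" for y
    using third_root_cube by (simp flip: mult.assoc)
  show ?thesis
    by (simp add: tetrahedral_form_def cyc3_def mat3_transpose mat3_mult_vec_nth algebra_simps w del: transpose_matrix_vector)
qed

lemma tetrahedral_form_eigen:
  assumes A: "A \<in> rotational_symmetries std_tetrahedron"
  shows "\<exists>c. \<forall>x. tetrahedral_form (transpose A *v x) = c * tetrahedral_form x"
proof -
  obtain a b c d e f g h i where Am: "A = mat3 a b c d e f g h i" using mat3_eq by blast
  have w: "third_root * (third_root * (third_root * y)) = y" for y
    using third_root_cube by (simp flip: mult.assoc)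
  have csq: "complex_of_real r * (complex_of_real r * y) = y" if "r * r = 1" for r y
    using that by (simp flip: mult.assoc of_real_mult)
  note s = tetrahedral_form_def Am mat3_transpose mat3_mult_vec_nth
  from tetrahedral_rotation_shape[OF A[unfolded Am]] show ?thesis
  proof (elim disjE conjE)
    assume "b = 0" "c = 0" "d = 0" "f = 0" "g = 0" "h = 0" "a * a = 1" "e * e = 1" "i * i = 1"
    then show ?thesis
      by (intro exI[of _ 1]) (simp add: s csq algebra_simps w del: transpose_matrix_vector)
  next
    assume "a = 0" "c = 0" "d = 0" "e = 0" "h = 0" "i = 0" "b * b = 1" "f * f = 1" "g * g = 1"
    then show ?thesis
      by (intro exI[of _ third_root]) (simp add: s csq algebra_simps w del: transpose_matrix_vector)
  next
    assume "a = 0" "b = 0" "e = 0" "f = 0" "g = 0" "i = 0" "c * c = 1" "d * d = 1" "h * h = 1"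
    then show ?thesis
      by (intro exI[of _ "third_root * third_root"]) (simp add: s csq algebra_simps w del: transpose_matrix_vector)
  qed
qed

lemma cyc3_tetrahedral: "cyc3 \<in> rotational_symmetries std_tetrahedron"
proof -
  have "cyc3 \<in> rotational_symmetries (convex hull tetrahedron_vertices)"
    by (rule rotational_symmetryI[OF _ _ cyc3_rotation])
       (auto simp: tetrahedron_vertices_def cyc3_def mat3_mult_vector)
  then show ?thesis by (simp add: std_tetrahedron_def tetrahedron_vertices_def)
qed

lemma tetrahedral_group_character:
  assumes G: "tetrahedral_group G"
  obtains f :: "real^3 \<Rightarrow> complex" and ch :: "real^3^3 \<Rightarrow> complex" and x0 g0
  where "continuous_on UNIV f" "norm x0 = 1" "f x0 \<noteq> 0" "g0 \<in> G" "ch g0 \<notin> \<real>"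
    "\<And>g x. g \<in> G \<Longrightarrow> f (transpose g *v x) = ch g * f x"
proof -
  obtain S where "similar_about_origin std_tetrahedron S" and G': "G = rotational_symmetries S"
    using G by (auto simp: tetrahedral_group_def)
  then obtain c Q where c: "c > 0" and Q: "orthogonal_matrix Q" and S: "S = (\<lambda>x. c *\<^sub>R (Q *v x)) ` std_tetrahedron"
    by (auto simp: similar_about_origin_def)
  have Geq: "G = (\<lambda>B. Q ** B ** transpose Q) ` rotational_symmetries std_tetrahedron"
    unfolding G' S by (rule rotational_symmetries_similar[OF Q c])
  define f where "f x = tetrahedral_form (transpose Q *v x)" for x
  have QQ: "transpose Q *v (Q *v x) = x" for x
    using orthogonal_matrix_mul_transpose(2)[OF Q] .
  have fB: "f (transpose (Q ** B ** transpose Q) *v x) = tetrahedral_form (transpose B *v (transpose Q *v x))" for B x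
  proof -
    have "transpose Q *v (transpose (Q ** B ** transpose Q) *v x)
        = transpose Q *v (Q *v (transpose B *v (transpose Q *v x)))"
      by (simp only: matrix_transpose_mul Finite_Cartesian_Product.transpose_transpose matrix_vector_mul_assoc matrix_mul_assoc)
    then show ?thesis unfolding f_def QQ by (rule arg_cong)
  qed
  have "\<exists>c. \<forall>x. f (transpose g *v x) = c * f x" if "g \<in> G" for g
  proof -
    obtain B where B: "B \<in> rotational_symmetries std_tetrahedron" "g = Q ** B ** transpose Q"
      using \<open>g \<in> G\<close> unfolding Geq by blast
    then show ?thesis
      using tetrahedral_form_eigen[OF B(1)] unfolding B(2) fB by (auto simp: f_def)
  qed
  then obtain ch where ch: "\<And>g x. g \<in> G \<Longrightarrow> f (transpose g *v x) = ch g * f x" by metis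
  define x0 where "x0 = Q *v vector [1, 0, 0]"
  have x0: "norm x0 = 1"
    unfolding x0_def by (simp add: orthogonal_matrix_norm[OF Q] norm_vector3)
  have fx0: "f x0 = 1"
    unfolding f_def x0_def QQ by (simp add: tetrahedral_form_def)
  define g0 where "g0 = Q ** cyc3 ** transpose Q"
  have g0: "g0 \<in> G" unfolding g0_def Geq using cyc3_tetrahedral by blast
  have "ch g0 * f x0 = third_root * third_root * f x0"
    using ch[OF g0, of x0] unfolding g0_def fB tetrahedral_form_cyc3 by (auto simp: f_def)
  then have "ch g0 = third_root * third_root" using fx0 by simp
  then have "ch g0 \<notin> \<real>"
    by (simp add: third_root_def complex_is_Real_iff)
  moreover have "continuous_on UNIV f"
    unfolding f_def tetrahedral_form_def
    by (intro continuous_intros matrix_vector_mult_linear_continuous_on)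
  ultimately show ?thesis
    using that[of f x0 g0 ch] x0 fx0 g0 ch by simp
qed

lemma mean_square_orthogonal:
  assumes f: "f \<in> sphere_L2" and s: "s \<in> sphere_L2" and 0: "sphere_inner f s = 0"
  shows "mean_square f \<le> mean_square (\<lambda>x. f x - s x)"
proof -
  define h where "h x = Re (cnj (f x) * s x)" for x
  have h: "integrable sphere_measure h" "(LINT x|sphere_measure. h x) = 0"
    using integrable_Re[OF integrable_sphere_product[OF f s]] integral_Re[OF integrable_sphere_product[OF f s]] 0
    unfolding h_def sphere_inner_def by simp_all
  have "(cmod (a - b))\<^sup>2 = (cmod a)\<^sup>2 + (cmod b)\<^sup>2 - 2 * Re (cnj a * b)" for a b :: complex
    unfolding cmod_power2 by (simp add: power2_eq_square algebra_simps)
  then have "mean_square (\<lambda>x. f x - s x)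
      = (LINT x|sphere_measure. (cmod (f x))\<^sup>2 + (cmod (s x))\<^sup>2 - 2 * h x)"
    unfolding mean_square_def h_def by presburger
  also have "\<dots> = mean_square f + mean_square s"
    using sphere_L2D(2)[OF f] sphere_L2D(2)[OF s] h by (simp add: mean_square_def)
  finally show ?thesis using mean_square_nonneg[of s] by simp
qed

lemma sphere_inner_sum:
  assumes f: "f \<in> sphere_L2" and e: "\<And>k. k \<in> S \<Longrightarrow> e k \<in> sphere_L2"
  shows "sphere_inner f (\<lambda>x. \<Sum>k\<in>S. c k * e k x) = (\<Sum>k\<in>S. c k * sphere_inner f (e k))"
proof -
  have "sphere_inner f (\<lambda>x. \<Sum>k\<in>S. c k * e k x) = (LINT x|sphere_measure. (\<Sum>k\<in>S. c k * (cnj (f x) * e k x)))"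
    by (simp add: sphere_inner_def sum_distrib_left mult_ac)
  also have "\<dots> = (\<Sum>k\<in>S. LINT x|sphere_measure. c k * (cnj (f x) * e k x))"
    by (rule Bochner_Integration.integral_sum)
       (use integrable_sphere_product[OF f e] in \<open>auto intro: integrable_mult_right\<close>)
  also have "\<dots> = (\<Sum>k\<in>S. c k * sphere_inner f (e k))"
    by (simp add: sphere_inner_def)
  finally show ?thesis .
qed

text \<open>Let \<open>w\<close> be the vector of inner products of \<open>f\<close> with the components of a basis function. Rotation
  invariance of the measure makes \<open>w\<close> a left eigenvector of the representation, so its annihilator is
  an invariant subspace. By irreducibility, either \<open>w = 0\<close> or the representation is the character.\<close>

theorem no_real_basis_if_nonreal_character:
  fixes f :: "real^3 \<Rightarrow> complex"
  assumes G: "mat 1 \<in> G" "\<And>g h. g \<in> G \<Longrightarrow> h \<in> G \<Longrightarrow> g ** h \<in> G"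
      "\<And>g. g \<in> G \<Longrightarrow> orthogonal_matrix g"
    and f: "continuous_on UNIV f" "norm x0 = 1" "f x0 \<noteq> 0"
    and g0: "g0 \<in> G" "ch g0 \<notin> \<real>"
    and ch: "\<And>g x. g \<in> G \<Longrightarrow> f (transpose g *v x) = ch g * f x"
    and \<Gamma>: "unitary_irreps G N d \<Gamma>" and F: "complete_basis_family G N d \<Gamma> F"
    and real: "\<And>p I. p < N \<Longrightarrow> I \<in> F p \<Longrightarrow> real_on_sphere I"
  shows False
proof -
  have ch1: "ch (mat 1) = 1"
  proof -
    have "ch (mat 1) * f x0 = 1 * f x0"
      using ch[OF G(1), of x0] by simp
    then show ?thesis using f(3) by simp
  qed
  have chm: "ch (g ** h) = ch g * ch h" if "g \<in> G" "h \<in> G" for g h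
  proof -
    have "ch (g ** h) * f x0 = f (transpose h *v (transpose g *v x0))"
      unfolding ch[OF G(2)[OF that], symmetric]
      by (simp only: matrix_transpose_mul matrix_vector_mul_assoc)
    also have "\<dots> = ch h * (ch g * f x0)" by (simp only: ch that)
    finally show ?thesis using f(3) by (simp add: mult_ac)
  qed
  have fL: "f \<in> sphere_L2" by (rule sphere_L2_continuous[OF f(1)])
  have fpos: "mean_square f > 0"
    unfolding mean_square_def by (rule sphere_norm_pos[OF f])
  have chunit: "cnj (ch g) * ch g = 1" if g: "g \<in> G" for g
  proof -
    have "mean_square f = mean_square (\<lambda>x. f (transpose g *v x))"
      unfolding mean_square_def
      by (rule integral_sphere_measure_rotation[symmetric, where f = "\<lambda>x. (cmod (f x))\<^sup>2"])
         (use G(3)[OF g] f(1) in \<open>auto intro!: continuous_borel_measurable_sphere_measure continuous_intros\<close>)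
    also have "\<dots> = (cmod (ch g))\<^sup>2 * mean_square f"
      unfolding ch[OF g] by (rule mean_square_scale)
    finally have "(cmod (ch g))\<^sup>2 = 1" using fpos by simp
    then show ?thesis by (metis complex_norm_square mult.commute of_real_1)
  qed
  define \<Gamma>ch where "\<Gamma>ch g = Matrix.mat 1 1 (\<lambda>_. ch g)" for g
  have "irreducible_representation G 1 \<Gamma>ch"
    unfolding irreducible_representation_def matrix_representation_def
  proof (intro conjI ballI allI impI)
    show "\<Gamma>ch (mat 1) = 1\<^sub>m 1"
      by (intro eq_matI) (auto simp: \<Gamma>ch_def ch1)
    show "\<Gamma>ch (g ** h) = \<Gamma>ch g * \<Gamma>ch h" if "g \<in> G" "h \<in> G" for g h
      by (intro eq_matI) (auto simp: \<Gamma>ch_def chm[OF that] scalar_prod_def)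
    fix W assume W: "VectorSpace.subspace class_ring W (module_vec TYPE(complex) 1) \<and> (\<forall>g\<in>G. \<forall>w\<in>W. \<Gamma>ch g *\<^sub>v w \<in> W)"
    then have Wc: "W \<subseteq> carrier_vec 1" "0\<^sub>v 1 \<in> W" and sm: "\<And>c v. v \<in> W \<Longrightarrow> c \<cdot>\<^sub>v v \<in> W"
      by (auto simp: subspace_module_vec_iff)
    have "carrier_vec 1 \<subseteq> W" if "w \<in> W" "w \<noteq> 0\<^sub>v 1" for w
    proof
      fix z :: "complex Matrix.vec" assume z: "z \<in> carrier_vec 1"
      have w1: "w \<in> carrier_vec 1" using that Wc by blast
      have "vec_index w 0 \<noteq> 0"
        using that(2) w1 by (metis carrier_vecD eq_vecI index_zero_vec less_one)
      then have "z = (vec_index z 0 / vec_index w 0) \<cdot>\<^sub>v w"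
        using z w1 by (intro eq_vecI) auto
      then show "z \<in> W" using sm[OF that(1)] by metis
    qed
    then show "W = {0\<^sub>v 1} \<or> W = carrier_vec 1" using Wc by blast
  qed (simp_all add: \<Gamma>ch_def)
  then obtain p where p: "p < N" and eqv: "equivalent_representations G (d p) (\<Gamma> p) 1 \<Gamma>ch"
    using \<Gamma> unfolding unitary_irreps_def by blast
  obtain T where dp: "d p = 1" and T: "T \<in> carrier_mat 1 1" and inv: "invertible_mat T"
    and int: "\<And>g. g \<in> G \<Longrightarrow> T * \<Gamma> p g = \<Gamma>ch g * T"
    using eqv by (auto simp: equivalent_representations_def)
  have rep: "\<Gamma> q g \<in> carrier_mat (d q) (d q)" if "q < N" "g \<in> G" for q g
    using \<Gamma> that by (auto simp: unitary_irreps_def irreducible_representation_def matrix_representation_def)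
  have T0: "T $$ (0, 0) \<noteq> 0"
  proof
    assume z: "T $$ (0, 0) = 0"
    obtain B where B: "inverts_mat T B" "inverts_mat B T" using inv by (auto simp: invertible_mat_def)
    then have "T * B = 1\<^sub>m 1" using T by (simp add: inverts_mat_def)
    moreover have Bc: "B \<in> carrier_mat 1 1"
      using B T unfolding inverts_mat_def
      by (metis carrier_matD carrier_matI index_mult_mat(2,3) index_one_mat(2,3))
    ultimately have "(T * B) $$ (0, 0) = 1" by simp
    then show False using T Bc z by (simp add: mult_mat_index[OF T Bc] del: index_mult_mat(1))
  qed
  have \<Gamma>p: "\<Gamma> p g = \<Gamma>ch g" if g: "g \<in> G" for g
  proof (rule eq_matI)
    have c: "\<Gamma> p g \<in> carrier_mat 1 1" "\<Gamma>ch g \<in> carrier_mat 1 1"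
      using rep[OF p g] by (simp_all add: dp \<Gamma>ch_def)
    have "T $$ (0, 0) * \<Gamma> p g $$ (0, 0) = \<Gamma>ch g $$ (0, 0) * T $$ (0, 0)"
      using arg_cong[OF int[OF g], of "\<lambda>M. M $$ (0, 0)"]
      by (simp add: mult_mat_index[OF T c(1)] mult_mat_index[OF c(2) T] del: index_mult_mat(1))
    then have "\<Gamma> p g $$ (0, 0) = \<Gamma>ch g $$ (0, 0)" using T0 by simp
    then show "\<Gamma> p g $$ (i, j) = \<Gamma>ch g $$ (i, j)" if "i < dim_row (\<Gamma>ch g)" "j < dim_col (\<Gamma>ch g)" for i j
      using that c by simp
  qed (use rep[OF p g] in \<open>simp_all add: dp \<Gamma>ch_def\<close>)
  have bf: "basis_function G (d q) (\<Gamma> q) I" if "q < N" "I \<in> F q" for q I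
    using F that by (auto simp: complete_basis_family_def)
  have Fp: "F p = {}"
  proof (rule ccontr)
    assume "F p \<noteq> {}"
    then obtain I where I: "I \<in> F p" by blast
    note b = bf[OF p I, unfolded basis_function_def dp]
    have zero: "vec_index (I x) 0 = 0" if x: "x \<in> sphere 0 1" for x
    proof -
      let ?y = "matrix_inv g0 *v x"
      have y: "?y \<in> sphere 0 1"
        using x orthogonal_matrix_norm[of "transpose g0" x] G(3)[OF g0(1)]
        by (simp add: matrix_inv_orthogonal del: transpose_matrix_vector)
      have c: "I x \<in> carrier_vec 1" "I ?y \<in> carrier_vec 1" using b x y by auto
      have "vec_index (I ?y) 0 = vec_index (transpose_mat (\<Gamma> p g0) *\<^sub>v I x) 0"
        using b x g0(1) by simp
      also have "\<dots> = ch g0 * vec_index (I x) 0"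
        unfolding \<Gamma>p[OF g0(1)] using c by (simp add: \<Gamma>ch_def scalar_prod_def)
      finally have eq: "vec_index (I ?y) 0 = ch g0 * vec_index (I x) 0" .
      have "vec_index (I x) 0 \<in> \<real>" "vec_index (I ?y) 0 \<in> \<real>"
        using real[OF p I] x y c by (auto simp: real_on_sphere_def)
      then show ?thesis
        using eq g0(2) by (metis Reals_divide nonzero_eq_divide_eq)
    qed
    have "sphere_inner (\<lambda>x. vec_index (I x) 0) (\<lambda>x. vec_index (I x) 0) = 1"
      using b by (auto simp: orthonormal_system_def)
    moreover have "sphere_inner (\<lambda>x. vec_index (I x) 0) (\<lambda>x. vec_index (I x) 0) = (LINT x|sphere_measure. 0)"
      unfolding sphere_inner_def
      by (rule Bochner_Integration.integral_cong) (auto simp: space_sphere_measure zero)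
    ultimately show False by simp
  qed
  have orth: "sphere_inner f (\<lambda>x. vec_index (I x) j) = 0" if q: "q < N" and I: "I \<in> F q" and j: "j < d q" for q I j
  proof -
    have qp: "q \<noteq> p" using Fp I by auto
    note b = bf[OF q I, unfolded basis_function_def]
    have IL: "(\<lambda>x. vec_index (I x) j) \<in> sphere_L2" if "j < d q" for j
      using b that by (auto simp: orthonormal_system_def)
    define w where "w j = sphere_inner f (\<lambda>x. vec_index (I x) j)" for j
    have eig: "(\<Sum>l<d q. w l * \<Gamma> q g $$ (l, j)) = ch g * w j" if g: "g \<in> G" and j: "j < d q" for g j
    proof -
      have "w j = (LINT x|sphere_measure. cnj (f (transpose g *v x)) * vec_index (I (transpose g *v x)) j)"
        unfolding w_def sphere_inner_def
        by (rule integral_sphere_measure_rotation[symmetric, where f = "\<lambda>x. cnj (f x) * vec_index (I x) j"])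
           (use G(3)[OF g] borel_measurable_integrable[OF integrable_sphere_product[OF fL IL[OF j]]] in auto)
      also have "\<dots> = (LINT x|sphere_measure. (\<Sum>l<d q. (cnj (ch g) * \<Gamma> q g $$ (l, j)) * (cnj (f x) * vec_index (I x) l)))"
      proof (rule Bochner_Integration.integral_cong[OF refl])
        fix x assume "x \<in> space sphere_measure"
        then have x: "x \<in> sphere 0 1" by (simp add: space_sphere_measure)
        have Ix: "I x \<in> carrier_vec (d q)" using b x by blast
        have "I (transpose g *v x) = transpose_mat (\<Gamma> q g) *\<^sub>v I x"
          using b x g unfolding matrix_inv_orthogonal[OF G(3)[OF g], symmetric] by blast
        then have "vec_index (I (transpose g *v x)) j = (\<Sum>l<d q. \<Gamma> q g $$ (l, j) * vec_index (I x) l)"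
          using rep[OF q g] Ix j by (simp add: scalar_prod_def lessThan_atLeast0)
        then show "cnj (f (transpose g *v x)) * vec_index (I (transpose g *v x)) j
            = (\<Sum>l<d q. (cnj (ch g) * \<Gamma> q g $$ (l, j)) * (cnj (f x) * vec_index (I x) l))"
          unfolding ch[OF g] by (simp add: sum_distrib_left mult_ac)
      qed
      also have "\<dots> = (\<Sum>l<d q. LINT x|sphere_measure. (cnj (ch g) * \<Gamma> q g $$ (l, j)) * (cnj (f x) * vec_index (I x) l))"
        by (rule Bochner_Integration.integral_sum)
           (use integrable_sphere_product[OF fL IL] in \<open>auto intro: integrable_mult_right\<close>)
      also have "\<dots> = cnj (ch g) * (\<Sum>l<d q. w l * \<Gamma> q g $$ (l, j))"
        unfolding w_def sphere_inner_def integral_mult_right_zero sum_distrib_left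
        by (intro sum.cong refl) (simp only: mult_ac)
      finally have "ch g * w j = (cnj (ch g) * ch g) * (\<Sum>l<d q. w l * \<Gamma> q g $$ (l, j))"
        by (simp add: mult_ac)
      then show ?thesis by (simp add: chunit[OF g])
    qed
    let ?W = "{u \<in> carrier_vec (d q). (\<Sum>l<d q. w l * vec_index u l) = 0}"
    have irr: "irreducible_representation G (d q) (\<Gamma> q)"
      using \<Gamma> q by (simp add: unitary_irreps_def)
    have subW: "VectorSpace.subspace class_ring ?W (module_vec TYPE(complex) (d q))"
      unfolding subspace_module_vec_iff
      by (auto simp: algebra_simps sum.distrib simp flip: sum_distrib_left)
    have invW: "\<Gamma> q g *\<^sub>v u \<in> ?W" if g: "g \<in> G" and u: "u \<in> ?W" for g u
    proof -
      have uc: "u \<in> carrier_vec (d q)" using u by blast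
      have "(\<Sum>l<d q. w l * vec_index (\<Gamma> q g *\<^sub>v u) l) = (\<Sum>l<d q. \<Sum>j<d q. w l * \<Gamma> q g $$ (l, j) * vec_index u j)"
        by (intro sum.cong refl) (simp add: mult_mat_vec_index[OF rep[OF q g] uc] sum_distrib_left mult.assoc del: index_mult_mat_vec)
      also have "\<dots> = (\<Sum>j<d q. (\<Sum>l<d q. w l * \<Gamma> q g $$ (l, j)) * vec_index u j)"
        by (subst sum.swap) (simp add: sum_distrib_right)
      also have "\<dots> = ch g * (\<Sum>j<d q. w j * vec_index u j)"
        by (simp add: eig[OF g] sum_distrib_left mult.assoc)
      also have "\<dots> = 0" using u by simp
      finally show ?thesis using rep[OF q g] uc by simp
    qed
    have min: "?W = {0\<^sub>v (d q)} \<or> ?W = carrier_vec (d q)"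
      using irr subW invW unfolding irreducible_representation_def by blast
    have unitW: "(\<Sum>l<d q. w l * vec_index (unit_vec (d q) j) l) = w j" if "j < d q" for j
      using that by (simp add: unit_vec_def if_distrib cong: if_cong)
    show ?thesis
    proof (cases "?W = carrier_vec (d q)")
      case True
      have "unit_vec (d q) j \<in> ?W" unfolding True by simp
      then have "w j = 0" using unitW[OF j] by simp
      then show ?thesis by (simp add: w_def)
    next
      case False
      then have W0: "?W = {0\<^sub>v (d q)}" using min by blast
      have wnz: "w j \<noteq> 0" if "j < d q" for j
      proof
        assume "w j = 0"
        then have "unit_vec (d q) j \<in> ?W" using unitW[OF that] by simp
        then have "unit_vec (d q) j = (0\<^sub>v (d q) :: complex Matrix.vec)" unfolding W0 by simp
        then have "vec_index (unit_vec (d q) j) j = (0 :: complex)" using that by simp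
        then show False using that by simp
      qed
      have d1: "d q = 1"
      proof (rule ccontr)
        assume "d q \<noteq> 1"
        then have d2: "0 < d q" "1 < d q" using j by auto
        let ?u = "w 1 \<cdot>\<^sub>v unit_vec (d q) 0 + (- w 0) \<cdot>\<^sub>v unit_vec (d q) 1"
        have "(\<Sum>l<d q. w l * vec_index ?u l) = w 1 * (\<Sum>l<d q. w l * vec_index (unit_vec (d q) 0) l)
            + (- w 0) * (\<Sum>l<d q. w l * vec_index (unit_vec (d q) 1) l)"
          unfolding sum_distrib_left sum.distrib[symmetric]
          by (intro sum.cong refl) (simp add: algebra_simps del: index_unit_vec(1,2))
        also have "\<dots> = 0" using unitW[OF d2(1)] unitW[OF d2(2)] by simp
        finally have "?u \<in> ?W" by simp
        then have "?u = 0\<^sub>v (d q)" unfolding W0 by simp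
        then have "vec_index ?u 0 = 0" using d2 by simp
        then show False using d2 wnz[OF d2(2)] by simp
      qed
      have qp_eq: "\<Gamma> q g = \<Gamma> p g" if g: "g \<in> G" for g
      proof (rule eq_matI)
        have c: "\<Gamma> p g \<in> carrier_mat 1 1" "\<Gamma> q g \<in> carrier_mat 1 1"
          using rep[OF p g] rep[OF q g] by (simp_all add: dp d1)
        have "w 0 * \<Gamma> q g $$ (0, 0) = ch g * w 0" using eig[OF g, of 0] d1 by simp
        then have "\<Gamma> q g $$ (0, 0) = ch g" using wnz[of 0] d1 by simp
        then show "\<Gamma> q g $$ (i, j) = \<Gamma> p g $$ (i, j)" if "i < dim_row (\<Gamma> p g)" "j < dim_col (\<Gamma> p g)" for i j
          using that c \<Gamma>p[OF g] by (simp add: \<Gamma>ch_def)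
      qed (use rep[OF p g] rep[OF q g] in \<open>simp_all add: dp d1\<close>)
      have "1\<^sub>m 1 * \<Gamma> q g = \<Gamma> p g * 1\<^sub>m 1" if g: "g \<in> G" for g
      proof -
        have "\<Gamma> p g \<in> carrier_mat 1 1" using rep[OF p g] by (simp only: dp)
        then show ?thesis
          by (simp only: qp_eq[OF g] left_mult_one_mat right_mult_one_mat)
      qed
      moreover have "invertible_mat (1\<^sub>m 1 :: complex mat)"
        by (auto simp: invertible_mat_def inverts_mat_def intro!: exI[of _ "1\<^sub>m 1"])
      moreover have "1\<^sub>m 1 \<in> carrier_mat 1 (1 :: nat)" by simp
      ultimately have "equivalent_representations G (d q) (\<Gamma> q) (d p) (\<Gamma> p)"
        unfolding equivalent_representations_def d1 dp by blast
      then show ?thesis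
        using \<Gamma> p q qp unfolding unitary_irreps_def by blast
    qed
  qed
  define K where "K = {(p, I, j). p < N \<and> I \<in> F p \<and> j < d p}"
  define e where "e = (\<lambda>(p :: nat, I :: real^3 \<Rightarrow> complex Matrix.vec, j) x. vec_index (I x) j)"
  have comp: "complete_orthonormal_system K e"
    using F by (simp add: complete_basis_family_def K_def e_def)
  have eL: "e k \<in> sphere_L2" if "k \<in> K" for k
    using comp that by (simp add: complete_orthonormal_system_def orthonormal_system_def)
  have fe: "sphere_inner f (e k) = 0" if "k \<in> K" for k
    using that orth by (auto simp: K_def e_def)
  obtain S c where S: "finite S" "S \<subseteq> K" and lt: "mean_square (\<lambda>x. f x - (\<Sum>k\<in>S. c k * e k x)) < mean_square f"
    using comp fL fpos unfolding complete_orthonormal_system_def mean_square_def by blast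
  have "mean_square f \<le> mean_square (\<lambda>x. f x - (\<Sum>k\<in>S. c k * e k x))"
  proof (rule mean_square_orthogonal[OF fL])
    show "(\<lambda>x. \<Sum>k\<in>S. c k * e k x) \<in> sphere_L2"
      by (intro sphere_L2_sum sphere_L2_scale eL) (use S in auto)
    show "sphere_inner f (\<lambda>x. \<Sum>k\<in>S. c k * e k x) = 0"
      using S fe by (subst sphere_inner_sum[OF fL eL]) (auto intro!: sum.neutral)
  qed
  then show False using lt by simp
qed

theorem tetrahedral_no_real_basis:
  assumes G: "tetrahedral_group G"
    and "unitary_irreps G N d \<Gamma>" "complete_basis_family G N d \<Gamma> F"
  shows "\<not> (\<forall>p<N. \<forall>I\<in>F p. real_on_sphere I)"
proof
  assume real: "\<forall>p<N. \<forall>I\<in>F p. real_on_sphere I"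
  obtain S where S: "G = rotational_symmetries S" using G by (auto simp: tetrahedral_group_def)
  show False
  proof (rule tetrahedral_group_character[OF G])
    fix f :: "real^3 \<Rightarrow> complex" and ch x0 g0
    assume f: "continuous_on UNIV f" "norm x0 = 1" "f x0 \<noteq> 0" "g0 \<in> G" "ch g0 \<notin> \<real>"
      "\<And>g x. g \<in> G \<Longrightarrow> f (transpose g *v x) = ch g * f x"
    show False
  proof (rule no_real_basis_if_nonreal_character[OF _ _ _ f assms(2,3)])
    show "mat 1 \<in> G" by (simp add: S rotational_symmetries_one)
    show "g ** h \<in> G" if "g \<in> G" "h \<in> G" for g h
      using that by (simp add: S rotational_symmetries_mult)
    show "orthogonal_matrix g" if "g \<in> G" for g
      using that by (simp add: S rotational_symmetries_orthogonal)
    show "real_on_sphere I" if "p < N" "I \<in> F p" for p I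
      using real that by blast
  qed
  qed
qed

section \<open>Orthonormalisation of a sequence of functions\<close>

text \<open>The Gram-Schmidt process for a positive semidefinite form \<open>B\<close>. A term that depends on the previous
  ones up to a null vector of \<open>B\<close> yields the zero function, because division by zero gives zero.\<close>

function orthonormalized :: "(('a \<Rightarrow> real) \<Rightarrow> ('a \<Rightarrow> real) \<Rightarrow> real) \<Rightarrow> (nat \<Rightarrow> 'a \<Rightarrow> real) \<Rightarrow> nat \<Rightarrow> 'a \<Rightarrow> real" where
  "orthonormalized B f n =
     (let h = (\<lambda>x. f n x - (\<Sum>k<n. B (f n) (orthonormalized B f k) * orthonormalized B f k x))
      in (\<lambda>x. h x / sqrt (B h h)))"
  by auto
termination by (relation "Wellfounded.measure (\<lambda>(B, f, n). n)") auto

declare orthonormalized.simps [simp del]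

text \<open>The form is only assumed bilinear on \<open>V\<close>, which allows integrals that exist only for some functions.\<close>

lemma orthonormalized_properties:
  assumes V: "function_space V" and f: "\<And>n. f n \<in> V"
    and sym: "\<And>u v. u \<in> V \<Longrightarrow> v \<in> V \<Longrightarrow> B u v = B v u"
    and lin: "\<And>u v w c. u \<in> V \<Longrightarrow> v \<in> V \<Longrightarrow> w \<in> V \<Longrightarrow> B u (\<lambda>x. v x + c * w x) = B u v + c * B u w"
    and nonneg: "\<And>u. u \<in> V \<Longrightarrow> B u u \<ge> 0"
  defines "e \<equiv> orthonormalized B f"
  shows "e n \<in> V" and "m \<noteq> n \<Longrightarrow> B (e m) (e n) = 0"
    and "B (e n) (e n) = 1 \<or> e n = (\<lambda>x. 0)"
    and "B (\<lambda>x. f n x - (\<Sum>k\<le>n. B (f n) (e k) * e k x)) (\<lambda>x. f n x - (\<Sum>k\<le>n. B (f n) (e k) * e k x)) = 0"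
proof -
  have V0: "(\<lambda>x. 0) \<in> V" by (rule function_space_zero[OF V])
  have B0: "B u (\<lambda>x. 0) = 0" if "u \<in> V" for u
    using lin[OF that V0 V0, of 1] by simp
  have scale: "(\<lambda>x. c * u x) \<in> V" "B w (\<lambda>x. c * u x) = c * B w u" if "u \<in> V" "w \<in> V" for u w c
    using function_space_add[OF V V0 that(1), of c] lin[OF that(2) V0 that(1), of c] B0[OF that(2)] by simp_all
  have sum: "B u (\<lambda>x. \<Sum>k\<in>I. c k * g k x) = (\<Sum>k\<in>I. c k * B u (g k))"
    if "finite I" "u \<in> V" "\<And>k. k \<in> I \<Longrightarrow> g k \<in> V" for I u g and c :: "nat \<Rightarrow> real"
    using that
  proof (induction I rule: finite_induct)
    case (insert i I)
    have gI: "(\<lambda>x. \<Sum>k\<in>I. c k * g k x) \<in> V"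
      by (rule function_space_sum[OF V]) (use insert in auto)
    have "B u (\<lambda>x. \<Sum>k\<in>insert i I. c k * g k x) = B u (\<lambda>x. (\<Sum>k\<in>I. c k * g k x) + c i * g i x)"
      using insert.hyps by (simp add: add.commute)
    also have "\<dots> = B u (\<lambda>x. \<Sum>k\<in>I. c k * g k x) + c i * B u (g i)"
      by (rule lin) (use insert gI in auto)
    finally show ?case using insert by simp
  qed (simp add: B0)
  define h where "h n = (\<lambda>x. f n x - (\<Sum>k<n. B (f n) (e k) * e k x))" for n
  have e_eq: "e n = (\<lambda>x. (1 / sqrt (B (h n) (h n))) * h n x)" for n
    unfolding e_def h_def by (subst orthonormalized.simps) (simp add: Let_def)
  have main: "e n \<in> V \<and> h n \<in> V \<and> (B (e n) (e n) = 1 \<or> e n = (\<lambda>x. 0)) \<and> (\<forall>m<n. B (e m) (e n) = 0)" for n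
  proof (induction n rule: less_induct)
    case (less n)
    have eV: "e k \<in> V" if "k < n" for k using less[OF that] by blast
    have "(\<lambda>x. \<Sum>k<n. B (f n) (e k) * e k x) \<in> V"
      by (rule function_space_sum[OF V]) (use eV in auto)
    from function_space_add[OF V f this, of n "-1"] have hV: "h n \<in> V" by (simp add: h_def)
    have enV: "e n \<in> V" unfolding e_eq by (rule scale(1)[OF hV hV])
    have eh: "B (e m) (h n) = 0" if m: "m < n" for m
    proof -
      have orth: "B (e m) (e k) = 0" if "k < n" "k \<noteq> m" for k
        using less[OF that(1)] less[OF m] m that sym[OF eV[OF m] eV[OF that(1)]]
        by (cases m k rule: linorder_cases) auto
      have sV: "(\<lambda>x. \<Sum>k<n. B (f n) (e k) * e k x) \<in> V"
        by (rule function_space_sum[OF V]) (use eV in auto)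
      have "B (e m) (h n) = B (e m) (f n) - B (e m) (\<lambda>x. \<Sum>k<n. B (f n) (e k) * e k x)"
        using lin[OF eV[OF m] f sV, of n "-1"] by (simp add: h_def)
      also have "\<dots> = B (e m) (f n) - (\<Sum>k<n. B (f n) (e k) * B (e m) (e k))"
        using sum[of "{..<n}" "e m" e "\<lambda>k. B (f n) (e k)"] eV m by simp
      also have "(\<Sum>k<n. B (f n) (e k) * B (e m) (e k)) = (\<Sum>k<n. if k = m then B (f n) (e m) * B (e m) (e m) else 0)"
        by (rule sum.cong) (auto simp: orth)
      also have "\<dots> = B (f n) (e m) * B (e m) (e m)" using m by simp
      finally show ?thesis
        using less[OF m] sym[OF eV[OF m] f, of n] B0[OF f] by auto
    qed
    have "B (e m) (e n) = 0" if "m < n" for m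
      unfolding e_eq[of n] scale(2)[OF hV eV[OF that]] eh[OF that] by simp
    moreover have "B (e n) (e n) = 1 \<or> e n = (\<lambda>x. 0)"
    proof (cases "B (h n) (h n) = 0")
      case True
      then show ?thesis by (simp add: e_eq)
    next
      case False
      then have pos: "B (h n) (h n) > 0" using nonneg[OF hV] by simp
      let ?c = "1 / sqrt (B (h n) (h n))"
      have "B (e n) (e n) = ?c * (?c * B (h n) (h n))"
        unfolding e_eq scale(2)[OF hV scale(1)[OF hV hV]] sym[OF scale(1)[OF hV hV] hV] scale(2)[OF hV hV] ..
      also have "\<dots> = 1" using pos by (simp add: field_simps)
      finally show ?thesis by blast
    qed
    ultimately show ?case using enV hV by blast
  qed
  show "e n \<in> V" and "B (e n) (e n) = 1 \<or> e n = (\<lambda>x. 0)" using main by blast+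
  show "B (e m) (e n) = 0" if "m \<noteq> n" for m
    using main[of m] main[of n] that sym[of "e m" "e n"] by (cases m n rule: linorder_cases) auto
  have hV: "h n \<in> V" and eV: "e k \<in> V" for k using main by blast+
  let ?res = "\<lambda>x. f n x - (\<Sum>k\<le>n. B (f n) (e k) * e k x)"
  have res: "?res = (\<lambda>x. h n x + (- B (f n) (e n)) * e n x)"
    by (simp add: h_def lessThan_Suc_atMost[symmetric] algebra_simps)
  show "B ?res ?res = 0"
  proof (cases "B (h n) (h n) = 0")
    case True
    then have "e n = (\<lambda>x. 0)" by (simp add: e_eq)
    then show ?thesis using True by (simp add: res)
  next
    case False
    then have pos: "B (h n) (h n) > 0" using nonneg[OF hV] by simp
    have sV: "(\<lambda>x. \<Sum>k<n. B (f n) (e k) * e k x) \<in> V"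
      by (rule function_space_sum[OF V]) (use eV in auto)
    have s0: "B (e n) (\<lambda>x. \<Sum>k<n. B (f n) (e k) * e k x) = 0"
    proof -
      have "B (e n) (\<lambda>x. \<Sum>k<n. B (f n) (e k) * e k x) = (\<Sum>k<n. B (f n) (e k) * B (e n) (e k))"
        by (rule sum) (use eV in auto)
      also have "\<dots> = 0"
        using main[of n] sym[OF eV eV] by (intro sum.neutral) auto
      finally show ?thesis .
    qed
    have "B (e n) (f n) = B (e n) (\<lambda>x. h n x + 1 * (\<Sum>k<n. B (f n) (e k) * e k x))"
      by (simp add: h_def)
    also have "\<dots> = B (e n) (h n)"
      by (subst lin[OF eV hV sV]) (simp add: s0)
    also have "\<dots> = B (h n) (e n)" by (rule sym[OF eV hV])
    also have "\<dots> = (1 / sqrt (B (h n) (h n))) * B (h n) (h n)"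
      unfolding e_eq by (rule scale(2)[OF hV hV])
    also have "\<dots> = sqrt (B (h n) (h n))" using pos by (simp add: field_simps)
    finally have "B (f n) (e n) = sqrt (B (h n) (h n))" using sym[OF eV f] by simp
    then have "?res = (\<lambda>x. 0)" unfolding res using pos by (simp add: e_eq)
    then show ?thesis using B0[OF V0] by simp
  qed
qed

section \<open>Real basis functions\<close>

locale finite_rotation_group = finite_matrix_group +
  assumes orthogonal_elements: "g \<in> G \<Longrightarrow> orthogonal_matrix g"
begin

lemma inv_eq_transpose:
  assumes "g \<in> G"
  shows "inv\<^bsub>matrix_group G\<^esub> g = transpose g"
proof -
  let ?h = "inv\<^bsub>matrix_group G\<^esub> g"
  have "?h = ?h ** (g ** transpose g)"
    using orthogonal_elements[OF assms] by (simp add: orthogonal_matrix_def)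
  also have "\<dots> = (?h ** g) ** transpose g" by (simp only: matrix_mul_assoc)
  also have "?h ** g = mat 1" using l_inv[of g] assms by simp
  finally show ?thesis by simp
qed

lemma transpose_closed: "g \<in> G \<Longrightarrow> transpose g \<in> G"
  using inv_closed[of g] by (simp add: inv_eq_transpose)

text \<open>A vector function is encoded as a function of the index of the component and of the point, so that a
  family of components is a single real function.\<close>

definition equivariant :: "nat \<Rightarrow> (real^3^3 \<Rightarrow> nat \<Rightarrow> nat \<Rightarrow> real) \<Rightarrow> (nat \<times> (real^3) \<Rightarrow> real) set" where
  "equivariant d r = {J. (\<forall>i<d. continuous_on UNIV (\<lambda>x. J (i, x))) \<and>
     (\<forall>g\<in>G. \<forall>i<d. \<forall>x. J (i, g *v x) = (\<Sum>l<d. r g i l * J (l, x)))}"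

definition component_inner :: "nat \<Rightarrow> nat \<Rightarrow> (nat \<times> (real^3) \<Rightarrow> real) \<Rightarrow> (nat \<times> (real^3) \<Rightarrow> real) \<Rightarrow> real" where
  "component_inner i j J J' = (LINT x|sphere_measure. J (i, x) * J' (j, x))"

lemma equivariantD:
  assumes "J \<in> equivariant d r" "i < d"
  shows "continuous_on UNIV (\<lambda>x. J (i, x))" "g \<in> G \<Longrightarrow> J (i, g *v x) = (\<Sum>l<d. r g i l * J (l, x))"
  using assms by (auto simp: equivariant_def)

lemma equivariant_function_space: "function_space (equivariant d r)"
  by (auto simp: function_space_def equivariant_def algebra_simps sum.distrib sum_distrib_left
      intro!: continuous_intros)

lemma integrable_components:
  assumes "J \<in> equivariant d r" "i < d" "J' \<in> equivariant d' r'" "j < d'"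
  shows "integrable sphere_measure (\<lambda>x. J (i, x) * J' (j, x))"
  by (intro integrable_continuous_sphere_measure continuous_intros equivariantD(1)[OF assms(1,2)]
      equivariantD(1)[OF assms(3,4)])

text \<open>Rotation invariance of the measure.\<close>

lemma component_inner_intertwines:
  assumes r: "orthogonal_rep (matrix_group G) {..<d} r" and r': "orthogonal_rep (matrix_group G) {..<d'} r'"
    and J: "J \<in> equivariant d r" and J': "J' \<in> equivariant d' r'" and g: "g \<in> G" and i: "i < d" and j: "j < d'"
  shows "(\<Sum>k<d. r g i k * component_inner k j J J') = (\<Sum>k<d'. component_inner i k J J' * r' g k j)"
proof -
  have inv: "component_inner i b J J' = (\<Sum>k<d. \<Sum>l<d'. r g i k * r' g b l * component_inner k l J J')" if b: "b < d'" for b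
  proof -
    have "component_inner i b J J' = (LINT x|sphere_measure. J (i, g *v x) * J' (b, g *v x))"
      unfolding component_inner_def
      by (rule integral_sphere_measure_rotation[symmetric, where f = "\<lambda>x. J (i, x) * J' (b, x)"])
         (use orthogonal_elements[OF g] borel_measurable_integrable[OF integrable_components[OF J i J' b]] in auto)
    also have "\<dots> = (LINT x|sphere_measure. (\<Sum>k<d. \<Sum>l<d'. r g i k * r' g b l * (J (k, x) * J' (l, x))))"
      by (simp add: equivariantD(2)[OF J i g] equivariantD(2)[OF J' b g] sum_product mult_ac)
    also have "\<dots> = (\<Sum>k<d. LINT x|sphere_measure. (\<Sum>l<d'. r g i k * r' g b l * (J (k, x) * J' (l, x))))"
      by (rule Bochner_Integration.integral_sum)
         (intro Bochner_Integration.integrable_sum integrable_mult_right integrable_components[OF J _ J'], auto)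
    also have "\<dots> = (\<Sum>k<d. \<Sum>l<d'. LINT x|sphere_measure. r g i k * r' g b l * (J (k, x) * J' (l, x)))"
      by (intro sum.cong refl Bochner_Integration.integral_sum)
         (intro integrable_mult_right integrable_components[OF J _ J'], auto)
    also have "\<dots> = (\<Sum>k<d. \<Sum>l<d'. r g i k * r' g b l * component_inner k l J J')"
      by (simp only: component_inner_def integral_mult_right_zero)
    finally show ?thesis .
  qed
  have "(\<Sum>b<d'. component_inner i b J J' * r' g b j)
      = (\<Sum>b<d'. \<Sum>k<d. \<Sum>l<d'. r g i k * component_inner k l J J' * (r' g b l * r' g b j))"
    by (intro sum.cong refl) (simp add: inv sum_distrib_left sum_distrib_right mult_ac)
  also have "\<dots> = (\<Sum>k<d. \<Sum>l<d'. \<Sum>b<d'. r g i k * component_inner k l J J' * (r' g b l * r' g b j))"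
    by (rule trans[OF sum.swap], rule sum.cong[OF refl], rule sum.swap)
  also have "\<dots> = (\<Sum>k<d. \<Sum>l<d'. r g i k * component_inner k l J J' * of_bool (l = j))"
    using orthogonal_rep_columns[OF r', of g _ j] g j by (simp flip: sum_distrib_left)
  also have "\<dots> = (\<Sum>k<d. r g i k * component_inner k j J J')"
    using j by (intro sum.cong refl) (simp only: sum_of_bool finite_lessThan lessThan_iff if_True)
  finally show ?thesis ..
qed

lemma component_inner_disjoint:
  assumes r: "orthogonal_rep (matrix_group G) {..<d} r" and r': "orthogonal_rep (matrix_group G) {..<d'} r'"
    and disj: "disjoint_reps (matrix_group G) {..<d} r {..<d'} r'"
    and J: "J \<in> equivariant d r" and J': "J' \<in> equivariant d' r'" and i: "i < d" and j: "j < d'"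
  shows "component_inner i j J J' = 0"
proof -
  have "\<forall>i\<in>{..<d}. \<forall>j\<in>{..<d'}. component_inner i j J J' = 0"
    by (rule mp[OF spec[OF disj[unfolded disjoint_reps_def], of "\<lambda>i j. component_inner i j J J'"]])
       (use component_inner_intertwines[OF r r' J J'] in auto)
  then show ?thesis using i j by blast
qed

text \<open>By Schur's lemma the first components determine all inner products.\<close>

lemma component_inner_same:
  assumes r: "orthogonal_rep (matrix_group G) {..<d} r" and irr: "absolutely_irreducible (matrix_group G) {..<d} r"
    and J: "J \<in> equivariant d r" and J': "J' \<in> equivariant d r" and i: "i < d" and j: "j < d"
  shows "component_inner i j J J' = of_bool (i = j) * component_inner 0 0 J J'"
proof -
  have "commutes_with (matrix_group G) {..<d} r (\<lambda>i j. component_inner i j J J')"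
    unfolding commutes_with_def using component_inner_intertwines[OF r r J J'] by auto
  then obtain c where c: "\<forall>i\<in>{..<d}. \<forall>j\<in>{..<d}. component_inner i j J J' = c * of_bool (i = j)"
    using mp[OF spec[OF irr[unfolded absolutely_irreducible_def], of "\<lambda>i j. component_inner i j J J'"]] by blast
  have "component_inner i j J J' = c * of_bool (i = j)" "component_inner 0 0 J J' = c"
    using c i j by auto
  then show ?thesis by simp
qed

text \<open>Up to a factor, the projection of a monomial to an isotypic component, using the row \<open>k\<close> of the representation.\<close>

definition projected_monomial ::
    "(real^3^3 \<Rightarrow> nat \<Rightarrow> nat \<Rightarrow> real) \<Rightarrow> nat \<times> nat \<times> nat \<Rightarrow> nat \<Rightarrow> nat \<times> (real^3) \<Rightarrow> real" where
  "projected_monomial r m k = (\<lambda>(i, x). \<Sum>g\<in>G. r g k i * monomial m (g *v x))"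

lemma projected_monomial_equivariant:
  assumes r: "orthogonal_rep (matrix_group G) {..<d} r" and k: "k < d"
  shows "projected_monomial r m k \<in> equivariant d r"
  unfolding equivariant_def
proof (intro CollectI conjI allI impI ballI)
  fix i assume i: "i < d"
  show "continuous_on UNIV (\<lambda>x. projected_monomial r m k (i, x))"
    unfolding projected_monomial_def prod.case
    by (intro continuous_intros continuous_on_compose2[OF continuous_on_monomial[of UNIV]]
        matrix_vector_mult_linear_continuous_on) auto
  fix h x assume h: "h \<in> G"
  have "projected_monomial r m k (i, h *v x)
      = (\<Sum>g\<in>G. r ((g ** h) ** transpose h) k i * monomial m ((g ** h) *v x))"
  proof -
    have hh: "(g ** h) ** transpose h = g" for g
      using orthogonal_elements[OF h] by (simp add: orthogonal_matrix_def flip: matrix_mul_assoc)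
    show ?thesis
      by (simp only: projected_monomial_def prod.case matrix_vector_mul_assoc hh)
  qed
  also have "\<dots> = (\<Sum>g\<in>G. r (g ** transpose h) k i * monomial m (g *v x))"
    using sum_translate_right[of h "\<lambda>g. r (g ** transpose h) k i * monomial m (g *v x)"] h by simp
  also have "\<dots> = (\<Sum>g\<in>G. \<Sum>l<d. r h i l * (r g k l * monomial m (g *v x)))"
  proof (rule sum.cong[OF refl])
    fix g assume g: "g \<in> G"
    have "r (g ** transpose h) k i = (\<Sum>l<d. r g k l * r (transpose h) l i)"
      using orthogonal_repD(3)[OF r, of g "transpose h" k i] g transpose_closed[OF h] k i by simp
    also have "\<dots> = (\<Sum>l<d. r g k l * r h i l)"
      using orthogonal_repD(4)[OF r, of h _ i] h i by (simp add: inv_eq_transpose)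
    finally show "r (g ** transpose h) k i * monomial m (g *v x) = (\<Sum>l<d. r h i l * (r g k l * monomial m (g *v x)))"
      by (simp add: sum_distrib_left sum_distrib_right mult_ac)
  qed
  also have "\<dots> = (\<Sum>l<d. r h i l * projected_monomial r m k (l, x))"
    by (subst sum.swap) (simp add: projected_monomial_def sum_distrib_left)
  finally show "projected_monomial r m k (i, h *v x) = (\<Sum>l<d. r h i l * projected_monomial r m k (l, x))" .
qed

lemma monomial_eq_sum_projected:
  assumes L: "irrep_list N d r"
    and delta: "\<And>g. g \<in> G \<Longrightarrow> (\<Sum>p<N. real (d p) / real (card G) * (\<Sum>i<d p. r p g i i))
      = of_bool (g = mat 1)"
  shows "monomial m x = (\<Sum>p<N. real (d p) / real (card G) * (\<Sum>i<d p. projected_monomial (r p) m i (i, x)))"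
proof -
  have "(\<Sum>p<N. real (d p) / real (card G) * (\<Sum>i<d p. projected_monomial (r p) m i (i, x)))
      = (\<Sum>p<N. \<Sum>g\<in>G. real (d p) / real (card G) * (\<Sum>i<d p. r p g i i) * monomial m (g *v x))"
    unfolding projected_monomial_def prod.case
    by (intro sum.cong refl, subst sum.swap) (simp add: sum_distrib_left sum_distrib_right mult_ac)
  also have "\<dots> = (\<Sum>g\<in>G. (\<Sum>p<N. real (d p) / real (card G) * (\<Sum>i<d p. r p g i i)) * monomial m (g *v x))"
    by (subst sum.swap) (simp add: sum_distrib_right)
  also have "\<dots> = (\<Sum>g\<in>G. of_bool (g = mat 1) * monomial m (g *v x))"
    by (rule sum.cong[OF refl]) (simp only: delta)
  also have "\<dots> = monomial m x"
    using finite_group one_closed by (simp add: sum_of_bool)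
  finally show ?thesis ..
qed

definition complex_family :: "nat \<Rightarrow> (nat \<times> (real^3) \<Rightarrow> real) \<Rightarrow> real^3 \<Rightarrow> complex Matrix.vec" where
  "complex_family d J x = Matrix.vec d (\<lambda>i. complex_of_real (J (i, x)))"

lemma component_L2:
  assumes "J \<in> equivariant d r" "i < d"
  shows "(\<lambda>x. complex_of_real (J (i, x))) \<in> sphere_L2"
  by (intro sphere_L2_continuous continuous_intros equivariantD(1)[OF assms])

lemma sphere_inner_of_real:
  "sphere_inner (\<lambda>x. complex_of_real (J (i, x))) (\<lambda>x. complex_of_real (J' (j, x))) = of_real (component_inner i j J J')"
  by (simp add: sphere_inner_def component_inner_def flip: of_real_mult)

text \<open>For each representation the projected monomials are orthonormalised with respect to the inner product of
  the first components. The closed span of the result contains the monomials and hence everything.\<close>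

theorem real_complete_basis_family:
  assumes L: "irrep_list N d r"
    and delta: "\<And>g. g \<in> G \<Longrightarrow> (\<Sum>p<N. real (d p) / real (card G) * (\<Sum>i<d p. r p g i i))
      = of_bool (g = mat 1)"
  shows "\<exists>F. complete_basis_family G N d (\<lambda>p. complex_rep (d p) (r p)) F \<and>
    (\<forall>p<N. \<forall>I\<in>F p. real_on_sphere I)"
proof -
  have rp: "d p > 0" "orthogonal_rep (matrix_group G) {..<d p} (r p)"
    "absolutely_irreducible (matrix_group G) {..<d p} (r p)" if "p < N" for p
    using L that by (auto simp: irrep_list_def)
  define B where "B = component_inner 0 0"
  have B00: "component_inner 0 0 J J' = B J J'" for J J' by (simp add: B_def)
  \<comment> \<open>The index \<open>n\<close> enumerates the monomials together with the rows of the representation; the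
    remainder keeps the row in range.\<close>
  define f where "f p n = (case from_nat n of (m, k) \<Rightarrow> projected_monomial (r p) m (k mod d p))" for p n
  define e where "e p = orthonormalized B (f p)" for p
  let ?V = "\<lambda>p. equivariant (d p) (r p)"
  have fV: "f p n \<in> ?V p" if "p < N" for p n
    unfolding f_def using rp[OF that] by (auto split: prod.split intro!: projected_monomial_equivariant)
  have Bsym: "B u v = B v u" for u v by (simp add: B_def component_inner_def mult.commute)
  have Blin: "B u (\<lambda>x. v x + c * w x) = B u v + c * B u w"
    if p: "p < N" and "u \<in> ?V p" "v \<in> ?V p" "w \<in> ?V p" for p u v w c
  proof -
    have "B u (\<lambda>x. v x + c * w x) = (LINT x|sphere_measure. u (0, x) * v (0, x) + c * (u (0, x) * w (0, x)))"
      by (simp add: B_def component_inner_def algebra_simps)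
    then show ?thesis
      using integrable_components[OF that(2) rp(1)[OF p] that(3) rp(1)[OF p]]
        integrable_components[OF that(2) rp(1)[OF p] that(4) rp(1)[OF p]]
      by (simp add: B_def component_inner_def)
  qed
  have Bnn: "B u u \<ge> 0" for u by (simp add: B_def component_inner_def)
  have eV: "e p n \<in> ?V p" if p: "p < N" for p m n
    unfolding e_def
    by (rule orthonormalized_properties(1)[where B = B and V = "?V p" and f = "f p"])
       (use equivariant_function_space fV[OF p] Bsym Blin[OF p] Bnn  in blast)+
  have e_orth: "B (e p m) (e p n) = 0" if p: "p < N" and "m \<noteq> n" for p m n
    unfolding e_def
    by (rule orthonormalized_properties(2)[where B = B and V = "?V p" and f = "f p"])
       (use equivariant_function_space fV[OF p] Bsym Blin[OF p] Bnn that in blast)+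
  have e_norm: "B (e p n) (e p n) = 1 \<or> e p n = (\<lambda>x. 0)" if p: "p < N" for p m n
    unfolding e_def
    by (rule orthonormalized_properties(3)[where B = B and V = "?V p" and f = "f p"])
       (use equivariant_function_space fV[OF p] Bsym Blin[OF p] Bnn  in blast)+
  have e_res: "B (\<lambda>x. f p n x - (\<Sum>k\<le>n. B (f p n) (e p k) * e p k x)) (\<lambda>x. f p n x - (\<Sum>k\<le>n. B (f p n) (e p k) * e p k x)) = 0" if p: "p < N" for p m n
    unfolding e_def
    by (rule orthonormalized_properties(4)[where B = B and V = "?V p" and f = "f p"])
       (use equivariant_function_space fV[OF p] Bsym Blin[OF p] Bnn  in blast)+
  define F where "F p = {complex_family (d p) (e p n) | n. B (e p n) (e p n) = 1}" for p
  have idx: "vec_index (complex_family (d p) J x) j = complex_of_real (J (j, x))" if "j < d p" for p J x j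
    using that by (simp add: complex_family_def)
  define K where "K = {(p, I, j). p < N \<and> I \<in> F p \<and> j < d p}"
  define c where "c = (\<lambda>(p :: nat, I :: real^3 \<Rightarrow> complex Matrix.vec, j) x. vec_index (I x) j)"
  have inner: "sphere_inner (\<lambda>x. vec_index (complex_family (d p) (e p m) x) i) (\<lambda>x. vec_index (complex_family (d q) (e q n) x) j)
      = of_bool (p = q \<and> i = j \<and> m = n)"
    if p: "p < N" and q: "q < N" and i: "i < d p" and j: "j < d q"
      and mn: "B (e p m) (e p m) = 1" "B (e q n) (e q n) = 1" for p q m n i j
  proof -
    have *: "sphere_inner (\<lambda>x. vec_index (complex_family (d p) (e p m) x) i) (\<lambda>x. vec_index (complex_family (d q) (e q n) x) j)
        = of_real (component_inner i j (e p m) (e q n))"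
      by (simp only: idx[OF i] idx[OF j] sphere_inner_of_real)
    show ?thesis
    proof (cases "p = q")
      case True
      have "component_inner i j (e p m) (e p n) = of_bool (i = j) * B (e p m) (e p n)"
        unfolding B_def using component_inner_same[OF rp(2,3)[OF p] eV[OF p] eV[OF p] i, of j] j True by simp
      also have "\<dots> = of_bool (i = j \<and> m = n)"
        using e_orth[OF p, of m n] mn True by (cases "m = n") auto
      finally show ?thesis using * True by simp
    next
      case False
      have "component_inner i j (e p m) (e q n) = 0"
        by (rule component_inner_disjoint[OF rp(2)[OF p] rp(2)[OF q] _ eV[OF p] eV[OF q] i j])
           (use L p q False in \<open>simp add: irrep_list_def\<close>)
      then show ?thesis using * False by simp
    qed
  qed
  \<comment> \<open>The family is indexed by the functions themselves, so equal functions must have equal numbers.\<close>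
  have inj: "m = n" if p: "p < N" and eq: "complex_family (d p) (e p m) = complex_family (d p) (e p n)"
    and mn: "B (e p m) (e p m) = 1" "B (e p n) (e p n) = 1" for p m n
    using inner[OF p p rp(1)[OF p] rp(1)[OF p] mn] inner[OF p p rp(1)[OF p] rp(1)[OF p] mn(1) mn(1)] eq
    by (cases "m = n") auto
  have cL: "(\<lambda>x. vec_index (complex_family (d p) (e p n) x) j) \<in> sphere_L2" if "p < N" "j < d p" for p n j
    using component_L2[OF eV[OF that(1)] that(2)] by (simp only: idx[OF that(2)])
  have ons: "orthonormal_system K c"
    unfolding orthonormal_system_def
  proof (intro conjI ballI)
    fix k assume "k \<in> K"
    then obtain p m i where p: "p < N" and i: "i < d p" and m: "B (e p m) (e p m) = 1"
      and k: "k = (p, complex_family (d p) (e p m), i)"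
      unfolding K_def F_def by blast
    show "c k \<in> sphere_L2" using cL[OF p i] by (simp add: k c_def)
    fix l assume "l \<in> K"
    then obtain q n j where q: "q < N" and j: "j < d q" and n: "B (e q n) (e q n) = 1"
      and l: "l = (q, complex_family (d q) (e q n), j)"
      unfolding K_def F_def by blast
    have "k = l \<longleftrightarrow> p = q \<and> i = j \<and> m = n"
      using inj[OF p _ m, of n] n by (auto simp: k l)
    then show "sphere_inner (c k) (c l) = (if k = l then 1 else 0)"
      using inner[OF p q i j m n] by (simp add: k l c_def)
  qed
  have bf: "basis_function G (d p) (complex_rep (d p) (r p)) I" if p: "p < N" and I: "I \<in> F p" for p I
  proof -
    obtain n where n: "B (e p n) (e p n) = 1" and I: "I = complex_family (d p) (e p n)"
      using I unfolding F_def by blast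
    show ?thesis
      unfolding basis_function_def
    proof (intro conjI ballI)
      show "I x \<in> carrier_vec (d p)" for x by (simp add: I complex_family_def)
      show "orthonormal_system {..<d p} (\<lambda>j x. vec_index (I x) j)"
        unfolding orthonormal_system_def I
        using cL[OF p] inner[OF p p _ _ n n] by auto
      fix g x assume g: "g \<in> G"
      show "I (matrix_inv g *v x) = transpose_mat (complex_rep (d p) (r p) g) *\<^sub>v I x"
      proof (rule eq_vecI)
        fix i assume "i < dim_vec (transpose_mat (complex_rep (d p) (r p) g) *\<^sub>v I x)"
        then have i: "i < d p" by simp
        have "e p n (i, transpose g *v x) = (\<Sum>l<d p. r p (transpose g) i l * e p n (l, x))"
          by (rule equivariantD(2)[OF eV[OF p] i transpose_closed[OF g]])
        also have "\<dots> = (\<Sum>l<d p. r p g l i * e p n (l, x))"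
          using orthogonal_repD(4)[OF rp(2)[OF p], of g i] g i by (simp add: inv_eq_transpose)
        finally show "vec_index (I (matrix_inv g *v x)) i = vec_index (transpose_mat (complex_rep (d p) (r p) g) *\<^sub>v I x) i"
          using i by (simp add: I complex_family_def matrix_inv_orthogonal[OF orthogonal_elements[OF g]]
              scalar_prod_def lessThan_atLeast0 del: transpose_matrix_vector)
      qed (simp add: I complex_family_def)
    qed
  qed
  have Vcl: "closed_subspace (mean_square_span K c)"
    by (rule mean_square_span_closed) (use ons in \<open>simp add: orthonormal_system_def\<close>)
  let ?S = "mean_square_span K c"
  have comp_in: "(\<lambda>x. complex_of_real (e p n (i, x))) \<in> ?S" if p: "p < N" and i: "i < d p" and n: "B (e p n) (e p n) = 1" for p n i
  proof -
    have k: "(p, complex_family (d p) (e p n), i) \<in> K" using p i n unfolding K_def F_def by blast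
    have "c (p, complex_family (d p) (e p n), i) \<in> ?S"
      by (rule mean_square_span_base[OF k]) (use ons k in \<open>simp add: orthonormal_system_def\<close>)
    then show ?thesis by (simp add: c_def idx[OF i])
  qed
  have zero_in: "(\<lambda>x. 0) \<in> ?S"
    unfolding mean_square_span_def
    by (auto intro!: sphere_L2_continuous exI[of _ "{}"] simp: mean_square_def)
  have e_in: "(\<lambda>x. complex_of_real (e p n (i, x))) \<in> ?S" if p: "p < N" and i: "i < d p" for p n i
    using e_norm[OF p, of n] comp_in[OF p i, of n] zero_in by auto
  have f_in: "(\<lambda>x. complex_of_real (f p n (i, x))) \<in> ?S" if p: "p < N" and i: "i < d p" for p n i
  proof (rule closed_subspace_cong[OF Vcl])
    let ?res = "\<lambda>x. f p n x - (\<Sum>k\<le>n. B (f p n) (e p k) * e p k x)"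
    show "(\<lambda>x. complex_of_real (f p n (i, x))) \<in> sphere_L2" by (rule component_L2[OF fV[OF p] i])
    show "(\<lambda>x. \<Sum>k\<le>n. complex_of_real (B (f p n) (e p k)) * complex_of_real (e p k (i, x))) \<in> ?S"
      by (rule closed_subspace_sum[OF Vcl zero_in]) (simp_all add: e_in[OF p i])
    have sumV: "(\<lambda>x. \<Sum>k\<le>n. B (f p n) (e p k) * e p k x) \<in> ?V p"
      by (rule function_space_sum[OF equivariant_function_space]) (simp_all add: eV[OF p])
    from function_space_add[OF equivariant_function_space fV[OF p] this, of n "-1"]
    have resV: "?res \<in> ?V p" by simp
    have "mean_square (\<lambda>x. complex_of_real (f p n (i, x)) -
        (\<Sum>k\<le>n. complex_of_real (B (f p n) (e p k)) * complex_of_real (e p k (i, x))))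
        = component_inner i i ?res ?res"
      unfolding mean_square_def component_inner_def
      by (simp add: power2_eq_square flip: of_real_mult of_real_sum of_real_diff)
    also have "\<dots> = B ?res ?res"
      using component_inner_same[OF rp(2,3)[OF p] resV resV i i] by (simp add: B00)
    also have "\<dots> = 0" by (rule e_res[OF p])
    finally show "mean_square (\<lambda>x. complex_of_real (f p n (i, x)) -
        (\<Sum>k\<le>n. complex_of_real (B (f p n) (e p k)) * complex_of_real (e p k (i, x)))) = 0" .
  qed
  have pm_in: "(\<lambda>x. complex_of_real (projected_monomial (r p) m i (i, x))) \<in> ?S" if "p < N" "i < d p" for p m i
    using f_in[OF that, of "to_nat (m, i)"] that by (simp add: f_def)
  have "(\<lambda>x. complex_of_real (monomial m x)) \<in> ?S" for m
  proof -
    have "(\<lambda>x. \<Sum>i<d p. 1 * complex_of_real (projected_monomial (r p) m i (i, x))) \<in> ?S" if "p < N" for p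
      by (rule closed_subspace_sum[OF Vcl zero_in]) (use pm_in that in simp_all)
    then have "(\<lambda>x. \<Sum>p<N. of_real (real (d p) / real (card G)) *
        (\<Sum>i<d p. 1 * complex_of_real (projected_monomial (r p) m i (i, x)))) \<in> ?S"
      by (rule closed_subspace_sum[OF Vcl zero_in, rotated]) simp_all
    then show ?thesis
      by (simp add: monomial_eq_sum_projected[OF L delta])
  qed
  then have S_all: "?S = sphere_L2" by (rule closed_subspace_eq_L2[OF Vcl])
  have "complete_orthonormal_system K c"
    unfolding complete_orthonormal_system_def
  proof (intro conjI ons ballI allI impI)
    fix f and \<epsilon> :: real assume f: "f \<in> sphere_L2" and \<epsilon>: "0 < \<epsilon>"
    have "f \<in> ?S" unfolding S_all by (rule f)
    then have "\<forall>\<epsilon>>0. \<exists>S a. finite S \<and> S \<subseteq> K \<and>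
        (LINT x|sphere_measure. (cmod (f x - (\<Sum>k\<in>S. a k * c k x)))\<^sup>2) < \<epsilon>"
      unfolding mean_square_span_def mean_square_def mem_Collect_eq by (rule conjunct2)
    from mp[OF spec[OF this] \<epsilon>]
    show "\<exists>S a. finite S \<and> S \<subseteq> K \<and> (LINT x|sphere_measure. (cmod (f x - (\<Sum>k\<in>S. a k * c k x)))\<^sup>2) < \<epsilon>" .
  qed
  then have "complete_basis_family G N d (\<lambda>p. complex_rep (d p) (r p)) F"
    unfolding complete_basis_family_def using bf by (simp add: K_def c_def)
  moreover have "\<forall>p<N. \<forall>I\<in>F p. real_on_sphere I"
    by (auto simp: F_def real_on_sphere_def complex_family_def)
  ultimately show ?thesis by blast
qed

end

lemma rotational_symmetries_group: "group (matrix_group (rotational_symmetries S))"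
proof (rule groupI)
  fix A assume "A \<in> carrier (matrix_group (rotational_symmetries S))"
  then have A: "A \<in> rotational_symmetries S" by simp
  have "transpose A ** A = mat 1"
    using rotational_symmetries_orthogonal[OF A] by (simp add: orthogonal_matrix_def)
  then show "\<exists>B\<in>carrier (matrix_group (rotational_symmetries S)).
      B \<otimes>\<^bsub>matrix_group (rotational_symmetries S)\<^esub> A = \<one>\<^bsub>matrix_group (rotational_symmetries S)\<^esub>"
    using transpose_rotational_symmetry[OF A] by (intro bexI[of _ "transpose A"]) simp_all
qed (simp_all add: rotational_symmetries_mult rotational_symmetries_one matrix_mul_assoc)

text \<open>The group of a solid of any size and orientation is a conjugate of the standard one, and the structure
  is carried over by conjugation.\<close>

lemma real_basis_if_sign_structured:
  assumes sim: "similar_about_origin X S" and str: "sign_structured (rotational_symmetries X)"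
  defines "G \<equiv> rotational_symmetries S"
  shows "\<exists>N d \<Gamma> F. unitary_irreps G N d \<Gamma> \<and> complete_basis_family G N d \<Gamma> F \<and> (\<forall>p<N. \<forall>I\<in>F p. real_on_sphere I)"
proof -
  obtain c Q where c: "c > 0" and Q: "orthogonal_matrix Q" and S: "S = (\<lambda>x. c *\<^sub>R (Q *v x)) ` X"
    using sim by (auto simp: similar_about_origin_def)
  define cj where "cj B = Q ** B ** transpose Q" for B
  have QQ: "transpose Q ** Q = mat 1" "Q ** transpose Q = mat 1"
    using Q by (simp_all add: orthogonal_matrix_def)
  have G: "G = cj ` rotational_symmetries X"
    unfolding G_def S cj_def by (rule rotational_symmetries_similar[OF Q c])
  have cj1: "cj (mat 1) = mat 1" by (simp add: cj_def QQ)
  have cjm: "cj A ** cj B = cj (A ** B)" for A B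
  proof -
    have "cj A ** cj B = Q ** A ** (transpose Q ** Q) ** B ** transpose Q"
      by (simp only: cj_def matrix_mul_assoc)
    then show ?thesis by (simp add: QQ cj_def matrix_mul_assoc)
  qed
  have cjt: "transpose (cj A) = cj (transpose A)" for A
    by (simp add: cj_def matrix_transpose_mul matrix_mul_assoc)
  have str: "finite (rotational_symmetries X)" "four_group \<subseteq> rotational_symmetries X" "cyc3 \<in> rotational_symmetries X"
    "\<exists>s\<in>rotational_symmetries X. s ** s = mat 1 \<and> s ** cyc3 ** s = transpose cyc3"
    "\<And>A. A \<in> rotational_symmetries X \<Longrightarrow> \<exists>d\<in>four_group. (d ** A) ** (d ** A) = mat 1 \<or>
        d ** A = cyc3 \<or> d ** A = transpose cyc3"
    using str by (auto simp: sign_structured_def)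
  obtain s where s: "s \<in> rotational_symmetries X" "s ** s = mat 1" "s ** cyc3 ** s = transpose cyc3"
    using str(4) by blast
  interpret group "matrix_group G" unfolding G_def by (rule rotational_symmetries_group)
  interpret finite_rotation_group G
    by unfold_locales (use str(1) in \<open>auto simp: G dest: rotational_symmetries_orthogonal[of _ S, folded G_def]
        intro: rotational_symmetries_orthogonal[of _ S, folded G_def, unfolded G]\<close>)
  define D1 D2 D3 where "D1 = diag3 1 (-1) (-1)" and "D2 = diag3 (-1) 1 (-1)" and "D3 = diag3 (-1) (-1) 1"
  note Ds = D1_def D2_def D3_def diag3_def cyc3_def mat3_mult mat3_one
  have V: "four_group = {mat 1, D1, D2, D3}"
    by (simp add: four_group_def D1_def D2_def D3_def)
  have mem: "cj A \<in> G" if "A \<in> rotational_symmetries X" for A using that by (simp add: G)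
  interpret sign_structured_group "matrix_group G" "cj D1" "cj D2" "cj D3" "cj cyc3" "cj s"
  proof (unfold_locales, simp_all only: matrix_group_simps cjm)
    show "cj D1 \<in> G" "cj D2 \<in> G" "cj D3 \<in> G" "cj cyc3 \<in> G" "cj s \<in> G"
      using str(2,3) s(1) by (auto simp: V intro!: mem)
    show "cj (D1 ** D1) = mat 1" "cj (D2 ** D2) = mat 1"
      "cj (D3 ** D3) = mat 1" "cj (s ** s) = mat 1"
      using cj1 by (simp_all add: s Ds)
    show "cj (D1 ** D2) = cj D3" "cj (D2 ** D1) = cj D3" "cj (D2 ** D3) = cj D1" "cj (D3 ** D2) = cj D1"
      "cj (D3 ** D1) = cj D2" "cj (D1 ** D3) = cj D2"
      "cj (cyc3 ** D1) = cj (D2 ** cyc3)" "cj (cyc3 ** D2) = cj (D3 ** cyc3)" "cj (cyc3 ** D3) = cj (D1 ** cyc3)"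
      by (simp_all add: Ds)
    have ic: "inv\<^bsub>matrix_group G\<^esub> cj cyc3 = cj (transpose cyc3)"
      using inv_eq_transpose[OF mem[OF str(3)]] by (simp add: cjt)
    show "cj (s ** cyc3 ** s) = inv\<^bsub>matrix_group G\<^esub> cj cyc3"
      by (simp add: s ic)
    fix a assume "a \<in> G"
    then obtain A where A: "A \<in> rotational_symmetries X" "a = cj A" unfolding G by blast
    obtain D where D: "D \<in> four_group" "(D ** A) ** (D ** A) = mat 1 \<or>
        D ** A = cyc3 \<or> D ** A = transpose cyc3"
      using str(5)[OF A(1)] by blast
    have "cj D \<in> {mat 1, cj D1, cj D2, cj D3}"
      using D(1) by (auto simp: V cj1)
    moreover have "cj D ** a ** (cj D ** a) = mat 1 \<or> cj D ** a = cj cyc3 \<or>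
        cj D ** a = inv\<^bsub>matrix_group G\<^esub> cj cyc3"
      unfolding A(2) cjm ic using D(2) cj1 by auto
    ultimately show "\<exists>d\<in>{mat 1, cj D1, cj D2, cj D3}.
        d ** a ** (d ** a) = mat 1 \<or> d ** a = cj cyc3 \<or> d ** a = inv\<^bsub>matrix_group G\<^esub> cj cyc3"
      by blast
  qed
  obtain N d r where L: "irrep_list N d r"
    and delta: "\<And>g. g \<in> G \<Longrightarrow>
       (\<Sum>p<N. real (d p) / real (card G) * (\<Sum>i<d p. r p g i i)) = of_bool (g = mat 1)"
    using complete_irrep_list_exists finite_group by auto
  have "unitary_irreps G N d (\<lambda>p. complex_rep (d p) (r p))"
    by (rule unitary_irreps_of_irrep_list[OF L delta])
  moreover obtain F where "complete_basis_family G N d (\<lambda>p. complex_rep (d p) (r p)) F"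
    "\<forall>p<N. \<forall>I\<in>F p. real_on_sphere I"
    using real_complete_basis_family[OF L delta] by blast
  ultimately show ?thesis by blast
qed

theorem corollary1:
  fixes G :: "(real^3^3) set"
  shows
    "(octahedral_group G \<or> icosahedral_group G \<longrightarrow>
        (\<exists>N d \<Gamma> F. unitary_irreps G N d \<Gamma> \<and> complete_basis_family G N d \<Gamma> F \<and>
           (\<forall>p<N. \<forall>I\<in>F p. real_on_sphere I))) \<and>
     (tetrahedral_group G \<longrightarrow>
        \<not> (\<exists>N d \<Gamma> F. unitary_irreps G N d \<Gamma> \<and> complete_basis_family G N d \<Gamma> F \<and>
           (\<forall>p<N. \<forall>I\<in>F p. real_on_sphere I)))"
proof (intro conjI impI)
  assume "octahedral_group G \<or> icosahedral_group G"
  then show "\<exists>N d \<Gamma> F. unitary_irreps G N d \<Gamma> \<and> complete_basis_family G N d \<Gamma> F \<and>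
           (\<forall>p<N. \<forall>I\<in>F p. real_on_sphere I)"
    unfolding octahedral_group_def icosahedral_group_def
    using real_basis_if_sign_structured[OF _ sign_structured_octahedron]
      real_basis_if_sign_structured[OF _ sign_structured_icosahedron] by blast
next
  assume "tetrahedral_group G"
  then show "\<not> (\<exists>N d \<Gamma> F. unitary_irreps G N d \<Gamma> \<and> complete_basis_family G N d \<Gamma> F \<and>
           (\<forall>p<N. \<forall>I\<in>F p. real_on_sphere I))"
    using tetrahedral_no_real_basis by blast
qed

end
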